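(* Let $M$ be the Weyl vertex operator algebra, let $n\ge 1$, let $\boldsymbol\lambda=(\lambda_0,\dots,\lambda_n)\in\mathbb{C}^{n+1}$ and $\boldsymbol\mu=(\mu_1,\dots,\mu_n)\in\mathbb{C}^n$, and assume $\Lambda=(\boldsymbol\lambda,\boldsymbol\mu)\neq 0$. Then for every integer $p\ge1$ the Whittaker module $M_1(\boldsymbol\lambda,\boldsymbol\mu)$ is an irreducible weak module for the orbifold vertex subalgebra $M^{\mathbb{Z}_p}=M^{\langle g_p\rangle}$.
   Context: The Weyl algebra $\widehat{\mathcal A}$ is the unital associative $\mathbb{C}$-algebra with generators $a(k),a^*(k)$, $k\in\mathbb{Z}$, and relations $[a(k),a^*(m)]=\delta_{k+m,0}$, $[a(k),a(m)]=[a^*(k),a^*(m)]=0$. $M$ is the simple $\widehat{\mathcal A}$-module generated by a vector $\mathbf 1$ with $a(k)\mathbf 1=a^*(k+1)\mathbf 1=0$ for $k\ge0$; as a vector space $M\cong\mathbb{C}[a(-k),a^*(-m): k>0,m\ge0]$. It carries a unique vertex algebra structure with vacuum $\mathbf 1$ and $Y(a(-1)\mathbf 1,z)=a(z)=\sum_{k}a(k)z^{-k-1}$, $Y(a^*(0)\mathbf 1,z)=a^*(z)=\sum_k a^*(k)z^{-k}$; with conformal vector $\omega=\frac12\bigl(a(-1)a^*(-1)-a(-2)a^*(0)\bigr)\mathbf 1$ it is a $\frac12\mathbb{Z}_{\ge0}$-graded vertex operator algebra of central charge $-1$. Weak modules (vector spaces with vertex operators satisfying lower truncation, the vacuum axiom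 and the Jacobi identity, with no grading required) are defined as for $\mathbb{Z}$-graded vertex operator algebras; an $\widehat{\mathcal A}$-module on which, for every vector $w$, $a(k)w=a^*(k)w=0$ for $k$ sufficiently large is naturally a weak $M$-module. $M_1(\boldsymbol\lambda,\boldsymbol\mu)=\widehat{\mathcal A}/I$, where $I$ is the left ideal generated by $a(k)-\lambda_k$ ($0\le k\le n$), $a^*(k)-\mu_k$ ($1\le k\le n$), and $a(k),a^*(k)$ ($k>n$). $g_p$ is the automorphism of $M$ of order $p$ determined by the automorphism $a(k)\mapsto\zeta_pa(k)$, $a^*(k)\mapsto\zeta_p^{-1}a^*(k)$ ($k\in\mathbb{Z}$) of $\widehat{\mathcal A}$, where $\zeta_p=e^{2\pi i/p}$; $M^{\langle g_p\rangle}=\{v\in M:g_pv=v\}$. *)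

theory Defs
  imports Complex_Main "HOL-Library.Poly_Mapping" "HOL-Library.Set_Algebras" "HOL-Algebra.Module"
begin

section \<open>The Weyl algebra\<close>

text \<open>\<open>A k\<close> and \<open>As k\<close> are the letters \<open>a(k)\<close> and \<open>a\<^sup>*(k)\<close>. The free unital algebra on them is the
  monoid algebra of the free monoid of words; words are written additively because the monoid
  algebras of \<open>Poly_Mapping\<close> (with convolution as product) are indexed by additive monoids.\<close>

datatype letter = A int | As int

datatype word = Word "letter list"

fun letters :: "word \<Rightarrow> letter list" where
  "letters (Word l) = l"

instantiation word :: monoid_add
begin

definition zero_word :: word where "0 = Word []"

definition plus_word :: "word \<Rightarrow> word \<Rightarrow> word" where "u + v = Word (letters u @ letters v)"

instance
proof
  fix u v w :: word
  show "u + v + w = u + (v + w)" by (simp add: plus_word_def)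
  show "0 + u = u" by (cases u) (simp add: plus_word_def zero_word_def)
  show "u + 0 = u" by (cases u) (simp add: plus_word_def zero_word_def)
qed

end

type_synonym free_algebra = "word \<Rightarrow>\<^sub>0 complex"

definition free_letter :: "letter \<Rightarrow> free_algebra" where
  "free_letter x = Poly_Mapping.single (Word [x]) 1"

definition free_const :: "complex \<Rightarrow> free_algebra" where
  "free_const c = Poly_Mapping.single 0 c"

definition free_commutator :: "letter \<Rightarrow> letter \<Rightarrow> free_algebra" where
  "free_commutator x y = free_letter x * free_letter y - free_letter y * free_letter x"

inductive_set weyl_relators :: "free_algebra set" where
  "free_commutator (A k) (As m) - (if k + m = 0 then 1 else 0) \<in> weyl_relators"
| "free_commutator (A k) (A m) \<in> weyl_relators"
| "free_commutator (As k) (As m) \<in> weyl_relators"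

inductive_set weyl_ideal :: "free_algebra set" where
  base: "r \<in> weyl_relators \<Longrightarrow> r \<in> weyl_ideal"
| zero: "0 \<in> weyl_ideal"
| add: "x \<in> weyl_ideal \<Longrightarrow> y \<in> weyl_ideal \<Longrightarrow> x + y \<in> weyl_ideal"
| lmult: "x \<in> weyl_ideal \<Longrightarrow> y * x \<in> weyl_ideal"
| rmult: "x \<in> weyl_ideal \<Longrightarrow> x * y \<in> weyl_ideal"

lemma weyl_ideal_uminus: "x \<in> weyl_ideal \<Longrightarrow> - x \<in> weyl_ideal"
  using weyl_ideal.lmult[of x "- 1"] by simp

lemma weyl_ideal_diff: "x \<in> weyl_ideal \<Longrightarrow> y \<in> weyl_ideal \<Longrightarrow> x - y \<in> weyl_ideal"
  using weyl_ideal.add[of x "- y"] weyl_ideal_uminus by simp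

quotient_type weyl = free_algebra / "\<lambda>x y. x - y \<in> weyl_ideal"
proof (rule equivpI)
  show "reflp (\<lambda>x y. x - y \<in> weyl_ideal)"
    by (rule reflpI) (simp add: weyl_ideal.zero)
  show "symp (\<lambda>x y. x - y \<in> weyl_ideal)"
    by (rule sympI) (metis minus_diff_eq weyl_ideal_uminus)
  show "transp (\<lambda>x y. x - y \<in> weyl_ideal)"
  proof (rule transpI)
    fix x y z :: free_algebra
    assume "x - y \<in> weyl_ideal" "y - z \<in> weyl_ideal"
    then have "(x - y) + (y - z) \<in> weyl_ideal" by (rule weyl_ideal.add)
    then show "x - z \<in> weyl_ideal" by simp
  qed
qed

instantiation weyl :: "{ring, monoid_mult}"
begin

lift_definition zero_weyl :: weyl is "0 :: free_algebra" .

lift_definition one_weyl :: weyl is "1 :: free_algebra" .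

lift_definition plus_weyl :: "weyl \<Rightarrow> weyl \<Rightarrow> weyl" is "(+)"
  by (metis (no_types, lifting) add_diff_add weyl_ideal.add)

lift_definition uminus_weyl :: "weyl \<Rightarrow> weyl" is "uminus"
  using weyl_ideal_uminus by fastforce

lift_definition minus_weyl :: "weyl \<Rightarrow> weyl \<Rightarrow> weyl" is "(-)"
proof -
  fix x x' y y' :: free_algebra
  assume "x - x' \<in> weyl_ideal" "y - y' \<in> weyl_ideal"
  then have "(x - x') - (y - y') \<in> weyl_ideal" by (rule weyl_ideal_diff)
  then show "(x - y) - (x' - y') \<in> weyl_ideal" by (simp add: algebra_simps)
qed

lift_definition times_weyl :: "weyl \<Rightarrow> weyl \<Rightarrow> weyl" is "(*)"
proof -
  fix x x' y y' :: free_algebra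
  assume "x - x' \<in> weyl_ideal" "y - y' \<in> weyl_ideal"
  then have "(x - x') * y + x' * (y - y') \<in> weyl_ideal"
    by (intro weyl_ideal.add weyl_ideal.lmult weyl_ideal.rmult)
  then show "x * y - x' * y' \<in> weyl_ideal" by (simp add: algebra_simps)
qed

instance
  by standard (transfer, simp add: algebra_simps weyl_ideal.zero)+

end

lift_definition weyl_const :: "complex \<Rightarrow> weyl" is free_const .

lift_definition gen_a :: "int \<Rightarrow> weyl" is "\<lambda>k. free_letter (A k)" .

lift_definition gen_as :: "int \<Rightarrow> weyl" is "\<lambda>k. free_letter (As k)" .

lemma gen_commutators:
  "gen_a k * gen_as m - gen_as m * gen_a k = (if k + m = 0 then 1 else 0)"
  "gen_a k * gen_a m - gen_a m * gen_a k = 0"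
  "gen_as k * gen_as m - gen_as m * gen_as k = 0"
proof -
  have "gen_a k * gen_as m - gen_as m * gen_a k = 1" if "k + m = 0"
    using that by transfer
      (metis (full_types) free_commutator_def weyl_ideal.base weyl_relators.intros(1))
  moreover have "gen_a k * gen_as m - gen_as m * gen_a k = 0" if "k + m \<noteq> 0"
    using that by transfer
      (metis (full_types) free_commutator_def weyl_ideal.base weyl_relators.intros(1))
  ultimately show "gen_a k * gen_as m - gen_as m * gen_a k = (if k + m = 0 then 1 else 0)"
    by simp
  show "gen_a k * gen_a m - gen_a m * gen_a k = 0"
    by transfer (metis diff_zero free_commutator_def weyl_ideal.base weyl_relators.intros(2))
  show "gen_as k * gen_as m - gen_as m * gen_as k = 0"
    by transfer (metis diff_zero free_commutator_def weyl_ideal.base weyl_relators.intros(3))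
qed

subsection \<open>The automorphism \<open>a(k) \<mapsto> \<zeta> a(k)\<close>, \<open>a\<^sup>*(k) \<mapsto> \<zeta>\<inverse> a\<^sup>*(k)\<close> with \<open>\<zeta> = exp (2\<pi>i/p)\<close>\<close>

definition zeta :: "nat \<Rightarrow> complex" where
  "zeta p = exp (2 * of_real pi * \<i> / of_nat p)"

fun letter_weight :: "nat \<Rightarrow> letter \<Rightarrow> complex" where
  "letter_weight p (A k) = zeta p"
| "letter_weight p (As k) = inverse (zeta p)"

definition word_weight :: "nat \<Rightarrow> word \<Rightarrow> complex" where
  "word_weight p w = prod_list (map (letter_weight p) (letters w))"

definition free_rotation :: "nat \<Rightarrow> free_algebra \<Rightarrow> free_algebra" where
  "free_rotation p x = Poly_Mapping.mapp (\<lambda>w c. word_weight p w * c) x"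

lemma lookup_free_rotation:
  "Poly_Mapping.lookup (free_rotation p x) w = word_weight p w * Poly_Mapping.lookup x w"
  by (simp add: free_rotation_def lookup_mapp when_def in_keys_iff)

lemma free_rotation_add: "free_rotation p (x + y) = free_rotation p x + free_rotation p y"
  by (rule poly_mapping_eqI) (simp add: lookup_free_rotation lookup_add algebra_simps)

lemma free_rotation_diff: "free_rotation p (x - y) = free_rotation p x - free_rotation p y"
  by (rule poly_mapping_eqI) (simp add: lookup_free_rotation lookup_minus algebra_simps)

lemma free_rotation_single:
  "free_rotation p (Poly_Mapping.single w c) = Poly_Mapping.single w (word_weight p w * c)"
  by (rule poly_mapping_eqI) (simp add: lookup_free_rotation lookup_single when_def)

lemma word_weight_plus: "word_weight p (u + v) = word_weight p u * word_weight p v"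
  by (simp add: word_weight_def plus_word_def)

lemma free_algebra_induct [case_names zero add]:
  assumes "P 0" and "\<And>w c x. P x \<Longrightarrow> P (Poly_Mapping.single w c + x)"
  shows "P (x :: free_algebra)"
proof (induction x rule: update_induct)
  case const
  show ?case by (rule assms(1))
next
  case (update x w c)
  have "Poly_Mapping.update w c x = Poly_Mapping.single w c + x"
    using update(1)
    by (intro poly_mapping_eqI) (auto simp: lookup_update lookup_add lookup_single in_keys_iff)
  then show ?case using assms(2) update(3) by simp
qed

lemma free_rotation_0: "free_rotation p 0 = 0"
  using free_rotation_diff[of p 0 0] by simp

lemma free_rotation_mult: "free_rotation p (x * y) = free_rotation p x * free_rotation p y"
proof (induction x rule: free_algebra_induct)
  case zero
  show ?case by (simp add: free_rotation_0)
next
  case (add u c x)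
  have "free_rotation p (Poly_Mapping.single u c * y)
    = free_rotation p (Poly_Mapping.single u c) * free_rotation p y"
    by (induction y rule: free_algebra_induct)
      (simp_all add: free_rotation_0 mult_single free_rotation_single free_rotation_add
        word_weight_plus distrib_left mult.assoc mult.left_commute)
  with add show ?case by (simp add: free_rotation_add distrib_right)
qed

lemma free_rotation_1: "free_rotation p 1 = 1"
  by (simp add: free_rotation_single word_weight_def zero_word_def flip: single_one)

lemma free_rotation_letter:
  "free_rotation p (free_letter x) = free_const (letter_weight p x) * free_letter x"
  by (simp add: free_letter_def free_const_def free_rotation_single mult_single word_weight_def)

lemma free_rotation_commutator:
  "free_rotation p (free_commutator x y)
    = free_const (letter_weight p x * letter_weight p y) * free_commutator x y"
  by (simp add: free_commutator_def free_letter_def free_const_def free_rotation_diff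
      free_rotation_single mult_single word_weight_def right_diff_distrib plus_word_def zero_word_def
      mult.commute)

lemma free_rotation_weyl_ideal: "x \<in> weyl_ideal \<Longrightarrow> free_rotation p x \<in> weyl_ideal"
proof (induction rule: weyl_ideal.induct)
  case (base r)
  then show ?case
  proof cases
    case (1 k m)
    have "zeta p \<noteq> 0" by (simp add: zeta_def)
    then have "free_const (letter_weight p (A k) * letter_weight p (As m)) = 1"
      by (simp add: free_const_def)
    moreover have "free_rotation p (if k + m = 0 then 1 else 0) = (if k + m = 0 then 1 else 0)"
      by (simp add: free_rotation_0 free_rotation_1)
    ultimately have "free_rotation p r = r"
      by (simp add: 1 free_rotation_diff free_rotation_commutator del: letter_weight.simps)
    then show ?thesis using base weyl_ideal.base by simp
  next
    case (2 k m)
    then show ?thesis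
      by (metis base free_rotation_commutator weyl_ideal.base weyl_ideal.lmult)
  next
    case (3 k m)
    then show ?thesis
      by (metis base free_rotation_commutator weyl_ideal.base weyl_ideal.lmult)
  qed
next
  case zero
  show ?case by (simp add: free_rotation_0 weyl_ideal.zero)
qed (simp_all add: free_rotation_add free_rotation_mult weyl_ideal.intros)

lift_definition weyl_rotation :: "nat \<Rightarrow> weyl \<Rightarrow> weyl" is free_rotation
  by (metis free_rotation_diff free_rotation_weyl_ideal)

lemma weyl_rotation_gen:
  "weyl_rotation p (gen_a k) = weyl_const (zeta p) * gen_a k"
  "weyl_rotation p (gen_as k) = weyl_const (inverse (zeta p)) * gen_as k"
  by (transfer, simp add: free_rotation_letter weyl_ideal.zero)+

lemma weyl_rotation_hom:
  "weyl_rotation p (x + y) = weyl_rotation p x + weyl_rotation p y"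
  "weyl_rotation p (x * y) = weyl_rotation p x * weyl_rotation p y"
  "weyl_rotation p (weyl_const c) = weyl_const c"
  by (transfer, simp add: free_rotation_add free_rotation_mult free_const_def
      free_rotation_single word_weight_def zero_word_def weyl_ideal.zero)+

section \<open>Modules over the Weyl algebra\<close>

definition complex_field :: "complex ring" where
  "complex_field = \<lparr>carrier = UNIV, mult = (*), one = 1, zero = 0, add = (+)\<rparr>"

text \<open>A complex vector space is a \<open>module\<close> record over \<open>complex_field\<close>; its fields \<open>mult\<close> and
  \<open>one\<close> are irrelevant.\<close>

locale weyl_module = module complex_field W for W :: "(complex, 'w) module" (structure) +
  fixes act :: "weyl \<Rightarrow> 'w \<Rightarrow> 'w"
  assumes act_closed: "w \<in> carrier W \<Longrightarrow> act x w \<in> carrier W"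
    and act_add_right: "w \<in> carrier W \<Longrightarrow> w' \<in> carrier W \<Longrightarrow>
      act x (w \<oplus>\<^bsub>W\<^esub> w') = act x w \<oplus>\<^bsub>W\<^esub> act x w'"
    and act_add_left: "w \<in> carrier W \<Longrightarrow> act (x + y) w = act x w \<oplus>\<^bsub>W\<^esub> act y w"
    and act_mult: "w \<in> carrier W \<Longrightarrow> act (x * y) w = act x (act y w)"
    and act_const: "w \<in> carrier W \<Longrightarrow> act (weyl_const c) w = c \<odot>\<^bsub>W\<^esub> w"

locale simple_weyl_module = weyl_module +
  assumes nonzero: "carrier W \<noteq> {\<zero>\<^bsub>W\<^esub>}"
    and simple: "submodule U complex_field W \<Longrightarrow> (\<And>x u. u \<in> U \<Longrightarrow> act x u \<in> U) \<Longrightarrow>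
      U = {\<zero>\<^bsub>W\<^esub>} \<or> U = carrier W"

inductive_set left_ideal :: "weyl set \<Rightarrow> weyl set" for S where
  base: "s \<in> S \<Longrightarrow> s \<in> left_ideal S"
| zero: "0 \<in> left_ideal S"
| add: "x \<in> left_ideal S \<Longrightarrow> y \<in> left_ideal S \<Longrightarrow> x + y \<in> left_ideal S"
| lmult: "x \<in> left_ideal S \<Longrightarrow> y * x \<in> left_ideal S"

text \<open>The quotient of the Weyl algebra by a left ideal \<open>I\<close>, as the set of cosets \<open>x +o I\<close>. Adding
  \<open>I\<close> after scaling or acting gives the coset again, also when the factor is not invertible.\<close>

definition weyl_quotient :: "weyl set \<Rightarrow> (complex, weyl set) module" where
  "weyl_quotient I = \<lparr>carrier = range (\<lambda>x. x +o I), mult = undefined, one = undefined,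
     zero = I, add = (+), smult = (\<lambda>c B. (weyl_const c *o B) + I)\<rparr>"

definition weyl_quotient_act :: "weyl set \<Rightarrow> weyl \<Rightarrow> weyl set \<Rightarrow> weyl set" where
  "weyl_quotient_act I x B = (x *o B) + I"

text \<open>Only \<open>lam 0, \<dots>, lam n\<close> and \<open>mu 1, \<dots>, mu n\<close> are used.\<close>

definition whittaker_ideal :: "nat \<Rightarrow> (nat \<Rightarrow> complex) \<Rightarrow> (nat \<Rightarrow> complex) \<Rightarrow> weyl set" where
  "whittaker_ideal n lam mu = left_ideal
     ({gen_a (int k) - weyl_const (lam k) |k. k \<le> n} \<union>
      {gen_as (int k) - weyl_const (mu k) |k. 1 \<le> k \<and> k \<le> n} \<union>
      {gen_a (int k) |k. n < k} \<union> {gen_as (int k) |k. n < k})"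

definition whittaker_module ::
    "nat \<Rightarrow> (nat \<Rightarrow> complex) \<Rightarrow> (nat \<Rightarrow> complex) \<Rightarrow> (complex, weyl set) module" where
  "whittaker_module n lam mu = weyl_quotient (whittaker_ideal n lam mu)"

definition whittaker_act ::
    "nat \<Rightarrow> (nat \<Rightarrow> complex) \<Rightarrow> (nat \<Rightarrow> complex) \<Rightarrow> weyl \<Rightarrow> weyl set \<Rightarrow> weyl set" where
  "whittaker_act n lam mu = weyl_quotient_act (whittaker_ideal n lam mu)"

section \<open>Vertex algebras and weak modules\<close>

text \<open>A vertex operator map is given by its modes: \<open>Y u n\<close> is the coefficient \<open>u\<^sub>n\<close> of \<open>z\<^bsup>-n-1\<^esup>\<close> in
  \<open>Y(u, z)\<close>.\<close>

locale vertex_operators =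
  V: module complex_field V + W: module complex_field W
  for V :: "(complex, 'v) module" and W :: "(complex, 'w) module" +
  fixes Y :: "'v \<Rightarrow> int \<Rightarrow> 'w \<Rightarrow> 'w"
  assumes closed: "u \<in> carrier V \<Longrightarrow> w \<in> carrier W \<Longrightarrow> Y u n w \<in> carrier W"
    and add_left: "u \<in> carrier V \<Longrightarrow> u' \<in> carrier V \<Longrightarrow> w \<in> carrier W \<Longrightarrow>
      Y (u \<oplus>\<^bsub>V\<^esub> u') n w = Y u n w \<oplus>\<^bsub>W\<^esub> Y u' n w"
    and smult_left: "u \<in> carrier V \<Longrightarrow> w \<in> carrier W \<Longrightarrow>
      Y (c \<odot>\<^bsub>V\<^esub> u) n w = c \<odot>\<^bsub>W\<^esub> Y u n w"
    and add_right: "u \<in> carrier V \<Longrightarrow> w \<in> carrier W \<Longrightarrow> w' \<in> carrier W \<Longrightarrow>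
      Y u n (w \<oplus>\<^bsub>W\<^esub> w') = Y u n w \<oplus>\<^bsub>W\<^esub> Y u n w'"
    and smult_right: "u \<in> carrier V \<Longrightarrow> w \<in> carrier W \<Longrightarrow>
      Y u n (c \<odot>\<^bsub>W\<^esub> w) = c \<odot>\<^bsub>W\<^esub> Y u n w"
    and truncation: "u \<in> carrier V \<Longrightarrow> w \<in> carrier W \<Longrightarrow> \<exists>N. \<forall>n\<ge>N. Y u n w = \<zero>\<^bsub>W\<^esub>"

definition finite_support_sum :: "(complex, 'w) module \<Rightarrow> (nat \<Rightarrow> 'w) \<Rightarrow> 'w" where
  "finite_support_sum W f = finsum W f {j. f j \<noteq> \<zero>\<^bsub>W\<^esub>}"

text \<open>The Jacobi identity
  \<open>z\<^sub>0\<inverse> \<delta>((z\<^sub>1 - z\<^sub>2)/z\<^sub>0) Y(u,z\<^sub>1) Y(v,z\<^sub>2) - z\<^sub>0\<inverse> \<delta>((z\<^sub>2 - z\<^sub>1)/(-z\<^sub>0)) Y(v,z\<^sub>2) Y(u,z\<^sub>1)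
    = z\<^sub>1\<inverse> \<delta>((z\<^sub>2 + z\<^sub>0)/z\<^sub>1) Y(Y(u,z\<^sub>0)v,z\<^sub>2)\<close>
  (where \<open>z\<^sub>1\<inverse> \<delta>((z\<^sub>2 + z\<^sub>0)/z\<^sub>1) = z\<^sub>2\<inverse> \<delta>((z\<^sub>1 - z\<^sub>0)/z\<^sub>2)\<close>) read off at the coefficients of
  \<open>z\<^sub>0\<^bsup>-l-1\<^esup> z\<^sub>1\<^bsup>-m-1\<^esup> z\<^sub>2\<^bsup>-n-1\<^esup>\<close>. All three sums have finite support by lower truncation.\<close>

definition jacobi_identity where
  "jacobi_identity V Y W YW \<longleftrightarrow>
    (\<forall>u\<in>carrier V. \<forall>v\<in>carrier V. \<forall>w\<in>carrier W. \<forall>l m n :: int.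
      finite_support_sum W (\<lambda>j. ((-1) ^ j * (of_int l gchoose j)) \<odot>\<^bsub>W\<^esub>
          YW u (m + l - int j) (YW v (n + int j) w))
      \<ominus>\<^bsub>W\<^esub> finite_support_sum W (\<lambda>j. ((-1) powi l * (-1) ^ j * (of_int l gchoose j)) \<odot>\<^bsub>W\<^esub>
          YW v (n + l - int j) (YW u (m + int j) w))
      = finite_support_sum W (\<lambda>j. (of_int m gchoose j) \<odot>\<^bsub>W\<^esub>
          YW (Y u (l + int j) v) (m + n - int j) w))"

locale vertex_algebra = vertex_operators V V Y
  for V :: "(complex, 'v) module" and vac :: 'v and Y :: "'v \<Rightarrow> int \<Rightarrow> 'v \<Rightarrow> 'v" +
  assumes vac_closed: "vac \<in> carrier V"
    and vacuum: "v \<in> carrier V \<Longrightarrow> Y vac n v = (if n = -1 then v else \<zero>\<^bsub>V\<^esub>)"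
    and creation: "v \<in> carrier V \<Longrightarrow> Y v (-1) vac = v"
    and creation_regular: "v \<in> carrier V \<Longrightarrow> 0 \<le> n \<Longrightarrow> Y v n vac = \<zero>\<^bsub>V\<^esub>"
    and jacobi: "jacobi_identity V Y V Y"

locale weak_module =
  V: vertex_algebra V vac Y + vertex_operators V W YW
  for V :: "(complex, 'v) module" and vac :: 'v and Y :: "'v \<Rightarrow> int \<Rightarrow> 'v \<Rightarrow> 'v"
    and W :: "(complex, 'w) module" and YW :: "'v \<Rightarrow> int \<Rightarrow> 'w \<Rightarrow> 'w" +
  assumes module_vacuum: "w \<in> carrier W \<Longrightarrow> YW vac n w = (if n = -1 then w else \<zero>\<^bsub>W\<^esub>)"
    and module_jacobi: "jacobi_identity V Y W YW"

locale irreducible_weak_module = weak_module +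
  assumes nonzero: "carrier W \<noteq> {\<zero>\<^bsub>W\<^esub>}"
    and irreducible: "submodule U complex_field W \<Longrightarrow>
      (\<And>v n u. v \<in> carrier V \<Longrightarrow> u \<in> U \<Longrightarrow> YW v n u \<in> U) \<Longrightarrow>
      U = {\<zero>\<^bsub>W\<^esub>} \<or> U = carrier W"

section \<open>The Weyl vertex algebra and its orbifolds\<close>

text \<open>Neither weak modules nor their irreducibility involve the conformal vector, so only the vertex
  algebra structure is recorded.

  The field \<open>a\<^sup>*(z) = \<Sum>\<^sub>k a\<^sup>*(k) z\<^bsup>-k\<^esup>\<close> has \<open>a\<^sup>*(n + 1)\<close> as coefficient of \<open>z\<^bsup>-n-1\<^esup>\<close>.\<close>

locale weyl_vertex_algebra = simple_weyl_module M act + vertex_algebra M vac Y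
  for M :: "(complex, 'm) module" and act and vac and Y +
  assumes generated: "v \<in> carrier M \<Longrightarrow> \<exists>x. v = act x vac"
    and annihilated_a: "0 \<le> k \<Longrightarrow> act (gen_a k) vac = \<zero>\<^bsub>M\<^esub>"
    and annihilated_as: "0 \<le> k \<Longrightarrow> act (gen_as (k + 1)) vac = \<zero>\<^bsub>M\<^esub>"
    and field_a: "v \<in> carrier M \<Longrightarrow> Y (act (gen_a (-1)) vac) n v = act (gen_a n) v"
    and field_as: "v \<in> carrier M \<Longrightarrow> Y (act (gen_as 0) vac) n v = act (gen_as (n + 1)) v"

text \<open>The weak module structure carried by a Weyl algebra module \<open>W\<close> on which \<open>a(z)\<close> and
  \<open>a\<^sup>*(z)\<close> are lower truncated is the one extending these two fields.\<close>

locale natural_weak_module =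
  weyl_module W actW + weak_module M vac Y W YW
  for M :: "(complex, 'm) module" and act :: "weyl \<Rightarrow> 'm \<Rightarrow> 'm" and vac and Y
    and W :: "(complex, 'w) module" and actW and YW +
  assumes module_field_a: "w \<in> carrier W \<Longrightarrow>
      YW (act (gen_a (-1)) vac) n w = actW (gen_a n) w"
    and module_field_as: "w \<in> carrier W \<Longrightarrow>
      YW (act (gen_as 0) vac) n w = actW (gen_as (n + 1)) w"

text \<open>The automorphism of \<open>M\<close> sends \<open>x\<cdot>vac\<close> to \<open>\<sigma>(x)\<cdot>vac\<close> for \<open>\<sigma> = weyl_rotation p\<close>. This is independent
  of \<open>x\<close> since \<open>\<sigma>\<close> preserves the annihilator of \<open>vac\<close>.\<close>

definition orbifold_automorphism ::
    "nat \<Rightarrow> (weyl \<Rightarrow> 'm \<Rightarrow> 'm) \<Rightarrow> 'm \<Rightarrow> 'm \<Rightarrow> 'm" where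
  "orbifold_automorphism p act vac v =
     (THE u. \<exists>x. v = act x vac \<and> u = act (weyl_rotation p x) vac)"

definition orbifold ::
    "nat \<Rightarrow> (complex, 'm) module \<Rightarrow> (weyl \<Rightarrow> 'm \<Rightarrow> 'm) \<Rightarrow> 'm \<Rightarrow> (complex, 'm) module" where
  "orbifold p M act vac =
     M\<lparr>carrier := {v \<in> carrier M. orbifold_automorphism p act vac v = v}\<rparr>"

end

theory Submission
  imports Defs "HOL-Computational_Algebra.Formal_Power_Series"
begin

text \<open>The shift \<open>a(k) \<mapsto> a(k) + \<lambda>\<^sub>k\<close>, \<open>a\<^sup>*(k) \<mapsto> a\<^sup>*(k) + \<mu>\<^sub>k\<close> is an automorphism of the Weyl algebra that
  turns the Whittaker module into the Fock space, so both \<open>M\<close> and the Whittaker module are realised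
  on the same space. Number operators show that the Fock space is simple.

  Existence of the vertex operators: if \<open>h\<close> is one of the two generating vectors and \<open>h\<^sub>k\<close> its
  modes on \<open>M\<close>, then replacing \<open>Z(v, z)\<close> by \<open>Z(exp(c X(z)) v, z)\<close> with
  \<open>X(z) = \<Sum>\<^sub>k (s choose k) z\<^bsup>s-k\<^esup> h\<^sub>k\<close> preserves the Jacobi identity and shifts a single mode of the other
  generator by a scalar. Finitely many such twists, starting from \<open>M\<close> itself, give the required structure.

  Irreducibility: by associativity a subspace \<open>U\<close> stable under the orbifold is stable under all words
  of weight \<open>1\<close> in the generators. Some annihilation operator \<open>T\<close> acts as \<open>D + \<mu>\<close> with \<open>D\<close> locally
  nilpotent and \<open>\<mu> \<noteq> 0\<close>. Since \<open>T\<^sup>p\<close> has weight \<open>1\<close>, \<open>U\<close> is stable under \<open>D\<close>, hence under \<open>T\<^bsup>\<plusminus>1\<^esup>\<close>. Any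
  generator times a suitable power of \<open>T\<close> has weight \<open>1\<close>, so \<open>U\<close> is stable under the Weyl algebra.\<close>

section \<open>The Weyl algebra\<close>

text \<open>\<open>M\<close> is given only by axioms, with no formula for Y(v, z) at a general v, so
  the fields of the Whittaker module are manufactured from Y itself. Here X(z) is the coefficient of
  x^(-1) in (z + x)^s Y(h, x). Applied to the generator that pairs with h it gives a multiple of z^s
  times the vacuum, and it kills the other generator. Since the vacuum acts as the identity, the
  twisted field changes by a multiple of z^s, and the integer s, of either sign, selects the shifted
  mode. Truncation makes X(z)v a finite sum. The modes h_k with k >= 0 are annihilation operators,
  so they lower the degree filtration and the exponential stops on every vector.

  In the irreducibility proof, Lambda being nonzero is what supplies T with mu nonzero. All weights
  are p-th roots of unity, which puts T^p among the operators of weight 1. The coefficient of D in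
  T^p is p mu^(p-1), invertible because p and mu are nonzero. The same filtration that gives
  simplicity of the Fock space makes D locally nilpotent.\<close>

lemma weyl_const_add: "weyl_const (c + d) = weyl_const c + weyl_const d"
  by transfer (simp add: free_const_def single_add weyl_ideal.zero)

lemma weyl_const_mult: "weyl_const (c * d) = weyl_const c * weyl_const d"
  by transfer (simp add: free_const_def mult_single weyl_ideal.zero)

lemma weyl_const_1: "weyl_const 1 = 1"
  by transfer (simp add: free_const_def weyl_ideal.zero)

lemma weyl_const_0: "weyl_const 0 = 0"
  by transfer (simp add: free_const_def weyl_ideal.zero)

lemma weyl_const_uminus: "weyl_const (- c) = - weyl_const c"
  by transfer (simp add: free_const_def single_uminus weyl_ideal.zero)

lemma free_const_commute: "free_const c * x = x * free_const c"
  by (induction x rule: free_algebra_induct)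
    (simp_all add: free_const_def distrib_left distrib_right mult_single mult.commute)

lemma weyl_const_commute: "weyl_const c * x = x * weyl_const c"
  by transfer (simp add: free_const_commute weyl_ideal.zero)

lemma weyl_const_left_commute: "x * (weyl_const c * y) = weyl_const c * (x * y)"
  by (metis mult.assoc weyl_const_commute)

section \<open>Generators indexed by letters, with scalar commutators\<close>

fun gen :: "letter \<Rightarrow> weyl" where
  "gen (A k) = gen_a k"
| "gen (As k) = gen_as k"

declare gen.simps [simp del]

fun br :: "letter \<Rightarrow> letter \<Rightarrow> complex" where
  "br (A k) (As m) = (if k + m = 0 then 1 else 0)"
| "br (As k) (A m) = (if k + m = 0 then - 1 else 0)"
| "br (A k) (A m) = 0"
| "br (As k) (As m) = 0"

lemma gen_swap: "gen x * gen y = gen y * gen x + weyl_const (br x y)"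
proof (cases "x"; cases "y")
  fix k m assume [simp]: "x = A k" "y = As m"
  show ?thesis using gen_commutators(1)[of k m]
    by (auto simp: gen.simps weyl_const_1 weyl_const_0 algebra_simps)
next
  fix k m assume [simp]: "x = As m" "y = A k"
  show ?thesis using gen_commutators(1)[of k m]
    by (auto simp: gen.simps weyl_const_1 weyl_const_0 weyl_const_uminus algebra_simps)
next
  fix k m assume [simp]: "x = A m" "y = A k"
  show ?thesis using gen_commutators(2)[of k m]
    by (auto simp: gen.simps weyl_const_0 algebra_simps)
next
  fix k m assume [simp]: "x = As m" "y = As k"
  show ?thesis using gen_commutators(3)[of k m]
    by (auto simp: gen.simps weyl_const_0 algebra_simps)
qed

lemma abs_weyl_letter: "abs_weyl (free_letter x) = gen x"
  by (cases x) (simp_all add: gen.simps gen_a.abs_eq gen_as.abs_eq)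

text \<open>The classes of words span the algebra, and the word with coefficient c arises from the
  constant c by multiplying single generators on the left. Left multiplication alone is therefore
  enough.\<close>

lemma weyl_induct [case_names const add gen]:
  assumes const: "\<And>c. P (weyl_const c)"
    and add: "\<And>x y. P x \<Longrightarrow> P y \<Longrightarrow> P (x + y)"
    and gen: "\<And>l x. P x \<Longrightarrow> P (gen l * x)"
  shows "P x"
proof -
  have single: "P (abs_weyl (Poly_Mapping.single (Word l) c))" for l c
  proof (induction l)
    case Nil
    show ?case using const[of c] by (simp add: weyl_const.abs_eq free_const_def zero_word_def)
  next
    case (Cons x l)
    have "Poly_Mapping.single (Word (x # l)) c = free_letter x * Poly_Mapping.single (Word l) c"
      by (simp add: free_letter_def mult_single plus_word_def)
    then show ?case using gen[OF Cons, of x] by (simp add: times_weyl.abs_eq flip: abs_weyl_letter)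
  qed
  have "P (abs_weyl y)" for y
  proof (induction y rule: free_algebra_induct)
    case zero
    then show ?case using const[of 0] by (simp add: weyl_const_0 zero_weyl_def)
  next
    case (add w c y)
    then show ?case using assms(2)[OF single[of "letters w" c]]
      by (cases w) (simp add: plus_weyl.abs_eq[symmetric])
  qed
  then show ?thesis by (metis Quotient3_abs_rep Quotient3_weyl)
qed

subsection \<open>Shift automorphisms\<close>

definition shifted_word :: "(letter \<Rightarrow> complex) \<Rightarrow> word \<Rightarrow> weyl" where
  "shifted_word s w = prod_list (map (\<lambda>l. gen l + weyl_const (s l)) (letters w))"

text \<open>Evaluation of noncommutative polynomials at the shifted generators, with values already
  in the quotient, so that only its vanishing on the relators remains to be checked.\<close>

definition free_shift :: "(letter \<Rightarrow> complex) \<Rightarrow> free_algebra \<Rightarrow> weyl" where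
  "free_shift s x = (\<Sum>w\<in>Poly_Mapping.keys x. weyl_const (Poly_Mapping.lookup x w) * shifted_word s w)"

text \<open>Allows polynomials with different supports to be summed over one common set of
  words.\<close>

lemma free_shift_superset:
  assumes "finite S" "Poly_Mapping.keys x \<subseteq> S"
  shows "free_shift s x = (\<Sum>w\<in>S. weyl_const (Poly_Mapping.lookup x w) * shifted_word s w)"
  unfolding free_shift_def using assms
  by (intro sum.mono_neutral_left) (auto simp: in_keys_iff weyl_const_0)

lemma free_shift_add: "free_shift s (x + y) = free_shift s x + free_shift s y"
proof -
  let ?S = "Poly_Mapping.keys x \<union> Poly_Mapping.keys y"
  have "Poly_Mapping.keys (x + y) \<subseteq> ?S" by (rule Poly_Mapping.keys_add)
  then show ?thesis
    by (simp add: free_shift_superset[of ?S] lookup_add weyl_const_add distrib_right sum.distrib)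
qed

lemma free_shift_single: "free_shift s (Poly_Mapping.single w c) = weyl_const c * shifted_word s w"
  by (cases "c = 0") (simp_all add: free_shift_def weyl_const_0)

lemma free_shift_0: "free_shift s 0 = 0"
  by (simp add: free_shift_def)

lemma free_shift_diff: "free_shift s (x - y) = free_shift s x - free_shift s y"
  using free_shift_add[of s "x - y" y] by simp

lemma shifted_word_plus: "shifted_word s (u + v) = shifted_word s u * shifted_word s v"
  by (simp add: shifted_word_def plus_word_def)

lemma free_shift_mult: "free_shift s (x * y) = free_shift s x * free_shift s y"
proof (induction x rule: free_algebra_induct)
  case zero
  show ?case by (simp add: free_shift_0)
next
  case (add u c x)
  have "free_shift s (Poly_Mapping.single u c * y)
    = free_shift s (Poly_Mapping.single u c) * free_shift s y"
    by (induction y rule: free_algebra_induct)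
      (simp_all add: free_shift_0 mult_single free_shift_single free_shift_add
        shifted_word_plus distrib_left weyl_const_mult mult.assoc weyl_const_left_commute[of "shifted_word s u"])
  with add show ?case by (simp add: free_shift_add distrib_right)
qed

lemma free_shift_const: "free_shift s (free_const c) = weyl_const c"
  by (simp add: free_const_def free_shift_single shifted_word_def zero_word_def)

lemma free_shift_letter: "free_shift s (free_letter l) = gen l + weyl_const (s l)"
  by (simp add: free_letter_def free_shift_single shifted_word_def weyl_const_1)

text \<open>Central scalars drop out of commutators. The shifted generators thus satisfy the same
  relations as the original ones, which lets the shift descend to the Weyl algebra.\<close>

lemma free_shift_commutator: "free_shift s (free_commutator x y) = weyl_const (br x y)"
proof -
  have "free_shift s (free_commutator x y) = gen x * gen y - gen y * gen x"
    by (simp add: free_commutator_def free_shift_diff free_shift_mult free_shift_letter distrib_left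
        distrib_right weyl_const_commute[of "s x"] weyl_const_commute[of "s y" "gen x"])
  then show ?thesis using gen_swap[of x y] by simp
qed

lemma free_shift_weyl_ideal: "x \<in> weyl_ideal \<Longrightarrow> free_shift s x = 0"
proof (induction rule: weyl_ideal.induct)
  case (base r)
  have "free_shift s 1 = 1" 
    using free_shift_const[of s 1] by (simp add: free_const_def weyl_const_1)
  with base show ?case
    by cases (auto simp: free_shift_diff free_shift_commutator free_shift_0 weyl_const_0 weyl_const_1)
qed (simp_all add: free_shift_0 free_shift_add free_shift_mult)

definition weyl_shift :: "(letter \<Rightarrow> complex) \<Rightarrow> weyl \<Rightarrow> weyl" where
  "weyl_shift s x = free_shift s (rep_weyl x)"

lemma weyl_shift_abs: "weyl_shift s (abs_weyl x) = free_shift s x"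
proof -
  have "rep_weyl (abs_weyl x) - x \<in> weyl_ideal"
    by (simp add: Quotient3_rep_abs[OF Quotient3_weyl] weyl_ideal.zero)
  then show ?thesis
    unfolding weyl_shift_def using free_shift_weyl_ideal free_shift_diff
    by (metis eq_iff_diff_eq_0)
qed

lemma abs_weyl_cases: obtains y where "x = abs_weyl y"
  by (metis Quotient3_abs_rep Quotient3_weyl)

lemma weyl_shift_add: "weyl_shift s (x + y) = weyl_shift s x + weyl_shift s y"
  by (cases x rule: abs_weyl_cases; cases y rule: abs_weyl_cases)
    (simp add: plus_weyl.abs_eq weyl_shift_abs free_shift_add)

lemma weyl_shift_mult: "weyl_shift s (x * y) = weyl_shift s x * weyl_shift s y"
  by (cases x rule: abs_weyl_cases; cases y rule: abs_weyl_cases)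
    (simp add: times_weyl.abs_eq weyl_shift_abs free_shift_mult)

lemma weyl_shift_const: "weyl_shift s (weyl_const c) = weyl_const c"
  by (simp add: weyl_const.abs_eq weyl_shift_abs free_shift_const)

lemma weyl_shift_gen: "weyl_shift s (gen l) = gen l + weyl_const (s l)"
  by (metis abs_weyl_letter free_shift_letter weyl_shift_abs)

lemma weyl_shift_0: "weyl_shift s 0 = 0"
  using weyl_shift_const[of s 0] by (simp add: weyl_const_0)

lemma weyl_shift_diff: "weyl_shift s (x - y) = weyl_shift s x - weyl_shift s y"
  using weyl_shift_add[of s "x - y" y] by simp

lemma weyl_shift_inverse: "weyl_shift (\<lambda>l. - s l) (weyl_shift s x) = x"
  by (induction x rule: weyl_induct)
    (simp_all add: weyl_shift_const weyl_shift_add weyl_shift_mult weyl_shift_gen weyl_const_uminus)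

lemma weyl_shift_inverse': "weyl_shift s (weyl_shift (\<lambda>l. - s l) x) = x"
  using weyl_shift_inverse[of "\<lambda>l. - s l"] by simp

section \<open>The Fock space\<close>

fun annihilator :: "letter \<Rightarrow> bool" where
  "annihilator (A k) \<longleftrightarrow> 0 \<le> k"
| "annihilator (As k) \<longleftrightarrow> 1 \<le> k"

definition fock_ideal :: "weyl set" where
  "fock_ideal = left_ideal (gen ` Collect annihilator)"

lemma left_ideal_uminus: "x \<in> left_ideal S \<Longrightarrow> - x \<in> left_ideal S"
  using left_ideal.lmult[of x S "- 1"] by simp

lemma left_ideal_diff: "x \<in> left_ideal S \<Longrightarrow> y \<in> left_ideal S \<Longrightarrow> x - y \<in> left_ideal S"
  using left_ideal.add[of x S "- y"] left_ideal_uminus by simp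

quotient_type fock = weyl / "\<lambda>x y. x - y \<in> fock_ideal"
proof (rule equivpI)
  show "reflp (\<lambda>x y. x - y \<in> fock_ideal)"
    by (rule reflpI) (simp add: fock_ideal_def left_ideal.zero)
  show "symp (\<lambda>x y. x - y \<in> fock_ideal)"
    unfolding fock_ideal_def by (rule sympI) (metis minus_diff_eq left_ideal_uminus)
  show "transp (\<lambda>x y. x - y \<in> fock_ideal)"
    unfolding fock_ideal_def
    by (rule transpI) (metis (no_types) diff_add_cancel add_diff_eq left_ideal.add)
qed

instantiation fock :: ab_group_add
begin

lift_definition zero_fock :: fock is "0 :: weyl" .

lift_definition plus_fock :: "fock \<Rightarrow> fock \<Rightarrow> fock" is "(+)"
  unfolding fock_ideal_def by (metis (no_types, lifting) add_diff_add left_ideal.add)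

lift_definition uminus_fock :: "fock \<Rightarrow> fock" is "uminus"
  unfolding fock_ideal_def using left_ideal_uminus by fastforce

lift_definition minus_fock :: "fock \<Rightarrow> fock \<Rightarrow> fock" is "(-)"
proof -
  fix x x' y y' :: weyl
  assume "x - x' \<in> fock_ideal" "y - y' \<in> fock_ideal"
  then have "(x - x') - (y - y') \<in> fock_ideal" unfolding fock_ideal_def by (rule left_ideal_diff)
  then show "(x - y) - (x' - y') \<in> fock_ideal" by (simp add: algebra_simps)
qed

instance
  by standard (transfer, simp add: algebra_simps fock_ideal_def left_ideal.zero)+

end

definition fock_act :: "weyl \<Rightarrow> fock \<Rightarrow> fock" (infixr \<open>\<bullet>\<close> 75) where
  "x \<bullet> v = abs_fock (x * rep_fock v)"

definition fock_vac :: fock where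
  "fock_vac = abs_fock 1"

lemma abs_fock_eq_iff: "abs_fock x = abs_fock y \<longleftrightarrow> x - y \<in> fock_ideal"
  by (rule fock.abs_eq_iff)

lemma act_abs_fock: "x \<bullet> abs_fock y = abs_fock (x * y)"
proof -
  have "rep_fock (abs_fock y) - y \<in> fock_ideal"
    using Quotient3_rep_abs[OF Quotient3_fock, of y] by (simp add: fock_ideal_def left_ideal.zero)
  then show ?thesis
    unfolding fock_act_def abs_fock_eq_iff fock_ideal_def
    by (metis left_ideal.lmult right_diff_distrib)
qed

lemma abs_fock_cases: obtains x where "v = abs_fock x"
  by (metis Quotient3_abs_rep Quotient3_fock)

definition fock_scale :: "complex \<Rightarrow> fock \<Rightarrow> fock" (infixr \<open>*\<^sub>F\<close> 75) where
  "c *\<^sub>F v = weyl_const c \<bullet> v"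

lemma fock_act_add_right: "x \<bullet> (u + v) = x \<bullet> u + x \<bullet> v"
  by (cases u rule: abs_fock_cases; cases v rule: abs_fock_cases)
    (simp add: plus_fock.abs_eq act_abs_fock distrib_left)

lemma fock_act_add_left: "(x + y) \<bullet> v = x \<bullet> v + y \<bullet> v"
  by (cases v rule: abs_fock_cases) (simp add: plus_fock.abs_eq act_abs_fock distrib_right)

lemma fock_act_mult: "(x * y) \<bullet> v = x \<bullet> y \<bullet> v"
  by (cases v rule: abs_fock_cases) (simp add: act_abs_fock mult.assoc)

lemma fock_act_1: "1 \<bullet> v = v"
  by (cases v rule: abs_fock_cases) (simp add: act_abs_fock)

lemma fock_act_zero_right: "x \<bullet> 0 = 0"
  using fock_act_add_right[of x 0 0] by simp

lemma fock_act_zero_left: "0 \<bullet> v = 0"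
  using fock_act_add_left[of 0 0 v] by simp

lemma fock_act_diff_right: "x \<bullet> (u - v) = x \<bullet> u - x \<bullet> v"
  using fock_act_add_right[of x "u - v" v] by simp

lemma fock_act_sum_left: "sum f S \<bullet> v = (\<Sum>x\<in>S. f x \<bullet> v)"
  by (induction S rule: infinite_finite_induct) (simp_all add: fock_act_zero_left fock_act_add_left)

lemma fock_act_scale: "x \<bullet> c *\<^sub>F v = c *\<^sub>F x \<bullet> v"
  by (metis fock_act_mult fock_scale_def weyl_const_commute)

lemma fock_act_const: "weyl_const c \<bullet> v = c *\<^sub>F v"
  by (simp add: fock_scale_def)

interpretation fock: vector_space fock_scale
  by standard (simp_all add: fock_scale_def fock_act_add_right weyl_const_add fock_act_add_left
      weyl_const_mult fock_act_mult weyl_const_1 fock_act_1)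

lemma act_vac: "x \<bullet> fock_vac = abs_fock x"
  by (simp add: fock_vac_def act_abs_fock)

lemma fock_cases: obtains x where "v = x \<bullet> fock_vac"
  by (metis abs_fock_cases act_vac)

lemma act_vac_eq_0_iff: "x \<bullet> fock_vac = 0 \<longleftrightarrow> x \<in> fock_ideal"
  by (simp add: act_vac zero_fock_def abs_fock_eq_iff)

lemma annihilator_vac: "annihilator l \<Longrightarrow> gen l \<bullet> fock_vac = 0"
  by (auto simp: act_vac_eq_0_iff fock_ideal_def intro: left_ideal.base)

lemma gen_act_swap: "gen x \<bullet> gen y \<bullet> v = gen y \<bullet> gen x \<bullet> v + br x y *\<^sub>F v"
  by (metis fock_act_add_left fock_act_const fock_act_mult gen_swap)

lemma fock_induct [case_names scale_vac add gen]:
  assumes "\<And>c. P (c *\<^sub>F fock_vac)" and "\<And>u v. P u \<Longrightarrow> P v \<Longrightarrow> P (u + v)"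
    and "\<And>l v. P v \<Longrightarrow> P (gen l \<bullet> v)"
  shows "P v"
proof -
  have "P (x \<bullet> fock_vac)" for x
    by (induction x rule: weyl_induct) (simp_all add: fock_act_const fock_act_add_left fock_act_mult assms)
  then show ?thesis by (metis fock_cases)
qed

text \<open>A filtration, not a grading: \<open>fock_degree n v\<close> says that \<open>v\<close>
  is a combination of products of at most \<open>n\<close> creation operators applied to the vacuum.
  It avoids any choice of normal form for such products.\<close>

inductive fock_degree :: "nat \<Rightarrow> fock \<Rightarrow> bool" where
  scale_vac: "fock_degree n (c *\<^sub>F fock_vac)"
| add: "fock_degree n u \<Longrightarrow> fock_degree n v \<Longrightarrow> fock_degree n (u + v)"
| create: "\<not> annihilator l \<Longrightarrow> fock_degree n v \<Longrightarrow> fock_degree (Suc n) (gen l \<bullet> v)"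

lemma fock_degree_0: "fock_degree n 0"
  using fock_degree.scale_vac[of n 0] by simp

lemma fock_degree_scale: "fock_degree n v \<Longrightarrow> fock_degree n (c *\<^sub>F v)"
proof (induction rule: fock_degree.induct)
  case (create l n v)
  then show ?case using fock_degree.create by (simp flip: fock_act_scale)
qed (auto simp: fock.scale_right_distrib intro: fock_degree.intros)

lemma fock_degree_Suc: "fock_degree n v \<Longrightarrow> fock_degree (Suc n) v"
  by (induction rule: fock_degree.induct) (auto intro: fock_degree.intros)

lemma fock_degree_mono: "n \<le> m \<Longrightarrow> fock_degree n v \<Longrightarrow> fock_degree m v"
  by (induction m rule: dec_induct) (auto intro: fock_degree_Suc)

lemma fock_degree_zeroD: "fock_degree n v \<Longrightarrow> n = 0 \<Longrightarrow> \<exists>c. v = c *\<^sub>F fock_vac"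
  by (induction rule: fock_degree.induct) (auto simp flip: fock.scale_left_distrib)

text \<open>Moving an annihilation operator to the right through a product of creation operators
  leaves only terms with one factor removed, since it kills the vacuum at the end. The truncated
  difference \<open>n - 1\<close> forgets the vanishing at \<open>n = 0\<close>, hence the second
  conjunct.\<close>

lemma fock_degree_annihilate:
  assumes "annihilator x"
  shows "fock_degree n v \<Longrightarrow> fock_degree (n - 1) (gen x \<bullet> v) \<and> (n = 0 \<longrightarrow> gen x \<bullet> v = 0)"
proof (induction rule: fock_degree.induct)
  case (create l n v)
  have "fock_degree n (gen l \<bullet> gen x \<bullet> v)"
  proof (cases n)
    case 0
    then show ?thesis using create by (simp add: fock_act_zero_right fock_degree_0)
  next
    case (Suc m)
    then show ?thesis using create by (auto intro: fock_degree.create)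
  qed
  then show ?case using create by (simp add: gen_act_swap[of x l] fock_degree.add fock_degree_scale)
qed (auto simp: fock_act_scale annihilator_vac[OF assms] fock_act_add_right fock_degree_0 fock_degree.add)

lemma fock_degree_exists: "\<exists>n. fock_degree n v"
proof (induction v rule: fock_induct)
  case (scale_vac c)
  then show ?case using fock_degree.scale_vac by blast
next
  case (add u v)
  then obtain n m where "fock_degree n u" "fock_degree m v" by blast
  then have "fock_degree (max n m) (u + v)"
    using fock_degree_mono[of n "max n m" u] fock_degree_mono[of m "max n m" v]
    by (auto intro: fock_degree.add)
  then show ?case by blast
next
  case (gen l v)
  then show ?case using fock_degree.create fock_degree_annihilate by blast
qed

section \<open>Number operators and simplicity of the Fock space\<close>

fun dual :: "letter \<Rightarrow> letter" where
  "dual (A k) = As (- k)"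
| "dual (As k) = A (- k)"

text \<open>A finite piece of the Euler operator: it counts the creation operators whose duals lie
  in \<open>X\<close>. The sign \<open>br x (dual x)\<close> is 1 for \<open>A\<close> and -1 for
  \<open>As\<close>, so that each such factor is counted as +1.\<close>

definition number_operator :: "letter set \<Rightarrow> weyl" where
  "number_operator X = (\<Sum>x\<in>X. weyl_const (br x (dual x)) * (gen (dual x) * gen x))"

lemma dual_dual: "dual (dual x) = x"
  by (cases x) simp_all

lemma br_dual: "br x (dual x) * br x y = (if x = dual y then 1 else 0)"
  by (cases x; cases y) auto

lemma br_creators: "\<not> annihilator x \<Longrightarrow> \<not> annihilator y \<Longrightarrow> br x y = 0"
  by (cases x; cases y) auto

lemma annihilator_dual: "annihilator (dual x) \<longleftrightarrow> \<not> annihilator x"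
  by (cases x) auto

text \<open>A creation operator commutes with every summand except the one belonging to its dual,
  and there it reproduces itself once.\<close>

lemma number_operator_swap:
  assumes "finite X" "X \<subseteq> Collect annihilator" "\<not> annihilator y" "dual y \<in> X"
  shows "number_operator X \<bullet> gen y \<bullet> v = gen y \<bullet> number_operator X \<bullet> v + gen y \<bullet> v"
proof -
  have "(weyl_const (br x (dual x)) * (gen (dual x) * gen x)) \<bullet> gen y \<bullet> v =
      gen y \<bullet> (weyl_const (br x (dual x)) * (gen (dual x) * gen x)) \<bullet> v
      + (if x = dual y then gen y \<bullet> v else 0)" if "x \<in> X" for x
  proof -
    have "br (dual x) y = 0" 
      using that assms br_creators[of "dual x" y] by (auto simp: annihilator_dual)
    then have "(weyl_const (br x (dual x)) * (gen (dual x) * gen x)) \<bullet> gen y \<bullet> v =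
      gen y \<bullet> (weyl_const (br x (dual x)) * (gen (dual x) * gen x)) \<bullet> v
      + (br x (dual x) * br x y) *\<^sub>F gen (dual x) \<bullet> v"
      by (simp add: fock_act_mult fock_act_const gen_act_swap[of x y] gen_act_swap[of "dual x" y]
        fock_act_add_right fock_act_scale fock.scale_right_distrib)
    then show ?thesis by (simp add: br_dual dual_dual)
  qed
  then have "number_operator X \<bullet> gen y \<bullet> v =
     (\<Sum>x\<in>X. gen y \<bullet> (weyl_const (br x (dual x)) * (gen (dual x) * gen x)) \<bullet> v
      + (if x = dual y then gen y \<bullet> v else 0))"
    by (simp add: number_operator_def fock_act_sum_left)
  also have "\<dots> = gen y \<bullet> number_operator X \<bullet> v + gen y \<bullet> v"
    using assms by (simp add: sum.distrib number_operator_def sum_distrib_left flip: fock_act_mult fock_act_sum_left)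
  finally show ?thesis .
qed

text \<open>On a product of exactly \<open>n\<close> creation operators whose duals lie in
  \<open>X\<close> the eigenvalue is \<open>n\<close>, so subtracting \<open>n\<close> leaves only
  shorter products. The claim covers every finite \<open>X\<close> above some \<open>X0\<close> so
  that two such sets can be united in the case of a sum.\<close>

lemma number_operator_degree:
  "fock_degree n v \<Longrightarrow> \<exists>X0. finite X0 \<and> X0 \<subseteq> Collect annihilator \<and>
    (\<forall>X. finite X \<longrightarrow> X0 \<subseteq> X \<longrightarrow> X \<subseteq> Collect annihilator \<longrightarrow>
      (if n = 0 then number_operator X \<bullet> v = 0
       else fock_degree (n - 1) (number_operator X \<bullet> v - of_nat n *\<^sub>F v)))"
proof (induction rule: fock_degree.induct)
  case (scale_vac n c)
  have "number_operator X \<bullet> c *\<^sub>F fock_vac = 0" if "X \<subseteq> Collect annihilator" for X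
    using that unfolding number_operator_def fock_act_sum_left
    by (intro sum.neutral ballI) (auto simp: fock_act_mult fock_act_scale annihilator_vac fock_act_zero_right)
  then show ?case
    using fock_degree_scale[OF fock_degree.scale_vac[of "n - 1" c], of "- of_nat n"]
    by (intro exI[of _ "{}"]) simp
next
  case (add n u v)
  then obtain X Y where
    X: "finite X" "X \<subseteq> Collect annihilator"
      "\<And>Z. finite Z \<Longrightarrow> X \<subseteq> Z \<Longrightarrow> Z \<subseteq> Collect annihilator \<Longrightarrow> (if n = 0 then number_operator Z \<bullet> u = 0
         else fock_degree (n - 1) (number_operator Z \<bullet> u - of_nat n *\<^sub>F u))" and
    Y: "finite Y" "Y \<subseteq> Collect annihilator"
      "\<And>Z. finite Z \<Longrightarrow> Y \<subseteq> Z \<Longrightarrow> Z \<subseteq> Collect annihilator \<Longrightarrow> (if n = 0 then number_operator Z \<bullet> v = 0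
         else fock_degree (n - 1) (number_operator Z \<bullet> v - of_nat n *\<^sub>F v))"
    by blast
  have eq: "number_operator Z \<bullet> (u + v) - of_nat n *\<^sub>F (u + v) =
    (number_operator Z \<bullet> u - of_nat n *\<^sub>F u) + (number_operator Z \<bullet> v - of_nat n *\<^sub>F v)" for Z
    by (simp add: fock_act_add_right fock.scale_right_distrib)
  show ?case
  proof (rule exI[of _ "X \<union> Y"], intro conjI allI impI)
    fix Z assume Z: "finite Z" "X \<union> Y \<subseteq> Z" "Z \<subseteq> Collect annihilator"
    then show "if n = 0 then number_operator Z \<bullet> (u + v) = 0
      else fock_degree (n - 1) (number_operator Z \<bullet> (u + v) - of_nat n *\<^sub>F (u + v))"
      using X(3)[of Z] Y(3)[of Z] fock_degree.add[of "n - 1"]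
      unfolding eq by (auto simp: fock_act_add_right split: if_splits)
  qed (use X Y in auto)
next
  case (create l n v)
  then obtain X where
    X: "finite X" "X \<subseteq> Collect annihilator"
      "\<And>Z. finite Z \<Longrightarrow> X \<subseteq> Z \<Longrightarrow> Z \<subseteq> Collect annihilator \<Longrightarrow> (if n = 0 then number_operator Z \<bullet> v = 0
         else fock_degree (n - 1) (number_operator Z \<bullet> v - of_nat n *\<^sub>F v))"
    by blast
  show ?case
  proof (rule exI[of _ "insert (dual l) X"], intro conjI allI impI)
    fix Z assume Z: "finite Z" "insert (dual l) X \<subseteq> Z" "Z \<subseteq> Collect annihilator"
    have "number_operator Z \<bullet> gen l \<bullet> v - of_nat (Suc n) *\<^sub>F gen l \<bullet> v =
      gen l \<bullet> (number_operator Z \<bullet> v - of_nat n *\<^sub>F v)"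
      using Z create.hyps
      by (simp add: number_operator_swap fock_act_diff_right fock_act_scale fock.scale_left_distrib)
    moreover have "fock_degree n (gen l \<bullet> (number_operator Z \<bullet> v - of_nat n *\<^sub>F v))"
    proof (cases n)
      case 0
      then show ?thesis using X(3)[of Z] Z by (simp add: fock_act_zero_right fock_degree_0)
    next
      case (Suc m)
      then show ?thesis using X(3)[of Z] Z create.hyps by (auto intro: fock_degree.create)
    qed
    ultimately show "if Suc n = 0 then number_operator Z \<bullet> gen l \<bullet> v = 0
      else fock_degree (Suc n - 1) (number_operator Z \<bullet> gen l \<bullet> v - of_nat (Suc n) *\<^sub>F gen l \<bullet> v)"
      by simp
  qed (use X create.hyps in \<open>auto simp: annihilator_dual\<close>)
qed

text \<open>If some annihilation operator does not kill \<open>v\<close>, it lowers the degree and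
  the induction applies. If all of them kill \<open>v\<close>, so does the number operator; then
  \<open>number_operator_degree\<close> puts a nonzero multiple of \<open>v\<close>, hence
  \<open>v\<close> itself, in smaller degree.\<close>

lemma fock_degree_reaches_vac: "fock_degree n v \<Longrightarrow> v \<noteq> 0 \<Longrightarrow> \<exists>x. x \<bullet> v = fock_vac"
proof (induction n arbitrary: v)
  case 0
  then obtain c where c: "v = c *\<^sub>F fock_vac" using fock_degree_zeroD by blast
  with 0 have "c \<noteq> 0" by auto
  then have "weyl_const (1 / c) \<bullet> v = fock_vac" by (simp add: c fock_act_const)
  then show ?case by blast
next
  case (Suc n)
  show ?case
  proof (cases "\<exists>l. annihilator l \<and> gen l \<bullet> v \<noteq> 0")
    case True
    then obtain l where l: "annihilator l" "gen l \<bullet> v \<noteq> 0" by blast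
    then obtain x where "x \<bullet> gen l \<bullet> v = fock_vac"
      using Suc.IH fock_degree_annihilate[OF l(1) Suc.prems(1)] by auto
    then show ?thesis by (metis fock_act_mult)
  next
    case False
    obtain X where X: "finite X" "X \<subseteq> Collect annihilator"
      "fock_degree n (number_operator X \<bullet> v - of_nat (Suc n) *\<^sub>F v)"
      using number_operator_degree[OF Suc.prems(1)] by auto
    have "number_operator X \<bullet> v = 0"
      using False X(2) unfolding number_operator_def fock_act_sum_left
      by (intro sum.neutral) (auto simp: fock_act_mult fock_act_zero_right)
    then have "fock_degree n (- (1 / of_nat (Suc n)) *\<^sub>F - (of_nat (Suc n) *\<^sub>F v))"
      using X(3) by (intro fock_degree_scale) simp
    then have "fock_degree n v" by (simp del: of_nat_Suc)
    then show ?thesis using Suc by blast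
  qed
qed

lemma fock_reaches_vac: "v \<noteq> 0 \<Longrightarrow> \<exists>x. x \<bullet> v = fock_vac"
  using fock_degree_exists fock_degree_reaches_vac by blast


section \<open>Fields on the Fock space\<close>

lemma Sum_any_lessThan:
  fixes f :: "nat \<Rightarrow> 'a::comm_monoid_add"
  assumes "\<And>j. J \<le> j \<Longrightarrow> f j = 0"
  shows "Sum_any f = (\<Sum>j<J. f j)"
  using assms by (intro Sum_any.expand_superset) (auto simp: not_le[symmetric])

text \<open>Flattens a nested sum into a sum over one set of triples, the form needed for reindexing
  by a bijection.\<close>

lemma sum_triple:
  assumes "finite B" "\<And>k. k \<in> B \<Longrightarrow> finite (C k)"
  shows "(\<Sum>j\<in>S. \<Sum>k\<in>B. \<Sum>t\<in>C k. f j k t) = (\<Sum>(j, k, t)\<in>S \<times> Sigma B C. f j k t)"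
  using assms by (simp add: sum.Sigma sum.cartesian_product)

definition fock_field :: "(int \<Rightarrow> fock \<Rightarrow> fock) \<Rightarrow> bool" where
  "fock_field \<phi> \<longleftrightarrow> (\<forall>n u v. \<phi> n (u + v) = \<phi> n u + \<phi> n v) \<and>
    (\<forall>n c v. \<phi> n (c *\<^sub>F v) = c *\<^sub>F \<phi> n v) \<and> (\<forall>v. \<exists>N. \<forall>n\<ge>N. \<phi> n v = 0)"

lemma fock_field_0: "fock_field \<phi> \<Longrightarrow> \<phi> n 0 = 0"
  unfolding fock_field_def by (metis fock.scale_zero_left)

lemma fock_field_sum: "fock_field \<phi> \<Longrightarrow> \<phi> n (sum f S) = (\<Sum>x\<in>S. \<phi> n (f x))"
  by (induction S rule: infinite_finite_induct) (simp_all add: fock_field_0 fock_field_def)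

lemma fock_field_scale: "fock_field \<phi> \<Longrightarrow> \<phi> n (c *\<^sub>F v) = c *\<^sub>F \<phi> n v"
  by (simp add: fock_field_def)

lemma fock_field_truncated:
  assumes "fock_field \<phi>" obtains J where "\<And>j. J \<le> j \<Longrightarrow> \<phi> (n + int j) v = 0"
proof -
  obtain N where "\<forall>n\<ge>N. \<phi> n v = 0" using assms unfolding fock_field_def by blast
  moreover have "N \<le> n + int j" if "nat (N - n) \<le> j" for j
    using that by linarith
  ultimately show ?thesis using that[of "nat (N - n)"] by blast
qed

lemma fock_fields_truncated:
  assumes "finite K" "\<And>k. k \<in> K \<Longrightarrow> fock_field (\<phi> k)"
  obtains J where "\<And>k j. k \<in> K \<Longrightarrow> J \<le> j \<Longrightarrow> \<phi> k (n k + int j) (v k) = 0"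
proof -
  have "\<forall>k\<in>K. \<exists>J. \<forall>j\<ge>J. \<phi> k (n k + int j) (v k) = 0"
    using assms(2) fock_field_truncated by metis
  then obtain J where J: "\<And>k j. k \<in> K \<Longrightarrow> J k \<le> j \<Longrightarrow> \<phi> k (n k + int j) (v k) = 0" by metis
  show ?thesis
  proof (rule that[of "Max (J ` K)"])
    fix k j assume k: "k \<in> K" "Max (J ` K) \<le> j"
    have "J k \<le> Max (J ` K)" using k assms(1) by simp
    then show "\<phi> k (n k + int j) (v k) = 0" using k J by auto
  qed
qed

text \<open>With modes read off at z^(-n-1), multiplication by z^d shifts the index by d. The
  combination is thus the sum of c_k z^(d_k) phi_k(z), the shape of both the twist and its
  exponential.\<close>

lemma fock_field_sumI:
  assumes "finite K" "\<And>k. k \<in> K \<Longrightarrow> fock_field (\<phi> k)"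
  shows "fock_field (\<lambda>n w. \<Sum>k\<in>K. c k *\<^sub>F \<phi> k (n + d k) w)"
  unfolding fock_field_def
proof (intro conjI allI)
  fix n u v
  show "(\<Sum>k\<in>K. c k *\<^sub>F \<phi> k (n + d k) (u + v)) =
    (\<Sum>k\<in>K. c k *\<^sub>F \<phi> k (n + d k) u) + (\<Sum>k\<in>K. c k *\<^sub>F \<phi> k (n + d k) v)"
    unfolding sum.distrib[symmetric]
    using assms by (intro sum.cong refl) (simp add: fock_field_def fock.scale_right_distrib)
next
  fix n e v
  show "(\<Sum>k\<in>K. c k *\<^sub>F \<phi> k (n + d k) (e *\<^sub>F v)) = e *\<^sub>F (\<Sum>k\<in>K. c k *\<^sub>F \<phi> k (n + d k) v)"
    unfolding fock.scale_sum_right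
    using assms by (intro sum.cong refl) (simp add: fock_field_def mult.commute)
next
  fix v
  obtain J where J: "\<And>k j. k \<in> K \<Longrightarrow> J \<le> j \<Longrightarrow> \<phi> k (d k + int j) v = 0"
    using fock_fields_truncated[of K \<phi>, OF assms, where n = d and v = "\<lambda>_. v"] by blast
  have "\<phi> k (n + d k) v = 0" if "k \<in> K" "int J \<le> n" for n k
    using J[of k "nat n"] that by (simp add: add.commute)
  then show "\<exists>N. \<forall>n\<ge>N. (\<Sum>k\<in>K. c k *\<^sub>F \<phi> k (n + d k) v) = 0"
    by (intro exI[of _ "int J"]) (simp add: sum.neutral)
qed

text \<open>The coefficient of \<open>z\<^sub>0\<^bsup>-l-1\<^esup> z\<^sub>1\<^bsup>-m-1\<^esup> z\<^sub>2\<^bsup>-n-1\<^esup>\<close> in \<open>z\<^sub>0\<inverse> \<delta>((z\<^sub>1 - z\<^sub>2)/z\<^sub>0) \<phi>(z\<^sub>1) \<psi>(z\<^sub>2)\<close>.\<close>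

definition delta_product ::
    "(int \<Rightarrow> fock \<Rightarrow> fock) \<Rightarrow> (int \<Rightarrow> fock \<Rightarrow> fock) \<Rightarrow> int \<Rightarrow> int \<Rightarrow> int \<Rightarrow> fock \<Rightarrow> fock" where
  "delta_product \<phi> \<psi> l m n w =
    Sum_any (\<lambda>j. ((-1) ^ j * (of_int l gchoose j)) *\<^sub>F \<phi> (m + l - int j) (\<psi> (n + int j) w))"

text \<open>The left side of the Jacobi identity. In the second term the variables z1, z2 exchange
  roles, and expanding in -z0 instead of z0 produces the sign \<open>(-1) powi l\<close>.\<close>

definition bracket ::
    "(int \<Rightarrow> fock \<Rightarrow> fock) \<Rightarrow> (int \<Rightarrow> fock \<Rightarrow> fock) \<Rightarrow> int \<Rightarrow> int \<Rightarrow> int \<Rightarrow> fock \<Rightarrow> fock" where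
  "bracket \<phi> \<psi> l m n w = delta_product \<phi> \<psi> l m n w - ((-1) powi l) *\<^sub>F delta_product \<psi> \<phi> l n m w"

lemma scale_sum_swap:
  "(\<Sum>j\<in>J. c j *\<^sub>F (\<Sum>k\<in>K. d k *\<^sub>F f j k)) = (\<Sum>k\<in>K. d k *\<^sub>F (\<Sum>j\<in>J. c j *\<^sub>F f j k))"
  unfolding fock.scale_sum_right fock.scale_scale by (subst sum.swap) (simp add: mult.commute)

lemma delta_product_sum_left:
  assumes "finite K" "\<And>k. k \<in> K \<Longrightarrow> fock_field (\<phi> k)" "fock_field \<psi>"
  shows "delta_product (\<lambda>n w. \<Sum>k\<in>K. c k *\<^sub>F \<phi> k (n + d k) w) \<psi> l m n w =
    (\<Sum>k\<in>K. c k *\<^sub>F delta_product (\<phi> k) \<psi> l (m + d k) n w)"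
proof -
  obtain J where J: "\<And>j. J \<le> j \<Longrightarrow> \<psi> (n + int j) w = 0"
    using fock_field_truncated[OF assms(3)] by blast
  have summand: "delta_product (\<phi> k) \<psi> l (m + d k) n w = (\<Sum>j<J. ((-1) ^ j * (of_int l gchoose j)) *\<^sub>F
      \<phi> k (m + l - int j + d k) (\<psi> (n + int j) w))" if "k \<in> K" for k
  proof -
    have "m + d k + l - int j = m + l - int j + d k" for j by simp
    then show ?thesis unfolding delta_product_def
      using that assms(2) by (simp only:) (rule Sum_any_lessThan, simp add: J fock_field_0)
  qed
  have "delta_product (\<lambda>n w. \<Sum>k\<in>K. c k *\<^sub>F \<phi> k (n + d k) w) \<psi> l m n w =
    (\<Sum>j<J. ((-1) ^ j * (of_int l gchoose j)) *\<^sub>F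
      (\<Sum>k\<in>K. c k *\<^sub>F \<phi> k (m + l - int j + d k) (\<psi> (n + int j) w)))"
    unfolding delta_product_def
    using assms by (intro Sum_any_lessThan) (simp add: J fock_field_0)
  then show ?thesis
    by (subst (asm) scale_sum_swap) (simp add: summand)
qed

lemma delta_product_sum_right:
  assumes "finite K" "\<And>k. k \<in> K \<Longrightarrow> fock_field (\<psi> k)" "fock_field \<phi>"
  shows "delta_product \<phi> (\<lambda>n w. \<Sum>k\<in>K. c k *\<^sub>F \<psi> k (n + d k) w) l m n w =
    (\<Sum>k\<in>K. c k *\<^sub>F delta_product \<phi> (\<psi> k) l m (n + d k) w)"
proof -
  obtain J where J: "\<And>k j. k \<in> K \<Longrightarrow> J \<le> j \<Longrightarrow> \<psi> k (n + d k + int j) w = 0"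
    using fock_fields_truncated[of K \<psi>, OF assms(1,2), where n = "\<lambda>k. n + d k" and v = "\<lambda>_. w"] by blast
  have *: "n + int j + d k = n + d k + int j" for j k by simp
  have summand: "delta_product \<phi> (\<psi> k) l m (n + d k) w = (\<Sum>j<J. ((-1) ^ j * (of_int l gchoose j)) *\<^sub>F
      \<phi> (m + l - int j) (\<psi> k (n + d k + int j) w))" if "k \<in> K" for k
    unfolding delta_product_def
    using that assms(3) by (intro Sum_any_lessThan) (simp add: J fock_field_0)
  have "delta_product \<phi> (\<lambda>n w. \<Sum>k\<in>K. c k *\<^sub>F \<psi> k (n + d k) w) l m n w =
    (\<Sum>j<J. ((-1) ^ j * (of_int l gchoose j)) *\<^sub>F
      (\<Sum>k\<in>K. c k *\<^sub>F \<phi> (m + l - int j) (\<psi> k (n + d k + int j) w)))"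
    unfolding delta_product_def *
    using assms J
    by (subst Sum_any_lessThan[of J]) (simp_all add: fock_field_0 fock_field_sum fock_field_scale)
  then show ?thesis
    by (subst (asm) scale_sum_swap) (simp add: summand)
qed

lemma bracket_sum_left:
  assumes "finite K" "\<And>k. k \<in> K \<Longrightarrow> fock_field (\<phi> k)" "fock_field \<psi>"
  shows "bracket (\<lambda>n w. \<Sum>k\<in>K. c k *\<^sub>F \<phi> k (n + d k) w) \<psi> l m n w =
    (\<Sum>k\<in>K. c k *\<^sub>F bracket (\<phi> k) \<psi> l (m + d k) n w)"
  by (simp add: bracket_def delta_product_sum_left[of K \<phi> \<psi> c d] delta_product_sum_right[of K \<phi> \<psi> c d]
      assms fock.scale_sum_right fock.scale_right_diff_distrib sum_subtractf mult.commute)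

lemma bracket_sum_right:
  assumes "finite K" "\<And>k. k \<in> K \<Longrightarrow> fock_field (\<psi> k)" "fock_field \<phi>"
  shows "bracket \<phi> (\<lambda>n w. \<Sum>k\<in>K. c k *\<^sub>F \<psi> k (n + d k) w) l m n w =
    (\<Sum>k\<in>K. c k *\<^sub>F bracket \<phi> (\<psi> k) l m (n + d k) w)"
  by (simp add: bracket_def delta_product_sum_left[of K \<psi> \<phi> c d] delta_product_sum_right[of K \<psi> \<phi> c d]
      assms fock.scale_sum_right fock.scale_right_diff_distrib sum_subtractf mult.commute)

lemma gbinomial_0_left: "(0::complex) gchoose j = (if j = 0 then 1 else 0)"
  using binomial_gbinomial[of 0 j, where 'a=complex] by (cases j) simp_all

lemma bracket_0:
  assumes "fock_field \<phi>" "fock_field \<psi>"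
  shows "bracket \<phi> \<psi> 0 m n w = \<phi> m (\<psi> n w) - \<psi> n (\<phi> m w)"
proof -
  have "delta_product \<phi> \<psi> 0 m n w = \<phi> m (\<psi> n w)" for \<phi> \<psi> m n
    unfolding delta_product_def by (subst Sum_any_lessThan[of 1]) (auto simp: gbinomial_0_left)
  then show ?thesis by (simp add: bracket_def)
qed

section \<open>State-field maps and the Jacobi identity\<close>

definition fock_map :: "(fock \<Rightarrow> int \<Rightarrow> fock \<Rightarrow> fock) \<Rightarrow> bool" where
  "fock_map Z \<longleftrightarrow> (\<forall>v. fock_field (Z v)) \<and>
    (\<forall>u v n w. Z (u + v) n w = Z u n w + Z v n w) \<and> (\<forall>c v n w. Z (c *\<^sub>F v) n w = c *\<^sub>F Z v n w)"

lemma fock_map_field: "fock_map Z \<Longrightarrow> fock_field (Z v)"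
  by (simp add: fock_map_def)

lemma fock_map_add: "fock_map Z \<Longrightarrow> Z (u + v) n w = Z u n w + Z v n w"
  by (simp add: fock_map_def)

lemma fock_map_scale: "fock_map Z \<Longrightarrow> Z (c *\<^sub>F v) n w = c *\<^sub>F Z v n w"
  by (simp add: fock_map_def)

lemma fock_map_0: "fock_map Z \<Longrightarrow> Z 0 n w = 0"
  unfolding fock_map_def by (metis fock.scale_zero_left)

lemma fock_map_sum: "fock_map Z \<Longrightarrow> Z (sum f S) n w = (\<Sum>x\<in>S. Z (f x) n w)"
  by (induction S rule: infinite_finite_induct) (simp_all add: fock_map_0 fock_map_add)

text \<open>The right side of the Jacobi identity. The sequence \<open>f\<close> holds the products
  u_i v, which are always formed with \<open>Y\<close>, while \<open>Z\<close> is replaced by its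
  twists.\<close>

definition iterate_product ::
    "(fock \<Rightarrow> int \<Rightarrow> fock \<Rightarrow> fock) \<Rightarrow> (int \<Rightarrow> fock) \<Rightarrow> int \<Rightarrow> int \<Rightarrow> int \<Rightarrow> fock \<Rightarrow> fock" where
  "iterate_product Z f l m n w =
    Sum_any (\<lambda>j. (of_int m gchoose j) *\<^sub>F Z (f (l + int j)) (m + n - int j) w)"

definition fock_jacobi ::
    "(fock \<Rightarrow> int \<Rightarrow> fock \<Rightarrow> fock) \<Rightarrow> (fock \<Rightarrow> int \<Rightarrow> fock \<Rightarrow> fock) \<Rightarrow> bool" where
  "fock_jacobi Y Z \<longleftrightarrow> (\<forall>u v w l m n.
     bracket (Z u) (Z v) l m n w = iterate_product Z (\<lambda>i. Y u i v) l m n w)"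

locale fock_vertex_algebra =
  fixes Y :: "fock \<Rightarrow> int \<Rightarrow> fock \<Rightarrow> fock"
  assumes Y_map: "fock_map Y"
    and Y_vacuum: "Y fock_vac n w = (if n = - 1 then w else 0)"
    and Y_creation: "Y v (- 1) fock_vac = v"
    and Y_jacobi: "fock_jacobi Y Y"
    and Y_a: "Y (gen (A (- 1)) \<bullet> fock_vac) n w = gen (A n) \<bullet> w"
    and Y_as: "Y (gen (As 0) \<bullet> fock_vac) n w = gen (As (n + 1)) \<bullet> w"
begin

lemma Y_truncated:
  obtains J where "\<And>j. J \<le> j \<Longrightarrow> Y u (l + int j) v = 0"
  using fock_field_truncated[OF fock_map_field[OF Y_map]] by blast

lemma iterate_product_lessThan:
  assumes "fock_map Z" "\<And>j. J \<le> j \<Longrightarrow> f (l + int j) = 0"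
  shows "iterate_product Z f l m n w =
    (\<Sum>j<J. (of_int m gchoose j) *\<^sub>F Z (f (l + int j)) (m + n - int j) w)"
  unfolding iterate_product_def using assms
  by (intro Sum_any_lessThan) (simp add: fock_map_0)

definition is_module :: "(fock \<Rightarrow> int \<Rightarrow> fock \<Rightarrow> fock) \<Rightarrow> bool" where
  "is_module Z \<longleftrightarrow> fock_map Z \<and> (\<forall>n w. Z fock_vac n w = (if n = - 1 then w else 0)) \<and> fock_jacobi Y Z"

lemma is_module_Y: "is_module Y"
  by (simp add: is_module_def Y_map Y_vacuum Y_jacobi)

text \<open>The commutator formula, which is the Jacobi identity at l = 0. For a nonnegative mode
  \<open>k\<close> the binomial coefficients end the sum at \<open>k\<close>.\<close>

lemma module_commutator:
  assumes "is_module Z"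
  shows "Z h (int k) (Z u i v) =
    Z u i (Z h (int k) v) + (\<Sum>t\<le>k. of_nat (k choose t) *\<^sub>F Z (Y h (int t) u) (int k + i - int t) v)"
proof -
  have Z: "fock_map Z" using assms by (simp add: is_module_def)
  have "bracket (Z h) (Z u) 0 (int k) i v = iterate_product Z (\<lambda>i. Y h i u) 0 (int k) i v"
    using assms unfolding is_module_def fock_jacobi_def by blast
  also have "\<dots> = (\<Sum>t<Suc k. of_nat (k choose t) *\<^sub>F Z (Y h (int t) u) (int k + i - int t) v)"
    unfolding iterate_product_def
    by (subst Sum_any_lessThan[of "Suc k"]) (auto simp: binomial_gbinomial[symmetric])
  finally show ?thesis
    by (simp add: bracket_0 fock_map_field[OF Z] lessThan_Suc_atMost diff_eq_eq add.commute)
qed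

subsection \<open>Twisting by a commuting family of annihilation operators\<close>

text \<open>The twist preserves the Jacobi identity because \<open>X(z) = \<Sum>\<^sub>k (s choose k) z\<^bsup>s-k\<^esup> h\<^sub>k\<close> satisfies
  \<open>[X(z\<^sub>2), Y(u, z\<^sub>0)] = Y(X(z\<^sub>2 + z\<^sub>0)u, z\<^sub>0)\<close>. The coefficient of \<open>c\<^bsup>N\<^esup>\<close> in the identity for
  \<open>Z(exp(c X(z)) v, z)\<close> follows from that of \<open>c\<^bsup>N-1\<^esup>\<close>.\<close>

context
  fixes h :: fock and b :: "int \<Rightarrow> letter" and s :: int
  assumes h: "\<And>n w. Y h n w = gen (b n) \<bullet> w"
    and b: "\<And>k. annihilator (b (int k))"
begin

text \<open>The modes of Z(X(z)v, z): the factor z^(s-k) becomes the shift of the mode by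
  \<open>s - int k\<close>.\<close>

definition twist :: "(fock \<Rightarrow> int \<Rightarrow> fock \<Rightarrow> fock) \<Rightarrow> fock \<Rightarrow> int \<Rightarrow> fock \<Rightarrow> fock" where
  "twist Z v n w = Sum_any (\<lambda>k. (of_int s gchoose k) *\<^sub>F Z (gen (b (int k)) \<bullet> v) (n + (s - int k)) w)"

lemma twist_lessThan:
  assumes "fock_map Z" "\<And>k. K \<le> k \<Longrightarrow> gen (b (int k)) \<bullet> v = 0"
  shows "twist Z v = (\<lambda>n w. \<Sum>k<K. (of_int s gchoose k) *\<^sub>F
    Z (gen (b (int k)) \<bullet> v) (n + (s - int k)) w)"
  unfolding twist_def using assms
  by (intro ext Sum_any_lessThan) (simp add: fock_map_0)

lemma modes_truncated:
  obtains K where "\<And>k. K \<le> k \<Longrightarrow> gen (b (int k)) \<bullet> v = 0"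
  using Y_truncated[of h 0 v] by (auto simp: h)

lemma fock_map_twist:
  assumes "fock_map Z"
  shows "fock_map (twist Z)"
proof -
  have "fock_field (twist Z v)" for v
  proof -
    obtain K where K: "\<And>k. K \<le> k \<Longrightarrow> gen (b (int k)) \<bullet> v = 0" using modes_truncated by blast
    have eq: "twist Z v = (\<lambda>n w. \<Sum>k<K. (of_int s gchoose k) *\<^sub>F
      Z (gen (b (int k)) \<bullet> v) (n + (s - int k)) w)"
      by (rule twist_lessThan[OF assms]) (rule K)
    show ?thesis unfolding eq by (rule fock_field_sumI) (simp_all add: fock_map_field assms)
  qed
  moreover have "twist Z (u + v) n w = twist Z u n w + twist Z v n w" for u v n w
  proof -
    obtain K where K: "\<And>k. K \<le> k \<Longrightarrow> gen (b (int k)) \<bullet> u = 0" using modes_truncated by blast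
    obtain K' where K': "\<And>k. K' \<le> k \<Longrightarrow> gen (b (int k)) \<bullet> v = 0" using modes_truncated by blast
    let ?K = "max K K'"
    have "twist Z x = (\<lambda>n w. \<Sum>k<?K. (of_int s gchoose k) *\<^sub>F
      Z (gen (b (int k)) \<bullet> x) (n + (s - int k)) w)" if "x \<in> {u, v, u + v}" for x
      by (rule twist_lessThan[OF assms]) (use that K K' in \<open>auto simp: fock_act_add_right\<close>)
    then show ?thesis
      by (simp add: fock_act_add_right fock_map_add[OF assms] fock.scale_right_distrib sum.distrib)
  qed
  moreover have "twist Z (c *\<^sub>F v) n w = c *\<^sub>F twist Z v n w" for c v n w
  proof -
    obtain K where K: "\<And>k. K \<le> k \<Longrightarrow> gen (b (int k)) \<bullet> v = 0" using modes_truncated by blast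
    have "twist Z x = (\<lambda>n w. \<Sum>k<K. (of_int s gchoose k) *\<^sub>F
      Z (gen (b (int k)) \<bullet> x) (n + (s - int k)) w)" if "x \<in> {v, c *\<^sub>F v}" for x
      by (rule twist_lessThan[OF assms]) (use that K in \<open>auto simp: fock_act_scale\<close>)
    then show ?thesis
      by (simp add: fock_act_scale fock_map_scale[OF assms] fock.scale_sum_right mult.commute)
  qed
  ultimately show ?thesis unfolding fock_map_def by blast
qed

lemma gbinomial_convolution:
  "(\<Sum>j\<le>i. ((m::complex) gchoose j) * (x gchoose (i - j))) = (m + x) gchoose i"
  using gbinomial_Vandermonde[of m x i] by (simp add: atMost_atLeast0)

text \<open>Commuting X(z2) past Y(u, z0) leaves X(z2) on \<open>v\<close>, the first sum, plus a
  term in which (z2 + z0)^(s-t) accompanies h_t u. Against the delta function that power is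
  z1^(s-t), whence the shift of \<open>m\<close> in the second sum. In coefficients, this last
  replacement is Vandermonde's identity.\<close>

lemma iterate_product_twist:
  assumes Z: "fock_map Z"
    and Kv: "\<And>k. K \<le> k \<Longrightarrow> gen (b (int k)) \<bullet> v = 0"
    and Ku: "\<And>k. K \<le> k \<Longrightarrow> gen (b (int k)) \<bullet> u = 0"
  shows "iterate_product (twist Z) (\<lambda>i. Y u i v) l m n w =
    (\<Sum>k<K. (of_int s gchoose k) *\<^sub>F
      iterate_product Z (\<lambda>i. Y u i (gen (b (int k)) \<bullet> v)) l m (n + (s - int k)) w) +
    (\<Sum>t<K. (of_int s gchoose t) *\<^sub>F
      iterate_product Z (\<lambda>i. Y (gen (b (int t)) \<bullet> u) i v) l (m + (s - int t)) n w)"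
proof -
  define y where "y t i = Y (gen (b (int t)) \<bullet> u) (l + int i) v" for t i
  obtain J1 where J1: "\<And>j. J1 \<le> j \<Longrightarrow> Y u (l + int j) v = 0"
    using Y_truncated by blast
  obtain J2 where J2: "\<And>k j. k < K \<Longrightarrow> J2 \<le> j \<Longrightarrow> Y u (l + int j) (gen (b (int k)) \<bullet> v) = 0"
    using fock_fields_truncated[of "{..<K}" "\<lambda>_. Y u", where n = "\<lambda>_. l" and v = "\<lambda>k. gen (b (int k)) \<bullet> v"]
      fock_map_field[OF Y_map] by auto
  obtain J3 where J3: "\<And>k j. k < K \<Longrightarrow> J3 \<le> j \<Longrightarrow> y k j = 0"
    using fock_fields_truncated[of "{..<K}" "\<lambda>k. Y (gen (b (int k)) \<bullet> u)", where n = "\<lambda>_. l" and v = "\<lambda>_. v"]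
      fock_map_field[OF Y_map] unfolding y_def by auto
  define J where "J = J1 + J2 + J3"
  have J: "\<And>j. J \<le> j \<Longrightarrow> Y u (l + int j) v = 0"
    "\<And>k j. J \<le> j \<Longrightarrow> Y u (l + int j) (gen (b (int k)) \<bullet> v) = 0"
    using J1 J2 Kv fock_field_0[OF fock_map_field[OF Y_map]] unfolding J_def
    by (auto, metis add_leD1 add_leD2 not_le)
  have yK: "y t i = 0" if "K \<le> t" for t i
    using Ku[OF that] fock_map_0[OF Y_map] by (simp add: y_def)
  have yJ: "y t i = 0" if "J \<le> i" for t i
    using J3[of t i] yK[of t i] that by (cases "t < K") (auto simp: J_def)
  \<comment> \<open>The second argument of \<open>y\<close> is written as \<open>j + (k - t)\<close>
    because this becomes the new summation index \<open>i\<close> below.\<close>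
  have comm: "gen (b (int k)) \<bullet> Y u (l + int j) v = Y u (l + int j) (gen (b (int k)) \<bullet> v) +
    (\<Sum>t\<le>k. of_nat (k choose t) *\<^sub>F y t (j + (k - t)))" for k j
  proof -
    have "(\<Sum>t\<le>k. of_nat (k choose t) *\<^sub>F Y (gen (b (int t)) \<bullet> u) (int k + (l + int j) - int t) v) =
      (\<Sum>t\<le>k. of_nat (k choose t) *\<^sub>F y t (j + (k - t)))"
      by (intro sum.cong refl) (simp add: y_def of_nat_diff algebra_simps)
    then show ?thesis
      using module_commutator[OF is_module_Y, of h k u "l + int j" v] unfolding h by simp
  qed
  \<comment> \<open>For \<open>k\<close> at least \<open>K + J\<close>, either \<open>t\<close> is
    at least \<open>K\<close> or \<open>j + (k - t)\<close> is at least \<open>J\<close>, and both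
    kill \<open>y\<close>. This is where the common bound \<open>B = K + J\<close> comes
    from.\<close>
  have vanish: "gen (b (int k)) \<bullet> Y u (l + int j) v = 0" if "K + J \<le> k" for k j
  proof -
    have "of_nat (k choose t) *\<^sub>F y t (j + (k - t)) = 0" for t
      using yK[of t] yJ[of "j + (k - t)" t] that by (cases "K \<le> t") auto
    then have "(\<Sum>t\<le>k. of_nat (k choose t) *\<^sub>F y t (j + (k - t))) = 0"
      by (intro sum.neutral) blast
    then show ?thesis unfolding comm using Kv[of k] that
      by (simp only: fock_field_0[OF fock_map_field[OF Y_map]]) simp
  qed
  define B where "B = K + J"
  define F where "F t i = Z (y t i) (m + n + s - int t - int i) w" for t i
  have F0: "F t i = 0" if "K \<le> t \<or> J \<le> i" for t i
    using that yK yJ fock_map_0[OF Z] by (auto simp: F_def)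
  have tw: "twist Z (Y u (l + int j) v) = (\<lambda>n w. \<Sum>k<B. (of_int s gchoose k) *\<^sub>F
      Z (gen (b (int k)) \<bullet> Y u (l + int j) v) (n + (s - int k)) w)" for j
    by (rule twist_lessThan[OF Z]) (simp add: vanish B_def)
  have "iterate_product (twist Z) (\<lambda>i. Y u i v) l m n w =
    (\<Sum>j<J. (of_int m gchoose j) *\<^sub>F (\<Sum>k<B. (of_int s gchoose k) *\<^sub>F
      Z (gen (b (int k)) \<bullet> Y u (l + int j) v) (m + n - int j + (s - int k)) w))"
    by (subst iterate_product_lessThan[where J = J]) (simp_all add: fock_map_twist[OF Z] J(1) tw)
  also have "\<dots> =
    (\<Sum>j<J. \<Sum>k<B. ((of_int m gchoose j) * (of_int s gchoose k)) *\<^sub>F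
      Z (Y u (l + int j) (gen (b (int k)) \<bullet> v)) (m + n - int j + (s - int k)) w) +
    (\<Sum>j<J. \<Sum>k<B. \<Sum>t\<le>k. ((of_int m gchoose j) * (of_int s gchoose k) * of_nat (k choose t)) *\<^sub>F
      Z (y t (j + (k - t))) (m + n - int j + (s - int k)) w)"
    unfolding comm fock_map_add[OF Z] fock_map_sum[OF Z] fock_map_scale[OF Z]
    by (simp add: fock.scale_sum_right fock.scale_right_distrib sum.distrib mult.assoc)
  finally have split: "iterate_product (twist Z) (\<lambda>i. Y u i v) l m n w = \<dots>" .
  have first: "(\<Sum>j<J. \<Sum>k<B. ((of_int m gchoose j) * (of_int s gchoose k)) *\<^sub>F
      Z (Y u (l + int j) (gen (b (int k)) \<bullet> v)) (m + n - int j + (s - int k)) w) =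
    (\<Sum>k<K. (of_int s gchoose k) *\<^sub>F
      iterate_product Z (\<lambda>i. Y u i (gen (b (int k)) \<bullet> v)) l m (n + (s - int k)) w)"
  proof -
    have "(\<Sum>j<J. \<Sum>k<B. ((of_int m gchoose j) * (of_int s gchoose k)) *\<^sub>F
      Z (Y u (l + int j) (gen (b (int k)) \<bullet> v)) (m + n - int j + (s - int k)) w) =
      (\<Sum>j<J. \<Sum>k<K. ((of_int m gchoose j) * (of_int s gchoose k)) *\<^sub>F
      Z (Y u (l + int j) (gen (b (int k)) \<bullet> v)) (m + n - int j + (s - int k)) w)"
      by (intro sum.cong refl sum.mono_neutral_right)
        (auto simp: B_def Kv fock_field_0[OF fock_map_field[OF Y_map]] fock_map_0[OF Z])
    also have "\<dots> = (\<Sum>k<K. \<Sum>j<J. ((of_int m gchoose j) * (of_int s gchoose k)) *\<^sub>F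
      Z (Y u (l + int j) (gen (b (int k)) \<bullet> v)) (m + n - int j + (s - int k)) w)"
      by (rule sum.swap)
    also have "\<dots> = (\<Sum>k<K. (of_int s gchoose k) *\<^sub>F
      iterate_product Z (\<lambda>i. Y u i (gen (b (int k)) \<bullet> v)) l m (n + (s - int k)) w)"
    proof (intro sum.cong refl)
      fix k :: nat
      have eq: "m + (n + (s - int k)) - int j = m + n - int j + (s - int k)" for j by simp
      have "iterate_product Z (\<lambda>i. Y u i (gen (b (int k)) \<bullet> v)) l m (n + (s - int k)) w =
        (\<Sum>j<J. (of_int m gchoose j) *\<^sub>F Z (Y u (l + int j) (gen (b (int k)) \<bullet> v))
          (m + n - int j + (s - int k)) w)"
        unfolding eq[symmetric] by (rule iterate_product_lessThan[OF Z]) (rule J(2))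
      then show "(\<Sum>j<J. ((of_int m gchoose j) * (of_int s gchoose k)) *\<^sub>F
          Z (Y u (l + int j) (gen (b (int k)) \<bullet> v)) (m + n - int j + (s - int k)) w) =
        (of_int s gchoose k) *\<^sub>F
          iterate_product Z (\<lambda>i. Y u i (gen (b (int k)) \<bullet> v)) l m (n + (s - int k)) w"
        by (simp only: fock.scale_sum_right fock.scale_scale mult.commute)
    qed
    finally show ?thesis .
  qed
  have "(\<Sum>j<J. \<Sum>k<B. \<Sum>t\<le>k. ((of_int m gchoose j) * (of_int s gchoose k) * of_nat (k choose t)) *\<^sub>F
      Z (y t (j + (k - t))) (m + n - int j + (s - int k)) w) =
    (\<Sum>j<J. \<Sum>k<B. \<Sum>t\<le>k. ((of_int m gchoose j) * (of_int s gchoose t) * (of_int s - of_nat t gchoose (k - t))) *\<^sub>F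
      F t (j + (k - t)))"
  proof (intro sum.cong refl)
    fix j k t :: nat assume "t \<in> {..k}"
    then have t: "t \<le> k" by simp
    \<comment> \<open>Trinomial revision separates the factor depending on \<open>t\<close> alone
      from one in \<open>k - t\<close>, which the later convolution in \<open>j\<close> can
      absorb.\<close>
    have "(of_int s gchoose k) * (of_nat (k choose t) :: complex) =
      (of_int s gchoose t) * (of_int s - of_nat t gchoose (k - t))"
      using gbinomial_trinomial_revision[OF t, of "of_int s :: complex"]
      by (simp add: binomial_gbinomial)
    moreover have "m + n - int j + (s - int k) = m + n + s - int t - int (j + (k - t))"
      using t by simp
    ultimately show "((of_int m gchoose j) * (of_int s gchoose k) * of_nat (k choose t)) *\<^sub>F
      Z (y t (j + (k - t))) (m + n - int j + (s - int k)) w =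
      ((of_int m gchoose j) * (of_int s gchoose t) * (of_int s - of_nat t gchoose (k - t))) *\<^sub>F
      F t (j + (k - t))"
      by (simp only: F_def mult.assoc)
  qed
  also have "\<dots> = (\<Sum>(j, k, t)\<in>{..<J} \<times> (SIGMA k:{..<B}. {..k}).
    ((of_int m gchoose j) * (of_int s gchoose t) * (of_int s - of_nat t gchoose (k - t))) *\<^sub>F
      F t (j + (k - t)))"
    by (rule sum_triple) auto
  \<comment> \<open>The substitution \<open>i = j + (k - t)\<close>. Triples with \<open>t\<close>
    at least \<open>K\<close> or \<open>i\<close> at least \<open>J\<close> contribute 0 and may be
    dropped; the remaining \<open>t\<close>, \<open>i\<close> give \<open>k = t + (i - j)\<close>
    below \<open>B\<close>.\<close>
  also have "\<dots> = (\<Sum>(t, i, j)\<in>{..<K} \<times> (SIGMA i:{..<J}. {..i}).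
    ((of_int m gchoose j) * (of_int s gchoose t) * (of_int s - of_nat t gchoose (i - j))) *\<^sub>F F t i)"
    by (rule sum.reindex_bij_witness_not_neutral[where
          S' = "{(j, k, t). (j, k, t) \<in> {..<J} \<times> (SIGMA k:{..<B}. {..k}) \<and> (K \<le> t \<or> J \<le> j + (k - t))}"
          and T' = "{}" and i = "\<lambda>(t, i, j). (j, t + (i - j), t)" and j = "\<lambda>(j, k, t). (t, j + (k - t), j)"])
      (auto simp: F0 B_def intro: finite_subset[of _ "{..<J} \<times> (SIGMA k:{..<B}. {..k})"])
  also have "\<dots> = (\<Sum>t<K. \<Sum>i<J. \<Sum>j\<le>i.
    ((of_int m gchoose j) * (of_int s gchoose t) * (of_int s - of_nat t gchoose (i - j))) *\<^sub>F F t i)"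
    by (rule sum_triple[symmetric]) auto
  also have "\<dots> = (\<Sum>t<K. \<Sum>i<J. ((of_int s gchoose t) * (of_int (m + (s - int t)) gchoose i)) *\<^sub>F F t i)"
  proof (intro sum.cong refl)
    fix t i :: nat
    have "(\<Sum>j\<le>i. (of_int m gchoose j) * (of_int s gchoose t) * (of_int s - of_nat t gchoose (i - j)))
      = (of_int s gchoose t) * (\<Sum>j\<le>i. (of_int m gchoose j) * ((of_int s - of_nat t :: complex) gchoose (i - j)))"
      by (simp add: sum_distrib_left mult_ac)
    also have "\<dots> = (of_int s gchoose t) * (of_int (m + (s - int t)) gchoose i)"
      using gbinomial_convolution[where i = i and m = "of_int m" and x = "of_int s - of_nat t"] by (simp add: algebra_simps)
    finally show "(\<Sum>j\<le>i. ((of_int m gchoose j) * (of_int s gchoose t) *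
        (of_int s - of_nat t gchoose (i - j))) *\<^sub>F F t i) =
      ((of_int s gchoose t) * (of_int (m + (s - int t)) gchoose i)) *\<^sub>F F t i"
      by (simp flip: fock.scale_sum_left)
  qed
  also have "\<dots> = (\<Sum>t<K. (of_int s gchoose t) *\<^sub>F
      iterate_product Z (\<lambda>i. Y (gen (b (int t)) \<bullet> u) i v) l (m + (s - int t)) n w)"
  proof (intro sum.cong refl)
    fix t :: nat
    have "iterate_product Z (\<lambda>i. Y (gen (b (int t)) \<bullet> u) i v) l (m + (s - int t)) n w =
      (\<Sum>i<J. (of_int (m + (s - int t)) gchoose i) *\<^sub>F
        Z (y t i) (m + (s - int t) + n - int i) w)"
      unfolding y_def
      by (rule iterate_product_lessThan[where f = "\<lambda>i. Y (gen (b (int t)) \<bullet> u) i v", OF Z])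
        (rule yJ[unfolded y_def])
    moreover have "m + (s - int t) + n - int i = m + n + s - int t - int i" for i by simp
    ultimately show "(\<Sum>i<J. ((of_int s gchoose t) * (of_int (m + (s - int t)) gchoose i)) *\<^sub>F F t i) =
      (of_int s gchoose t) *\<^sub>F
      iterate_product Z (\<lambda>i. Y (gen (b (int t)) \<bullet> u) i v) l (m + (s - int t)) n w"
      unfolding F_def fock.scale_scale[symmetric] fock.scale_sum_right[symmetric] by simp
  qed
  finally show ?thesis unfolding split first by (rule arg_cong)
qed

lemma bracket_twist_left:
  assumes "fock_map Z" "fock_field \<psi>" "\<And>k. K \<le> k \<Longrightarrow> gen (b (int k)) \<bullet> u = 0"
  shows "bracket (twist Z u) \<psi> l m n w = (\<Sum>k<K. (of_int s gchoose k) *\<^sub>F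
    bracket (Z (gen (b (int k)) \<bullet> u)) \<psi> l (m + (s - int k)) n w)"
proof -
  have eq: "twist Z u = (\<lambda>n w. \<Sum>k<K. (of_int s gchoose k) *\<^sub>F
    Z (gen (b (int k)) \<bullet> u) (n + (s - int k)) w)"
    by (rule twist_lessThan[OF assms(1)]) (rule assms(3))
  show ?thesis unfolding eq
    by (rule bracket_sum_left) (simp_all add: assms(2) fock_map_field[OF assms(1)])
qed

lemma bracket_twist_right:
  assumes "fock_map Z" "fock_field \<phi>" "\<And>k. K \<le> k \<Longrightarrow> gen (b (int k)) \<bullet> v = 0"
  shows "bracket \<phi> (twist Z v) l m n w = (\<Sum>k<K. (of_int s gchoose k) *\<^sub>F
    bracket \<phi> (Z (gen (b (int k)) \<bullet> v)) l m (n + (s - int k)) w)"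
proof -
  have eq: "twist Z v = (\<lambda>n w. \<Sum>k<K. (of_int s gchoose k) *\<^sub>F
    Z (gen (b (int k)) \<bullet> v) (n + (s - int k)) w)"
    by (rule twist_lessThan[OF assms(1)]) (rule assms(3))
  show ?thesis unfolding eq
    by (rule bracket_sum_right) (simp_all add: assms(2) fock_map_field[OF assms(1)])
qed

text \<open>The coefficient of c^N in Z(exp(c X(z)) v, z); the factors 1/N accumulate to the 1/N! of
  the exponential.\<close>

primrec twist_power :: "(fock \<Rightarrow> int \<Rightarrow> fock \<Rightarrow> fock) \<Rightarrow> nat \<Rightarrow> fock \<Rightarrow> int \<Rightarrow> fock \<Rightarrow> fock" where
  "twist_power Z 0 = Z"
| "twist_power Z (Suc N) = (\<lambda>v n w. (1 / of_nat (Suc N)) *\<^sub>F twist (twist_power Z N) v n w)"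

lemma twist_twist_power:
  "twist (twist_power Z N) v = (\<lambda>n w. of_nat (Suc N) *\<^sub>F twist_power Z (Suc N) v n w)"
  by (simp del: of_nat_Suc)

lemma fock_map_twist_power:
  assumes "fock_map Z" shows "fock_map (twist_power Z N)"
proof (induction N)
  case (Suc N)
  then have "fock_map (twist (twist_power Z N))" by (rule fock_map_twist)
  then show ?case
    by (auto simp: fock_map_def fock_field_def fock.scale_right_distrib mult.commute)
       metis
qed (simp add: assms)

text \<open>This is the Leibniz rule for the derivative in c, read off at one power of c. Twisting
  the right side amounts to twisting either the field of \<open>u\<close> or the field of
  \<open>v\<close> on the left.\<close>

lemma twist_power_jacobi:
  assumes "is_module Z"
  shows "(\<Sum>i\<le>N. bracket (twist_power Z i u) (twist_power Z (N - i) v) l m n w) =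
    iterate_product (twist_power Z N) (\<lambda>i. Y u i v) l m n w"
proof (induction N arbitrary: u v l m n)
  case 0
  then show ?case using assms by (simp add: is_module_def fock_jacobi_def)
next
  case (Suc N)
  have Z: "fock_map (twist_power Z i)" for i
    using assms by (intro fock_map_twist_power) (simp add: is_module_def)
  note Zf = fock_map_field[OF Z]
  obtain K1 where K1: "\<And>k. K1 \<le> k \<Longrightarrow> gen (b (int k)) \<bullet> u = 0" using modes_truncated by blast
  obtain K2 where K2: "\<And>k. K2 \<le> k \<Longrightarrow> gen (b (int k)) \<bullet> v = 0" using modes_truncated by blast
  define K where "K = max K1 K2"
  have Ku: "gen (b (int k)) \<bullet> u = 0" if "K \<le> k" for k using K1 that by (simp add: K_def)
  have Kv: "gen (b (int k)) \<bullet> v = 0" if "K \<le> k" for k using K2 that by (simp add: K_def)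
  define X where "X i = bracket (twist_power Z i u) (twist_power Z (Suc N - i) v) l m n w" for i
  have "of_nat (Suc N) *\<^sub>F iterate_product (twist_power Z (Suc N)) (\<lambda>i. Y u i v) l m n w =
    iterate_product (twist (twist_power Z N)) (\<lambda>i. Y u i v) l m n w"
  proof -
    obtain J where J: "\<And>j. J \<le> j \<Longrightarrow> Y u (l + int j) v = 0" using Y_truncated by blast
    have "iterate_product Z' (\<lambda>i. Y u i v) l m n w =
      (\<Sum>j<J. (of_int m gchoose j) *\<^sub>F Z' (Y u (l + int j) v) (m + n - int j) w)"
      if "fock_map Z'" for Z'
      using that by (rule iterate_product_lessThan) (rule J)
    from this[OF Z[of "Suc N"]] this[OF fock_map_twist[OF Z[of N]]] show ?thesis
      unfolding twist_twist_power fock.scale_sum_right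
      by (simp add: mult.commute fock.scale_sum_right del: twist_power.simps of_nat_Suc)
  qed
  also have "\<dots> =
    (\<Sum>k<K. (of_int s gchoose k) *\<^sub>F (\<Sum>i\<le>N. bracket (twist_power Z i u)
      (twist_power Z (N - i) (gen (b (int k)) \<bullet> v)) l m (n + (s - int k)) w)) +
    (\<Sum>t<K. (of_int s gchoose t) *\<^sub>F (\<Sum>i\<le>N. bracket
      (twist_power Z i (gen (b (int t)) \<bullet> u)) (twist_power Z (N - i) v) l (m + (s - int t)) n w))"
    unfolding Suc.IH by (rule iterate_product_twist[OF Z]) (fact Kv Ku)+
  also have "\<dots> =
    (\<Sum>i\<le>N. bracket (twist_power Z i u) (twist (twist_power Z (N - i)) v) l m n w) +
    (\<Sum>i\<le>N. bracket (twist (twist_power Z i) u) (twist_power Z (N - i) v) l m n w)"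
  proof -
    have "bracket (twist_power Z i u) (twist (twist_power Z (N - i)) v) l m n w =
      (\<Sum>k<K. (of_int s gchoose k) *\<^sub>F bracket (twist_power Z i u)
      (twist_power Z (N - i) (gen (b (int k)) \<bullet> v)) l m (n + (s - int k)) w)" for i
      by (rule bracket_twist_right[OF Z Zf]) (rule Kv)
    moreover have "bracket (twist (twist_power Z i) u) (twist_power Z (N - i) v) l m n w =
      (\<Sum>t<K. (of_int s gchoose t) *\<^sub>F bracket
      (twist_power Z i (gen (b (int t)) \<bullet> u)) (twist_power Z (N - i) v) l (m + (s - int t)) n w)" for i
      by (rule bracket_twist_left[OF Z Zf]) (rule Ku)
    ultimately show ?thesis
      by (simp only: fock.scale_sum_right sum.swap[of _ "{..N}" "{..<K}"])
  qed
  \<comment> \<open>Twisting the divided power \<open>i\<close> gives \<open>Suc i\<close> times the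
    next one. So \<open>X i\<close> is counted \<open>Suc N - i\<close> times through
    \<open>v\<close> and \<open>i\<close> times through \<open>u\<close>, in total
    \<open>Suc N\<close> times whatever \<open>i\<close> is.\<close>
  also have "\<dots> = (\<Sum>i\<le>N. of_nat (Suc N - i) *\<^sub>F X i) + (\<Sum>i\<le>N. of_nat (Suc i) *\<^sub>F X (Suc i))"
  proof -
    have scale_left: "bracket (\<lambda>n w. c *\<^sub>F twist_power Z i x n w) (twist_power Z j y) l m n w =
      c *\<^sub>F bracket (twist_power Z i x) (twist_power Z j y) l m n w" for c i j x y
      using bracket_sum_left[of "{()}" "\<lambda>_. twist_power Z i x" "twist_power Z j y" "\<lambda>_. c" "\<lambda>_. 0"]
      by (simp add: Zf)
    have scale_right: "bracket (twist_power Z j y) (\<lambda>n w. c *\<^sub>F twist_power Z i x n w) l m n w =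
      c *\<^sub>F bracket (twist_power Z j y) (twist_power Z i x) l m n w" for c i j x y
      using bracket_sum_right[of "{()}" "\<lambda>_. twist_power Z i x" "twist_power Z j y" "\<lambda>_. c" "\<lambda>_. 0"]
      by (simp add: Zf)
    show ?thesis
      unfolding twist_twist_power scale_left scale_right X_def
      by (intro arg_cong2[where f = "(+)"] sum.cong refl)
        (simp_all add: Suc_diff_le del: twist_power.simps)
  qed
  also have "(\<Sum>i\<le>N. of_nat (Suc N - i) *\<^sub>F X i) = (\<Sum>i\<le>Suc N. of_nat (Suc N - i) *\<^sub>F X i)"
    by simp
  also have "(\<Sum>i\<le>N. of_nat (Suc i) *\<^sub>F X (Suc i)) = (\<Sum>i\<le>Suc N. of_nat i *\<^sub>F X i)"
    by (subst sum.atMost_Suc_shift) simp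
  also have "(\<Sum>i\<le>Suc N. of_nat (Suc N - i) *\<^sub>F X i) + (\<Sum>i\<le>Suc N. of_nat i *\<^sub>F X i) =
    of_nat (Suc N) *\<^sub>F (\<Sum>i\<le>Suc N. X i)"
    unfolding sum.distrib[symmetric] fock.scale_sum_right
    by (intro sum.cong refl) (simp add: of_nat_diff flip: fock.scale_left_distrib)
  finally show ?case unfolding X_def
    by (simp only: fock.scale_cancel_left) (simp del: of_nat_Suc)
qed

text \<open>X(z) consists of annihilation operators, each lowering the degree by one, so more than
  \<open>d\<close> of them kill a vector of degree \<open>d\<close>.\<close>

lemma twist_power_vanish:
  assumes "fock_map Z"
  shows "fock_degree d v \<Longrightarrow> d < N \<Longrightarrow> twist_power Z N v n w = 0"
proof (induction N arbitrary: v d n w)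
  case (Suc N)
  have "twist_power Z N (gen (b (int k)) \<bullet> v) n' w = 0" for k n'
  proof (cases d)
    case 0
    then show ?thesis
      using fock_degree_annihilate[OF b Suc.prems(1)] fock_map_0[OF fock_map_twist_power[OF assms]]
      by simp
  next
    case (Suc d')
    then show ?thesis
      using fock_degree_annihilate[OF b Suc.prems(1)] Suc.prems(2) by (intro Suc.IH[of d']) simp_all
  qed
  then show ?case by (simp add: twist_def)
qed simp

section \<open>The exponential twist\<close>

definition exp_twist :: "complex \<Rightarrow> (fock \<Rightarrow> int \<Rightarrow> fock \<Rightarrow> fock) \<Rightarrow> fock \<Rightarrow> int \<Rightarrow> fock \<Rightarrow> fock" where
  "exp_twist c Z v n w = Sum_any (\<lambda>N. c ^ N *\<^sub>F twist_power Z N v n w)"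

text \<open>The form \<open>n + 0\<close> exhibits the sum as an instance of \<open>n + d k\<close>
  with \<open>d = 0\<close>, as in \<open>fock_field_sumI\<close> and
  \<open>bracket_sum_left\<close>.\<close>

lemma exp_twist_lessThan:
  assumes "fock_map Z" "fock_degree d v" "d < D"
  shows "exp_twist c Z v = (\<lambda>n w. \<Sum>N<D. c ^ N *\<^sub>F twist_power Z N v (n + 0) w)"
  unfolding exp_twist_def
proof (intro ext, subst Sum_any_lessThan[of D])
  fix N n w assume "D \<le> N"
  then show "c ^ N *\<^sub>F twist_power Z N v n w = 0"
    using twist_power_vanish[OF assms(1,2), of N] assms(3) by simp
qed simp

lemma fock_map_exp_twist:
  assumes "fock_map Z" shows "fock_map (exp_twist c Z)"
proof -
  note Z = fock_map_twist_power[OF assms]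
  have "fock_field (exp_twist c Z v)" for v
  proof -
    obtain d where "fock_degree d v" using fock_degree_exists by blast
    from exp_twist_lessThan[OF assms this lessI] show ?thesis
      by (simp only:) (rule fock_field_sumI, simp_all only: finite_lessThan fock_map_field[OF Z])
  qed
  moreover have "exp_twist c Z (u + v) n w = exp_twist c Z u n w + exp_twist c Z v n w" for u v n w
  proof -
    obtain d1 d2 where d: "fock_degree d1 u" "fock_degree d2 v" using fock_degree_exists by blast
    have "fock_degree (max d1 d2) u" "fock_degree (max d1 d2) v"
      using fock_degree_mono[OF _ d(1)] fock_degree_mono[OF _ d(2)] by auto
    note d = this fock_degree.add[OF this]
    show ?thesis
      unfolding d[THEN exp_twist_lessThan[OF assms _ lessI]]
      by (simp only: fock_map_add[OF Z] fock.scale_right_distrib sum.distrib)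
  qed
  moreover have "exp_twist c Z (e *\<^sub>F v) n w = e *\<^sub>F exp_twist c Z v n w" for e v n w
  proof -
    obtain d where d: "fock_degree d v" using fock_degree_exists by blast
    note d = this fock_degree_scale[OF this, of e]
    show ?thesis
      unfolding d[THEN exp_twist_lessThan[OF assms _ lessI]]
      by (simp only: fock_map_scale[OF Z] fock.scale_sum_right fock.scale_left_commute)
  qed
  ultimately show ?thesis unfolding fock_map_def by blast
qed

lemma exp_twist_vac:
  assumes "fock_map Z" shows "exp_twist c Z fock_vac = Z fock_vac"
proof -
  have "fock_degree 0 fock_vac" using fock_degree.scale_vac[of 0 1] by simp
  from exp_twist_lessThan[OF assms this, of 1] show ?thesis by (simp add: fun_eq_iff)
qed

text \<open>Multiply the identities of \<open>twist_power_jacobi\<close> by c^N and add: the left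
  side is then the Cauchy product of the two exponential series. Everything is cut to finite sums by
  degree bounds.\<close>

lemma fock_jacobi_exp_twist:
  assumes "is_module Z" shows "fock_jacobi Y (exp_twist c Z)"
  unfolding fock_jacobi_def
proof (intro allI)
  fix u v w l m n
  have Z: "fock_map Z" using assms by (simp add: is_module_def)
  note P = fock_map_twist_power[OF Z] and Pf = fock_map_field[OF fock_map_twist_power[OF Z]]
  obtain du dv where d: "fock_degree du u" "fock_degree dv v" using fock_degree_exists by blast
  define D where "D = Suc (du + dv)"
  obtain J where J: "\<And>j. J \<le> j \<Longrightarrow> Y u (l + int j) v = 0" using Y_truncated by blast
  define e where "e j = (SOME d. fock_degree d (Y u (l + int j) v))" for j
  have e: "fock_degree (e j) (Y u (l + int j) v)" for j
    unfolding e_def by (rule someI_ex) (rule fock_degree_exists)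
  \<comment> \<open>One bound for both sides: it exceeds every \<open>i + j\<close> with
    \<open>i\<close>, \<open>j\<close> below \<open>D\<close>, and also the degree of each vector
    \<open>Y u (l + int j) v\<close> with \<open>j < J\<close>.\<close>
  define E where "E = Suc (2 * D + (\<Sum>j<J. e j))"
  define X where "X i j = bracket (twist_power Z i u) (twist_power Z j v) l m n w" for i j
  have "e j < E" if "j < J" for j
    using member_le_sum[of j "{..<J}" e] that by (simp add: E_def)
  note expY = exp_twist_lessThan[OF Z e this]
  have X0: "X i j = 0" if "D \<le> i \<or> D \<le> j" for i j
  proof -
    have zero: "bracket (\<lambda>n w. 0) \<psi> l m n w = 0" "bracket \<psi> (\<lambda>n w. 0) l m n w = 0"
      if "fock_field \<psi>" for \<psi>
      using that by (simp_all add: bracket_def delta_product_def fock_field_0)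
    from that show ?thesis
    proof
      assume "D \<le> i"
      then have "twist_power Z i u = (\<lambda>n w. 0)"
        using twist_power_vanish[OF Z d(1)] by (simp add: fun_eq_iff D_def)
      then show ?thesis by (simp add: X_def zero Pf)
    next
      assume "D \<le> j"
      then have "twist_power Z j v = (\<lambda>n w. 0)"
        using twist_power_vanish[OF Z d(2)] by (simp add: fun_eq_iff D_def)
      then show ?thesis by (simp add: X_def zero Pf)
    qed
  qed
  have u: "exp_twist c Z u = (\<lambda>n w. \<Sum>N<D. c ^ N *\<^sub>F twist_power Z N u (n + 0) w)"
    by (rule exp_twist_lessThan[OF Z d(1)]) (simp add: D_def)
  have v: "exp_twist c Z v = (\<lambda>n w. \<Sum>N<D. c ^ N *\<^sub>F twist_power Z N v (n + 0) w)"
    by (rule exp_twist_lessThan[OF Z d(2)]) (simp add: D_def)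
  have "bracket (exp_twist c Z u) (exp_twist c Z v) l m n w =
    (\<Sum>i<D. c ^ i *\<^sub>F bracket (twist_power Z i u) (exp_twist c Z v) l (m + 0) n w)"
    unfolding u by (rule bracket_sum_left) (simp_all add: Pf fock_map_field[OF fock_map_exp_twist[OF Z]])
  also have "\<dots> = (\<Sum>i<D. c ^ i *\<^sub>F (\<Sum>j<D. c ^ j *\<^sub>F X i j))"
  proof (intro sum.cong refl)
    fix i
    have "bracket (twist_power Z i u) (exp_twist c Z v) l (m + 0) n w =
      (\<Sum>j<D. c ^ j *\<^sub>F bracket (twist_power Z i u) (twist_power Z j v) l (m + 0) (n + 0) w)"
      unfolding v by (rule bracket_sum_right) (simp_all add: Pf)
    then show "c ^ i *\<^sub>F bracket (twist_power Z i u) (exp_twist c Z v) l (m + 0) n w =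
      c ^ i *\<^sub>F (\<Sum>j<D. c ^ j *\<^sub>F X i j)"
      by (simp add: X_def)
  qed
  also have "\<dots> = (\<Sum>(i, j)\<in>{..<D} \<times> {..<D}. c ^ (i + j) *\<^sub>F X i j)"
    by (simp add: fock.scale_sum_right sum.cartesian_product power_add)
  also have "\<dots> = (\<Sum>(N, i)\<in>(SIGMA N:{..<E}. {..N}). c ^ N *\<^sub>F X i (N - i))"
    by (rule sum.reindex_bij_witness_not_neutral[where S' = "{}"
          and T' = "{(N, i). (N, i) \<in> (SIGMA N:{..<E}. {..N}) \<and> (D \<le> i \<or> D \<le> N - i)}"
          and i = "\<lambda>(N, i). (i, N - i)" and j = "\<lambda>(i, j). (i + j, i)"])
      (auto simp: X0 E_def intro: finite_subset[of _ "SIGMA N:{..<E}. {..N}"])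
  also have "\<dots> = (\<Sum>N<E. c ^ N *\<^sub>F (\<Sum>i\<le>N. X i (N - i)))"
    by (simp add: sum.Sigma fock.scale_sum_right)
  also have "\<dots> = (\<Sum>N<E. c ^ N *\<^sub>F iterate_product (twist_power Z N) (\<lambda>i. Y u i v) l m n w)"
    unfolding X_def twist_power_jacobi[OF assms] ..
  also have "\<dots> = (\<Sum>N<E. c ^ N *\<^sub>F (\<Sum>j<J. (of_int m gchoose j) *\<^sub>F
      twist_power Z N (Y u (l + int j) v) (m + n - int j) w))"
  proof (intro sum.cong refl arg_cong[where f = "\<lambda>x. _ *\<^sub>F x"])
    fix N
    show "iterate_product (twist_power Z N) (\<lambda>i. Y u i v) l m n w = (\<Sum>j<J. (of_int m gchoose j) *\<^sub>F
      twist_power Z N (Y u (l + int j) v) (m + n - int j) w)"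
      by (rule iterate_product_lessThan[OF P]) (rule J)
  qed
  also have "\<dots> = (\<Sum>j<J. (of_int m gchoose j) *\<^sub>F (\<Sum>N<E. c ^ N *\<^sub>F
      twist_power Z N (Y u (l + int j) v) (m + n - int j) w))"
    by (rule scale_sum_swap)
  also have "\<dots> = (\<Sum>j<J. (of_int m gchoose j) *\<^sub>F exp_twist c Z (Y u (l + int j) v) (m + n - int j) w)"
    by (intro sum.cong refl) (simp add: expY)
  also have "\<dots> = iterate_product (exp_twist c Z) (\<lambda>i. Y u i v) l m n w"
    by (rule iterate_product_lessThan[OF fock_map_exp_twist[OF Z], symmetric]) (rule J)
  finally show "bracket (exp_twist c Z u) (exp_twist c Z v) l m n w =
    iterate_product (exp_twist c Z) (\<lambda>i. Y u i v) l m n w" .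
qed

lemma is_module_exp_twist: "is_module Z \<Longrightarrow> is_module (exp_twist c Z)"
  using fock_jacobi_exp_twist[of Z c] fock_map_exp_twist[of Z c] exp_twist_vac[of Z c]
  by (simp add: is_module_def)

text \<open>X(z) sends this vector to e z^s times the vacuum, and a second application gives 0. The
  field therefore gains exactly the scalar c e z^s, which sits at the mode with
  \<open>n + s = - 1\<close>. The value \<open>e = 0\<close> covers a generator left
  unchanged.\<close>

lemma exp_twist_creator:
  assumes "is_module Z" "\<not> annihilator y"
    and br: "\<And>k. br (b (int k)) y = (if k = 0 then e else 0)"
  shows "exp_twist c Z (gen y \<bullet> fock_vac) n w =
    Z (gen y \<bullet> fock_vac) n w + (if n + s = - 1 then c * e else 0) *\<^sub>F w"
proof -
  have Z: "fock_map Z" "\<And>n w. Z fock_vac n w = (if n = - 1 then w else 0)"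
    using assms(1) by (auto simp: is_module_def)
  have "fock_degree 1 (gen y \<bullet> fock_vac)"
    using fock_degree.create[OF assms(2) fock_degree.scale_vac[of 0 1]] by simp
  from exp_twist_lessThan[OF Z(1) this, of 2 c]
  have "exp_twist c Z (gen y \<bullet> fock_vac) n w =
    Z (gen y \<bullet> fock_vac) n w + c *\<^sub>F twist Z (gen y \<bullet> fock_vac) n w"
    by (simp add: numeral_2_eq_2)
  moreover have "gen (b (int k)) \<bullet> gen y \<bullet> fock_vac = (if k = 0 then e *\<^sub>F fock_vac else 0)" for k
    by (simp add: gen_act_swap[of _ y] annihilator_vac[OF b] fock_act_zero_right br)
  then have "twist Z (gen y \<bullet> fock_vac) n w = (\<Sum>k<1. (of_int s gchoose k) *\<^sub>F
    Z (gen (b (int k)) \<bullet> gen y \<bullet> fock_vac) (n + (s - int k)) w)"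
    by (subst twist_lessThan[OF Z(1), of 1]) auto
  ultimately show ?thesis
    using \<open>\<And>k. gen (b (int k)) \<bullet> gen y \<bullet> fock_vac = (if k = 0 then e *\<^sub>F fock_vac else 0)\<close>[of 0]
    by (simp add: fock_map_scale[OF Z(1)] Z(2))
qed

end

section \<open>Shifting the modes of the two generators one at a time\<close>

lemma shift_module_a:
  assumes "is_module Z"
  obtains Z' where "is_module Z'"
    "\<And>n w. Z' (gen (A (- 1)) \<bullet> fock_vac) n w =
      Z (gen (A (- 1)) \<bullet> fock_vac) n w + (if n = k then c else 0) *\<^sub>F w"
    "\<And>n w. Z' (gen (As 0) \<bullet> fock_vac) n w = Z (gen (As 0) \<bullet> fock_vac) n w"
proof -
  \<comment> \<open>The field a*(z) pairs with a(-1), and \<open>- k - 1\<close> is the exponent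
    \<open>s\<close> solving \<open>n + s = - 1\<close> at \<open>n = k\<close>. The bracket of
    \<open>As 1\<close> with \<open>A (- 1)\<close> is -1, so the twist is taken with parameter
    \<open>- c\<close>.\<close>
  let ?b = "\<lambda>n. As (n + 1)" and ?s = "- k - 1"
  have b: "annihilator (?b (int j))" for j by simp
  \<comment> \<open>The second equation keeps a conditional with equal branches in order to match
    \<open>exp_twist_creator\<close> with \<open>e = 0\<close>.\<close>
  have br: "br (?b (int j)) (A (- 1)) = (if j = 0 then - 1 else 0)"
    "br (?b (int j)) (As 0) = (if j = 0 then 0 else 0)" for j
    by auto
  have "n + ?s = - 1 \<longleftrightarrow> n = k" for n by auto
  then show ?thesis
    using that[of "exp_twist ?b ?s (- c) Z"] is_module_exp_twist[OF Y_as b assms, of ?s "- c"]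
      exp_twist_creator[OF Y_as b assms _ br(1), of ?s "- c"]
      exp_twist_creator[OF Y_as b assms _ br(2), of ?s "- c"]
    by simp
qed

lemma shift_module_as:
  assumes "is_module Z"
  obtains Z' where "is_module Z'"
    "\<And>n w. Z' (gen (A (- 1)) \<bullet> fock_vac) n w = Z (gen (A (- 1)) \<bullet> fock_vac) n w"
    "\<And>n w. Z' (gen (As 0) \<bullet> fock_vac) n w =
      Z (gen (As 0) \<bullet> fock_vac) n w + (if n + 1 = k then c else 0) *\<^sub>F w"
proof -
  \<comment> \<open>Now \<open>n + s = - 1\<close> has to hold at \<open>n + 1 = k\<close>, because
    mode \<open>n\<close> of the second generator is \<open>As (n + 1)\<close>; and the bracket of
    \<open>A 0\<close> with \<open>As 0\<close> is +1.\<close>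
  let ?b = "A" and ?s = "- k"
  have b: "annihilator (?b (int j))" for j by simp
  have br: "br (?b (int j)) (A (- 1)) = (if j = 0 then 0 else 0)"
    "br (?b (int j)) (As 0) = (if j = 0 then 1 else 0)" for j
    by auto
  have "n + ?s = - 1 \<longleftrightarrow> n + 1 = k" for n by auto
  then show ?thesis
    using that[of "exp_twist ?b ?s c Z"] is_module_exp_twist[OF Y_a b assms, of ?s c]
      exp_twist_creator[OF Y_a b assms _ br(1), of ?s c]
      exp_twist_creator[OF Y_a b assms _ br(2), of ?s c]
    by simp
qed

text \<open>A single shift leaves the other generator and all other modes alone, so shifts
  accumulate over a finite set, first for a(z) and then for a*(z).\<close>

theorem shifted_module_exists:
  assumes "finite {k. \<alpha> k \<noteq> 0}" "finite {k. \<beta> k \<noteq> 0}"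
  obtains Z where "is_module Z"
    "\<And>n w. Z (gen (A (- 1)) \<bullet> fock_vac) n w = gen (A n) \<bullet> w + \<alpha> n *\<^sub>F w"
    "\<And>n w. Z (gen (As 0) \<bullet> fock_vac) n w = gen (As (n + 1)) \<bullet> w + \<beta> (n + 1) *\<^sub>F w"
proof -
  let ?r = "\<lambda>f S k. if k \<in> S then f k else (0 :: complex)"
  have "\<exists>Z. is_module Z \<and>
    (\<forall>n w. Z (gen (A (- 1)) \<bullet> fock_vac) n w = gen (A n) \<bullet> w + ?r \<alpha> S n *\<^sub>F w) \<and>
    (\<forall>n w. Z (gen (As 0) \<bullet> fock_vac) n w = gen (As (n + 1)) \<bullet> w)"
    if "finite S" for S
    using that
  proof (induction S rule: finite_induct)
    case empty
    show ?case by (intro exI[of _ Y]) (simp add: is_module_Y Y_a Y_as)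
  next
    case (insert k S)
    then obtain Z where Z: "is_module Z"
      "\<And>n w. Z (gen (A (- 1)) \<bullet> fock_vac) n w = gen (A n) \<bullet> w + ?r \<alpha> S n *\<^sub>F w"
      "\<And>n w. Z (gen (As 0) \<bullet> fock_vac) n w = gen (As (n + 1)) \<bullet> w"
      by blast
    obtain Z' where "is_module Z'"
      "\<And>n w. Z' (gen (A (- 1)) \<bullet> fock_vac) n w =
        Z (gen (A (- 1)) \<bullet> fock_vac) n w + (if n = k then \<alpha> k else 0) *\<^sub>F w"
      "\<And>n w. Z' (gen (As 0) \<bullet> fock_vac) n w = Z (gen (As 0) \<bullet> fock_vac) n w"
      using shift_module_a[OF Z(1)] by metis
    with Z insert.hyps show ?case by (intro exI[of _ Z']) auto
  qed
  note first = this
  have r: "?r f {k. f k \<noteq> 0} n = f n" for f n by simp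
  from first[OF assms(1)] obtain Z1 where Z1: "is_module Z1"
      "\<And>n w. Z1 (gen (A (- 1)) \<bullet> fock_vac) n w = gen (A n) \<bullet> w + \<alpha> n *\<^sub>F w"
      "\<And>n w. Z1 (gen (As 0) \<bullet> fock_vac) n w = gen (As (n + 1)) \<bullet> w"
    unfolding r by blast
  have "\<exists>Z. is_module Z \<and>
    (\<forall>n w. Z (gen (A (- 1)) \<bullet> fock_vac) n w = gen (A n) \<bullet> w + \<alpha> n *\<^sub>F w) \<and>
    (\<forall>n w. Z (gen (As 0) \<bullet> fock_vac) n w = gen (As (n + 1)) \<bullet> w + ?r \<beta> S (n + 1) *\<^sub>F w)"
    if "finite S" for S
    using that
  proof (induction S rule: finite_induct)
    case empty
    show ?case by (intro exI[of _ Z1]) (simp add: Z1)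
  next
    case (insert k S)
    then obtain Z where Z: "is_module Z"
      "\<And>n w. Z (gen (A (- 1)) \<bullet> fock_vac) n w = gen (A n) \<bullet> w + \<alpha> n *\<^sub>F w"
      "\<And>n w. Z (gen (As 0) \<bullet> fock_vac) n w = gen (As (n + 1)) \<bullet> w + ?r \<beta> S (n + 1) *\<^sub>F w"
      by blast
    obtain Z' where "is_module Z'"
      "\<And>n w. Z' (gen (A (- 1)) \<bullet> fock_vac) n w = Z (gen (A (- 1)) \<bullet> fock_vac) n w"
      "\<And>n w. Z' (gen (As 0) \<bullet> fock_vac) n w =
        Z (gen (As 0) \<bullet> fock_vac) n w + (if n + 1 = k then \<beta> k else 0) *\<^sub>F w"
      using shift_module_as[OF Z(1)] by metis
    with Z insert.hyps show ?case by (intro exI[of _ Z']) auto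
  qed
  from this[OF assms(2)] obtain Z where "is_module Z"
    "\<And>n w. Z (gen (A (- 1)) \<bullet> fock_vac) n w = gen (A n) \<bullet> w + \<alpha> n *\<^sub>F w"
    "\<And>n w. Z (gen (As 0) \<bullet> fock_vac) n w = gen (As (n + 1)) \<bullet> w + \<beta> (n + 1) *\<^sub>F w"
    unfolding r by blast
  then show ?thesis by (rule that)
qed

end


section \<open>Vertex operators on records modelled on the Fock space\<close>

lemma cring_complex_field: "cring complex_field"
proof (rule cringI)
  show "abelian_group complex_field"
    by (rule abelian_groupI) (auto simp: complex_field_def intro: exI[of _ "- _"])
  show "comm_monoid complex_field"
    by (rule comm_monoidI) (auto simp: complex_field_def)
qed (simp add: complex_field_def distrib_right)

lemma complex_field_simps [simp]:
  "carrier complex_field = UNIV" "x \<oplus>\<^bsub>complex_field\<^esub> y = x + y" "x \<otimes>\<^bsub>complex_field\<^esub> y = x * y"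
  "\<one>\<^bsub>complex_field\<^esub> = 1" "\<zero>\<^bsub>complex_field\<^esub> = 0"
  by (simp_all add: complex_field_def)

lemma scale_Sum_any: "c \<noteq> 0 \<Longrightarrow> c *\<^sub>F Sum_any f = Sum_any (\<lambda>j. c *\<^sub>F f j)"
  by (simp add: Sum_any.expand_set fock.scale_sum_right)

text \<open>A record that is a copy of the subspace \<open>S\<close> of the Fock space. For
  \<open>M\<close> and the Whittaker module \<open>S\<close> is everything; for the orbifold it is
  the fixed space of the rotation.\<close>

locale fock_model =
  fixes S :: "fock set" and \<phi> :: "fock \<Rightarrow> 'w" and W :: "(complex, 'w) module"
  assumes carrier: "carrier W = \<phi> ` S"
    and inj: "inj_on \<phi> S"
    and zero_mem: "0 \<in> S"
    and add_mem: "u \<in> S \<Longrightarrow> v \<in> S \<Longrightarrow> u + v \<in> S"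
    and scale_mem: "u \<in> S \<Longrightarrow> c *\<^sub>F u \<in> S"
    and map_zero: "\<phi> 0 = \<zero>\<^bsub>W\<^esub>"
    and map_add: "u \<in> S \<Longrightarrow> v \<in> S \<Longrightarrow> \<phi> (u + v) = \<phi> u \<oplus>\<^bsub>W\<^esub> \<phi> v"
    and map_scale: "u \<in> S \<Longrightarrow> \<phi> (c *\<^sub>F u) = c \<odot>\<^bsub>W\<^esub> \<phi> u"
begin

lemma uminus_mem: "u \<in> S \<Longrightarrow> - u \<in> S"
  using scale_mem[of u "- 1"] by simp

lemma diff_mem: "u \<in> S \<Longrightarrow> v \<in> S \<Longrightarrow> u - v \<in> S"
  using add_mem[of u "- v"] uminus_mem by simp

lemma sum_mem: "(\<And>x. x \<in> X \<Longrightarrow> f x \<in> S) \<Longrightarrow> sum f X \<in> S"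
  by (induction X rule: infinite_finite_induct) (auto simp: zero_mem add_mem)

lemma Sum_any_mem: "(\<And>x. f x \<in> S) \<Longrightarrow> Sum_any f \<in> S"
  by (simp add: Sum_any.expand_set sum_mem)

lemma abelian_group_W: "abelian_group W"
proof (rule abelian_groupI)
  fix x assume "x \<in> carrier W"
  then obtain u where u: "x = \<phi> u" "u \<in> S" by (auto simp: carrier)
  then have "\<phi> (- u) \<in> carrier W" "\<phi> (- u) \<oplus>\<^bsub>W\<^esub> x = \<zero>\<^bsub>W\<^esub>"
    using map_add[of "- u" u] by (auto simp: uminus_mem carrier map_zero)
  then show "\<exists>y\<in>carrier W. y \<oplus>\<^bsub>W\<^esub> x = \<zero>\<^bsub>W\<^esub>" by blast
qed (auto simp: carrier zero_mem add_mem add_ac simp flip: map_zero map_add)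

lemma module_W: "Module.module complex_field W"
proof (rule moduleI[OF cring_complex_field abelian_group_W])
  fix a b :: complex and x y
  assume "x \<in> carrier W" "y \<in> carrier W"
  then show "a \<odot>\<^bsub>W\<^esub> (x \<oplus>\<^bsub>W\<^esub> y) = a \<odot>\<^bsub>W\<^esub> x \<oplus>\<^bsub>W\<^esub> a \<odot>\<^bsub>W\<^esub> y"
    by (auto simp: carrier scale_mem add_mem fock.scale_right_distrib simp flip: map_scale map_add)
next
  fix x assume "x \<in> carrier W"
  then show "\<one>\<^bsub>complex_field\<^esub> \<odot>\<^bsub>W\<^esub> x = x"
    by (auto simp: carrier simp flip: map_scale)
qed (auto simp: carrier scale_mem fock.scale_left_distrib simp flip: map_scale map_add)

lemma map_diff: "u \<in> S \<Longrightarrow> v \<in> S \<Longrightarrow> \<phi> (u - v) = \<phi> u \<ominus>\<^bsub>W\<^esub> \<phi> v"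
proof -
  assume uv: "u \<in> S" "v \<in> S"
  have "\<ominus>\<^bsub>W\<^esub> \<phi> v = \<phi> (- v)"
    using map_add[of "- v" v] uv uminus_mem
    by (intro abelian_group.minus_equality[OF abelian_group_W]) (auto simp: carrier map_zero)
  then show ?thesis using map_add[of u "- v"] uv uminus_mem by (simp add: a_minus_def)
qed

lemma map_eq_zero: "u \<in> S \<Longrightarrow> \<phi> u = \<zero>\<^bsub>W\<^esub> \<longleftrightarrow> u = 0"
  using inj zero_mem by (auto simp: inj_on_def simp flip: map_zero)

lemma finsum_map:
  "finite X \<Longrightarrow> (\<And>x. x \<in> X \<Longrightarrow> f x \<in> S) \<Longrightarrow> finsum W (\<lambda>x. \<phi> (f x)) X = \<phi> (sum f X)"
proof (induction X rule: finite_induct)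
  case empty
  show ?case
    by (simp add: abelian_monoid.finsum_empty[OF abelian_group.axioms(1)[OF abelian_group_W]] map_zero)
next
  case (insert x X)
  then show ?case
    by (subst abelian_monoid.finsum_insert[OF abelian_group.axioms(1)[OF abelian_group_W]])
      (auto simp: carrier map_add sum_mem)
qed

text \<open>Both kinds of sum are 0 by convention on an infinite support, and \<phi> preserves
  supports on \<open>S\<close>, so the equality is unconditional.\<close>

lemma finite_support_sum_map:
  assumes "\<And>j. f j \<in> S"
  shows "finite_support_sum W (\<lambda>j. \<phi> (f j)) = \<phi> (Sum_any f)"
proof -
  have eq: "{j. \<phi> (f j) \<noteq> \<zero>\<^bsub>W\<^esub>} = {j. f j \<noteq> 0}" using assms by (simp add: map_eq_zero)
  show ?thesis
  proof (cases "finite {j. f j \<noteq> 0}")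
    case True
    then show ?thesis
      unfolding finite_support_sum_def eq Sum_any.expand_set by (intro finsum_map assms)
  next
    case False
    then show ?thesis
      unfolding finite_support_sum_def eq
      using abelian_monoid.finsum_infinite[OF abelian_group.axioms(1)[OF abelian_group_W]]
      by (simp add: map_zero)
  qed
qed

end

text \<open>The two subspaces are independent because the orbifold, modelled on a proper subspace in
  general, acts on the full Whittaker module.\<close>

locale vertex_operators_model =
  V: fock_model S1 \<phi>1 V + W: fock_model S2 \<phi>2 W
  for S1 :: "fock set" and \<phi>1 :: "fock \<Rightarrow> 'v" and V :: "(complex, 'v) module"
    and S2 :: "fock set" and \<phi>2 :: "fock \<Rightarrow> 'w" and W :: "(complex, 'w) module" +
  fixes YW :: "'v \<Rightarrow> int \<Rightarrow> 'w \<Rightarrow> 'w" and Z :: "fock \<Rightarrow> int \<Rightarrow> fock \<Rightarrow> fock"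
  assumes mem: "u \<in> S1 \<Longrightarrow> w \<in> S2 \<Longrightarrow> Z u n w \<in> S2"
    and map: "u \<in> S1 \<Longrightarrow> w \<in> S2 \<Longrightarrow> YW (\<phi>1 u) n (\<phi>2 w) = \<phi>2 (Z u n w)"
begin

lemma vertex_operators_record:
  assumes "fock_map Z" shows "vertex_operators V W YW"
proof -
  interpret V': Module.module complex_field V by (rule V.module_W)
  interpret W': Module.module complex_field W by (rule W.module_W)
  show ?thesis
  proof unfold_locales
    fix u w assume "u \<in> carrier V" "w \<in> carrier W"
    then obtain u' w' where uw: "u = \<phi>1 u'" "u' \<in> S1" "w = \<phi>2 w'" "w' \<in> S2"
      by (auto simp: V.carrier W.carrier)
    obtain N where "\<forall>n\<ge>N. Z u' n w' = 0"
      using fock_map_field[OF assms] unfolding fock_field_def by blast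
    then show "\<exists>N. \<forall>n\<ge>N. YW u n w = \<zero>\<^bsub>W\<^esub>"
      by (intro exI[of _ N]) (simp add: uw map W.map_zero)
  qed (auto simp: V.carrier W.carrier V.add_mem V.scale_mem W.add_mem W.scale_mem map mem
      fock_map_add[OF assms] fock_map_scale[OF assms] fock_field_scale[OF fock_map_field[OF assms]]
      fock_map_field[OF assms, unfolded fock_field_def]
      simp flip: V.map_add V.map_scale W.map_add W.map_scale)
qed

text \<open>The converse transport, for structures that are given on records: the operators of
  \<open>M\<close>, and an arbitrary module structure on the Whittaker module. Both subspaces are
  everything since \<open>fock_map\<close> speaks of all vectors.\<close>

lemma fock_map_of_record:
  assumes "vertex_operators V W YW" "S1 = UNIV" "S2 = UNIV"
  shows "fock_map Z"
proof -
  interpret vertex_operators V W YW by fact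
  have mem1: "\<phi>1 u \<in> carrier V" and mem2: "\<phi>2 w \<in> carrier W" for u w
    using assms by (auto simp: V.carrier W.carrier)
  have eqI: "\<phi>2 v = \<phi>2 w \<Longrightarrow> v = w" for v w using W.inj assms by (auto dest: inj_onD)
  note m = map[unfolded assms, OF UNIV_I UNIV_I, symmetric]
    and simps = V.map_add[unfolded assms, OF UNIV_I UNIV_I] W.map_add[unfolded assms, OF UNIV_I UNIV_I]
      V.map_scale[unfolded assms, OF UNIV_I] W.map_scale[unfolded assms, OF UNIV_I]
  have "\<exists>N. \<forall>n\<ge>N. Z u n w = 0" for u w
    using truncation[OF mem1[of u] mem2[of w]] W.map_eq_zero[unfolded assms, OF UNIV_I]
    by (simp add: map assms)
  moreover have "Z u n (v + w) = Z u n v + Z u n w" for u n v w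
    by (rule eqI) (simp add: m simps add_right mem1 mem2)
  moreover have "Z u n (c *\<^sub>F w) = c *\<^sub>F Z u n w" for u n c w
    by (rule eqI) (simp add: m simps smult_right mem1 mem2)
  moreover have "Z (u + v) n w = Z u n w + Z v n w" for u n v w
    by (rule eqI) (simp add: m simps add_left mem1 mem2)
  moreover have "Z (c *\<^sub>F u) n w = c *\<^sub>F Z u n w" for u n c w
    by (rule eqI) (simp add: m simps smult_left mem1 mem2)
  ultimately show ?thesis unfolding fock_map_def fock_field_def by blast
qed

text \<open>All three sums lie in the image of \<open>S2\<close>, where \<phi>2 is injective.
  Restricting u and v to \<open>S1\<close> lets an identity on the whole Fock space yield the one
  for the orbifold.\<close>

lemma jacobi_identity_iff:
  assumes "vertex_operators_model S1 \<phi>1 V S1 \<phi>1 V Y Yf"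
  shows "jacobi_identity V Y W YW \<longleftrightarrow> (\<forall>u\<in>S1. \<forall>v\<in>S1. \<forall>w\<in>S2. \<forall>l m n.
    bracket (Z u) (Z v) l m n w = iterate_product Z (\<lambda>i. Yf u i v) l m n w)"
proof -
  interpret VV: vertex_operators_model S1 \<phi>1 V S1 \<phi>1 V Y Yf by fact
  have *: "(finite_support_sum W (\<lambda>j. ((-1) ^ j * (of_int l gchoose j)) \<odot>\<^bsub>W\<^esub>
          YW (\<phi>1 u) (m + l - int j) (YW (\<phi>1 v) (n + int j) (\<phi>2 w)))
      \<ominus>\<^bsub>W\<^esub> finite_support_sum W (\<lambda>j. ((-1) powi l * (-1) ^ j * (of_int l gchoose j)) \<odot>\<^bsub>W\<^esub>
          YW (\<phi>1 v) (n + l - int j) (YW (\<phi>1 u) (m + int j) (\<phi>2 w)))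
      = finite_support_sum W (\<lambda>j. (of_int m gchoose j) \<odot>\<^bsub>W\<^esub>
          YW (Y (\<phi>1 u) (l + int j) (\<phi>1 v)) (m + n - int j) (\<phi>2 w))) \<longleftrightarrow>
    bracket (Z u) (Z v) l m n w = iterate_product Z (\<lambda>i. Yf u i v) l m n w"
    if "u \<in> S1" "v \<in> S1" "w \<in> S2" for u v w l m n
  proof -
    have 1: "finite_support_sum W (\<lambda>j. ((-1) ^ j * (of_int l gchoose j)) \<odot>\<^bsub>W\<^esub>
          YW (\<phi>1 u) (m + l - int j) (YW (\<phi>1 v) (n + int j) (\<phi>2 w))) =
        \<phi>2 (delta_product (Z u) (Z v) l m n w)"
      unfolding delta_product_def using that
      by (subst W.finite_support_sum_map[symmetric]) (simp_all add: map mem W.map_scale W.scale_mem)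
    have 2: "finite_support_sum W (\<lambda>j. ((-1) powi l * (-1) ^ j * (of_int l gchoose j)) \<odot>\<^bsub>W\<^esub>
          YW (\<phi>1 v) (n + l - int j) (YW (\<phi>1 u) (m + int j) (\<phi>2 w))) =
        \<phi>2 ((-1) powi l *\<^sub>F delta_product (Z v) (Z u) l n m w)"
    proof -
      have "(-1) powi l *\<^sub>F delta_product (Z v) (Z u) l n m w =
        Sum_any (\<lambda>j. ((-1) powi l * (-1) ^ j * (of_int l gchoose j)) *\<^sub>F
          Z v (n + l - int j) (Z u (m + int j) w))"
        unfolding delta_product_def by (subst scale_Sum_any) (simp_all add: mult.assoc)
      then show ?thesis using that
        by (simp only:) (subst W.finite_support_sum_map[symmetric],
          simp_all add: map mem W.map_scale W.scale_mem)
    qed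
    have 3: "finite_support_sum W (\<lambda>j. (of_int m gchoose j) \<odot>\<^bsub>W\<^esub>
          YW (Y (\<phi>1 u) (l + int j) (\<phi>1 v)) (m + n - int j) (\<phi>2 w)) =
        \<phi>2 (iterate_product Z (\<lambda>i. Yf u i v) l m n w)"
      unfolding iterate_product_def using that
      by (subst W.finite_support_sum_map[symmetric])
        (simp_all add: map mem VV.map VV.mem W.map_scale W.scale_mem)
    have delta_mem: "delta_product (Z u) (Z v) l m n w \<in> S2" if "u \<in> S1" "v \<in> S1" for u v m n
      unfolding delta_product_def using that \<open>w \<in> S2\<close> by (intro W.Sum_any_mem W.scale_mem mem)
    have mems: "delta_product (Z u) (Z v) l m n w \<in> S2"
      "(-1) powi l *\<^sub>F delta_product (Z v) (Z u) l n m w \<in> S2"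
      "iterate_product Z (\<lambda>i. Yf u i v) l m n w \<in> S2"
      using that unfolding iterate_product_def
      by (auto intro!: W.scale_mem delta_mem W.Sum_any_mem mem VV.mem)
    show ?thesis
      unfolding 1 2 3 W.map_diff[OF mems(1,2), symmetric] bracket_def
      by (rule inj_on_eq_iff[OF W.inj W.diff_mem[OF mems(1,2)] mems(3)])
  qed
  show ?thesis
    unfolding jacobi_identity_def V.carrier W.carrier ball_simps using * by auto
qed

end

section \<open>The Whittaker module as a shifted Fock space\<close>

lemma left_ideal_map:
  assumes "\<And>x. x \<in> S \<Longrightarrow> weyl_shift s x \<in> left_ideal T"
  shows "x \<in> left_ideal S \<Longrightarrow> weyl_shift s x \<in> left_ideal T"
  by (induction rule: left_ideal.induct)
    (auto simp: weyl_shift_0 weyl_shift_add weyl_shift_mult assms intro: left_ideal.intros)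

lemma coset_eq_iff: "x +o left_ideal S = y +o left_ideal S \<longleftrightarrow> x - y \<in> left_ideal S"
proof
  assume "x +o left_ideal S = y +o left_ideal S"
  then have "x + 0 \<in> y +o left_ideal S"
    using left_ideal.zero set_plus_intro2 by blast
  then show "x - y \<in> left_ideal S" by (auto simp: elt_set_plus_def)
next
  assume xy: "x - y \<in> left_ideal S"
  have "x + z \<in> y +o left_ideal S" if "z \<in> left_ideal S" for z
    using left_ideal.add[OF xy that] set_plus_intro2[of "x - y + z" "left_ideal S" y] by simp
  moreover have "y + z \<in> x +o left_ideal S" if "z \<in> left_ideal S" for z
    using left_ideal_diff[OF that xy] set_plus_intro2[of "z - (x - y)" "left_ideal S" x]
    by (simp add: algebra_simps)
  ultimately show "x +o left_ideal S = y +o left_ideal S"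
    by (auto simp: elt_set_plus_def)
qed

lemma coset_add: "(x +o left_ideal S) + (y +o left_ideal S) = (x + y) +o left_ideal S"
proof -
  have "left_ideal S + left_ideal S = left_ideal S"
    by (auto simp: set_plus_def intro: left_ideal.add) (metis add_0 left_ideal.zero)
  then show ?thesis by (simp add: set_plus_rearrange)
qed

lemma coset_mult: "(x *o (y +o left_ideal S)) + left_ideal S = (x * y) +o left_ideal S"
proof
  show "(x *o (y +o left_ideal S)) + left_ideal S \<subseteq> (x * y) +o left_ideal S"
    by (auto simp: set_plus_def elt_set_plus_def elt_set_times_def distrib_left add.assoc
        intro!: left_ideal.add left_ideal.lmult)
  show "(x * y) +o left_ideal S \<subseteq> (x *o (y +o left_ideal S)) + left_ideal S"
  proof
    fix z assume "z \<in> (x * y) +o left_ideal S"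
    then obtain b where b: "z = x * y + b" "b \<in> left_ideal S" by (auto simp: elt_set_plus_def)
    have "x * (y + 0) \<in> x *o (y +o left_ideal S)"
      unfolding elt_set_times_def using set_plus_intro2[OF left_ideal.zero, of y] by blast
    then show "z \<in> (x *o (y +o left_ideal S)) + left_ideal S"
      using b by (auto simp: set_plus_def)
  qed
qed

lemma fock_eq_iff: "u = v \<longleftrightarrow> rep_fock u - rep_fock v \<in> fock_ideal"
  by (metis abs_fock_eq_iff Quotient3_abs_rep Quotient3_fock)

lemma rep_fock_act: "rep_fock (x \<bullet> v) - x * rep_fock v \<in> fock_ideal"
  by (metis abs_fock_eq_iff Quotient3_abs_rep Quotient3_fock act_abs_fock)

lemma rep_fock_add: "rep_fock (u + v) - (rep_fock u + rep_fock v) \<in> fock_ideal"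
  by (metis abs_fock_eq_iff Quotient3_abs_rep Quotient3_fock plus_fock.abs_eq)

lemma rep_fock_0: "rep_fock 0 \<in> fock_ideal"
  by (metis abs_fock_eq_iff Quotient3_abs_rep Quotient3_fock zero_fock_def diff_zero)

lemma rep_abs_fock: "rep_fock (abs_fock x) - x \<in> fock_ideal"
  by (metis abs_fock_eq_iff Quotient3_abs_rep Quotient3_fock)

fun whittaker_shift :: "nat \<Rightarrow> (nat \<Rightarrow> complex) \<Rightarrow> (nat \<Rightarrow> complex) \<Rightarrow> letter \<Rightarrow> complex" where
  "whittaker_shift n lam mu (A k) = (if 0 \<le> k \<and> k \<le> int n then lam (nat k) else 0)"
| "whittaker_shift n lam mu (As k) = (if 1 \<le> k \<and> k \<le> int n then mu (nat k) else 0)"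

context
  fixes n :: nat and lam mu :: "nat \<Rightarrow> complex"
begin

private abbreviation (input) "s \<equiv> whittaker_shift n lam mu"
private abbreviation (input) "I \<equiv> whittaker_ideal n lam mu"
private abbreviation (input) "W \<equiv> whittaker_module n lam mu"

text \<open>The shift carries the generators \<open>gen l - weyl_const (s l)\<close> of the
  Whittaker ideal to the annihilation operators, so its inverse carries the Fock space onto the
  Whittaker quotient.\<close>

definition whittaker_model :: "fock \<Rightarrow> weyl set" where
  "whittaker_model v = weyl_shift (\<lambda>l. - s l) (rep_fock v) +o I"

lemma shift_whittaker_ideal: "x \<in> I \<Longrightarrow> weyl_shift s x \<in> fock_ideal"
  unfolding whittaker_ideal_def fock_ideal_def
proof (erule left_ideal_map[rotated])
  fix x assume "x \<in> {gen_a (int k) - weyl_const (lam k) |k. k \<le> n} \<union>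
      {gen_as (int k) - weyl_const (mu k) |k. 1 \<le> k \<and> k \<le> n} \<union>
      {gen_a (int k) |k. n < k} \<union> {gen_as (int k) |k. n < k}"
  then obtain l where l: "annihilator l" "x = gen l - weyl_const (s l)"
  proof (elim UnE CollectE exE conjE)
    fix k assume "x = gen_a (int k) - weyl_const (lam k)" "k \<le> n"
    then show thesis using that[of "A (int k)"] by (simp add: gen.simps)
  next
    fix k assume "x = gen_as (int k) - weyl_const (mu k)" "1 \<le> k" "k \<le> n"
    then show thesis using that[of "As (int k)"] by (simp add: gen.simps)
  next
    fix k assume "x = gen_a (int k)" "n < k"
    then show thesis using that[of "A (int k)"] by (simp add: gen.simps weyl_const_0)
  next
    fix k assume "x = gen_as (int k)" "n < k"
    then show thesis using that[of "As (int k)"] by (simp add: gen.simps weyl_const_0)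
  qed
  then have "weyl_shift s x = gen l"
    by (simp add: weyl_shift_diff weyl_shift_gen weyl_shift_const)
  then show "weyl_shift s x \<in> left_ideal (gen ` Collect annihilator)"
    using l by (auto intro: left_ideal.base)
qed

lemma unshift_fock_ideal: "x \<in> fock_ideal \<Longrightarrow> weyl_shift (\<lambda>l. - s l) x \<in> I"
  unfolding whittaker_ideal_def fock_ideal_def
proof (erule left_ideal_map[rotated])
  fix x assume "x \<in> gen ` Collect annihilator"
  then obtain l where l: "annihilator l" "x = gen l" by auto
  have x: "weyl_shift (\<lambda>l. - s l) x = gen l - weyl_const (s l)"
    using l by (simp add: weyl_shift_gen weyl_const_uminus)
  show "weyl_shift (\<lambda>l. - s l) x \<in> left_ideal
    ({gen_a (int k) - weyl_const (lam k) |k. k \<le> n} \<union>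
      {gen_as (int k) - weyl_const (mu k) |k. 1 \<le> k \<and> k \<le> n} \<union>
      {gen_a (int k) |k. n < k} \<union> {gen_as (int k) |k. n < k})"
  proof (rule left_ideal.base, cases l)
    case (A k)
    then obtain k' where "k = int k'" using l by (auto elim: nonneg_int_cases)
    with A show "weyl_shift (\<lambda>l. - s l) x \<in> {gen_a (int k) - weyl_const (lam k) |k. k \<le> n} \<union>
      {gen_as (int k) - weyl_const (mu k) |k. 1 \<le> k \<and> k \<le> n} \<union>
      {gen_a (int k) |k. n < k} \<union> {gen_as (int k) |k. n < k}"
      unfolding x by (cases "k' \<le> n") (auto simp: gen.simps weyl_const_0)
  next
    case (As k)
    then obtain k' where "k = int k'" "1 \<le> k'"
      using l by (metis annihilator.simps(2) nat_0_le nat_one_as_int of_nat_le_iff order_trans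
        zero_le_one of_nat_1)
    with As show "weyl_shift (\<lambda>l. - s l) x \<in> {gen_a (int k) - weyl_const (lam k) |k. k \<le> n} \<union>
      {gen_as (int k) - weyl_const (mu k) |k. 1 \<le> k \<and> k \<le> n} \<union>
      {gen_a (int k) |k. n < k} \<union> {gen_as (int k) |k. n < k}"
      unfolding x by (cases "k' \<le> n") (auto simp: gen.simps weyl_const_0)
  qed
qed

lemma I_coset_eq_iff: "x +o I = y +o I \<longleftrightarrow> x - y \<in> I"
  unfolding whittaker_ideal_def by (rule coset_eq_iff)

lemma whittaker_model_eqI: "rep_fock v - x \<in> fock_ideal \<Longrightarrow>
    whittaker_model v = weyl_shift (\<lambda>l. - s l) x +o I"
  unfolding whittaker_model_def I_coset_eq_iff
  by (simp add: unshift_fock_ideal flip: weyl_shift_diff)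

text \<open>On the Fock space the Whittaker action of a generator thus becomes \<open>gen l\<close>
  plus the scalar \<open>s l\<close>.\<close>

lemma whittaker_model_act:
  "whittaker_model (weyl_shift s x \<bullet> v) = whittaker_act n lam mu x (whittaker_model v)"
proof -
  have "whittaker_model (weyl_shift s x \<bullet> v) =
    weyl_shift (\<lambda>l. - s l) (weyl_shift s x * rep_fock v) +o I"
    by (rule whittaker_model_eqI) (rule rep_fock_act)
  also have "\<dots> = (x * weyl_shift (\<lambda>l. - s l) (rep_fock v)) +o I"
    by (simp add: weyl_shift_mult weyl_shift_inverse)
  also have "\<dots> = whittaker_act n lam mu x (whittaker_model v)"
    by (simp add: whittaker_act_def weyl_quotient_act_def whittaker_model_def coset_mult
        whittaker_ideal_def)
  finally show ?thesis .
qed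

lemma fock_model_whittaker: "fock_model UNIV whittaker_model W"
proof
  show "carrier W = whittaker_model ` UNIV"
  proof -
    have "x +o I = whittaker_model (abs_fock (weyl_shift s x))" for x
      using whittaker_model_eqI[OF rep_abs_fock, of "weyl_shift s x"] by (simp add: weyl_shift_inverse)
    then show ?thesis
      by (auto simp: whittaker_module_def weyl_quotient_def whittaker_model_def)
  qed
  show "inj_on whittaker_model UNIV"
  proof (rule inj_onI)
    fix u v assume "whittaker_model u = whittaker_model v"
    then have "weyl_shift s (weyl_shift (\<lambda>l. - s l) (rep_fock u - rep_fock v)) \<in> fock_ideal"
      by (intro shift_whittaker_ideal) (simp add: whittaker_model_def I_coset_eq_iff weyl_shift_diff)
    then show "u = v" by (simp add: weyl_shift_inverse' fock_eq_iff)
  qed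
  show "whittaker_model 0 = \<zero>\<^bsub>W\<^esub>"
    using whittaker_model_eqI[of 0 0] rep_fock_0
    by (simp add: whittaker_module_def weyl_quotient_def weyl_shift_0)
  fix u v c
  show "whittaker_model (u + v) = whittaker_model u \<oplus>\<^bsub>W\<^esub> whittaker_model v"
    using whittaker_model_eqI[OF rep_fock_add, of u v]
    by (simp add: whittaker_module_def weyl_quotient_def whittaker_model_def weyl_shift_add coset_add
        whittaker_ideal_def)
  show "whittaker_model (c *\<^sub>F u) = c \<odot>\<^bsub>W\<^esub> whittaker_model u"
    using whittaker_model_act[of "weyl_const c" u]
    by (simp add: whittaker_module_def weyl_quotient_def whittaker_act_def weyl_quotient_act_def
        weyl_shift_const fock_act_const)
qed simp_all

lemma weyl_module_whittaker: "weyl_module W (whittaker_act n lam mu)"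
proof -
  interpret fock_model UNIV whittaker_model W by (rule fock_model_whittaker)
  interpret Module.module complex_field W by (rule module_W)
  have act: "whittaker_act n lam mu x (whittaker_model v) = whittaker_model (weyl_shift s x \<bullet> v)" for x v
    by (simp add: whittaker_model_act)
  show ?thesis
    by unfold_locales
      (auto simp: carrier act fock_act_add_right fock_act_add_left fock_act_mult fock_act_const weyl_shift_add
        weyl_shift_mult weyl_shift_const simp flip: map_add map_scale)
qed

end

section \<open>The Weyl vertex algebra as the Fock space\<close>

context weyl_vertex_algebra
begin

lemma act_zero: "act x \<zero>\<^bsub>M\<^esub> = \<zero>\<^bsub>M\<^esub>"
proof -
  have "act x \<zero>\<^bsub>M\<^esub> \<in> carrier M" by (rule act_closed) simp
  moreover have "act x \<zero>\<^bsub>M\<^esub> = act x \<zero>\<^bsub>M\<^esub> \<oplus>\<^bsub>M\<^esub> act x \<zero>\<^bsub>M\<^esub>"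
    using act_add_right[of "\<zero>\<^bsub>M\<^esub>" "\<zero>\<^bsub>M\<^esub>" x] by simp
  ultimately show ?thesis by (metis M.add.r_cancel_one')
qed

lemma fock_ideal_act: "x \<in> fock_ideal \<Longrightarrow> act x vac = \<zero>\<^bsub>M\<^esub>"
  unfolding fock_ideal_def
proof (induction rule: left_ideal.induct)
  case (base x)
  then obtain l where "x = gen l" "annihilator l" by auto
  then show ?case
    using annihilated_a annihilated_as[of "_ - 1"] by (cases l) (force simp: gen.simps)+
next
  case zero
  show ?case using act_const[of vac 0] smult_l_null[OF vac_closed] by (simp add: weyl_const_0 vac_closed)
next
  case (add x y)
  then show ?case by (simp add: act_add_left vac_closed)
next
  case (lmult x y)
  then show ?case by (simp add: act_mult vac_closed act_zero)
qed

definition vertex_model :: "fock \<Rightarrow> 'm" where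
  "vertex_model v = act (rep_fock v) vac"

lemma act_vac_eqI: "x - y \<in> fock_ideal \<Longrightarrow> act x vac = act y vac"
  using fock_ideal_act[of "x - y"] act_add_left[of vac "x - y" y] vac_closed by (simp add: act_closed)

lemma vertex_model_act: "vertex_model (x \<bullet> v) = act x (vertex_model v)"
  unfolding vertex_model_def by (simp add: act_vac_eqI[OF rep_fock_act] act_mult vac_closed)

lemma vertex_model_vac: "vertex_model fock_vac = vac"
proof -
  have "vertex_model fock_vac = act (weyl_const 1) vac"
    unfolding vertex_model_def fock_vac_def weyl_const_1 by (rule act_vac_eqI) (rule rep_abs_fock)
  then show ?thesis
    using act_const[of vac 1] smult_one[OF vac_closed] by (simp add: vac_closed)
qed

lemma vac_nonzero: "vac \<noteq> \<zero>\<^bsub>M\<^esub>"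
proof
  assume vac: "vac = \<zero>\<^bsub>M\<^esub>"
  have "carrier M \<subseteq> {\<zero>\<^bsub>M\<^esub>}"
    using generated act_zero unfolding vac by blast
  then show False using nonzero by auto
qed

text \<open>Surjectivity holds because the vacuum generates \<open>M\<close>. For injectivity, a
  nonzero vector of the kernel could be moved to the vacuum of the Fock space, forcing the vacuum of
  \<open>M\<close> to vanish.\<close>

lemma fock_model_vertex: "fock_model UNIV vertex_model M"
proof
  have add: "vertex_model (u + v) = vertex_model u \<oplus>\<^bsub>M\<^esub> vertex_model v" for u v
    unfolding vertex_model_def by (simp add: act_vac_eqI[OF rep_fock_add] act_add_left vac_closed)
  have zero: "vertex_model 0 = \<zero>\<^bsub>M\<^esub>"
    unfolding vertex_model_def by (rule fock_ideal_act) (rule rep_fock_0)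
  have closed: "vertex_model v \<in> carrier M" for v
    by (simp add: vertex_model_def act_closed vac_closed)
  have kernel: "v = 0" if "vertex_model v = \<zero>\<^bsub>M\<^esub>" for v
  proof (rule ccontr)
    assume "v \<noteq> 0"
    then obtain x where "x \<bullet> v = fock_vac" using fock_reaches_vac by blast
    then have "vac = act x (vertex_model v)" by (simp flip: vertex_model_act add: vertex_model_vac)
    then show False using that vac_nonzero by (simp add: act_zero)
  qed
  show "carrier M = vertex_model ` UNIV"
  proof
    show "carrier M \<subseteq> range vertex_model"
    proof
      fix v assume "v \<in> carrier M"
      then obtain x where "v = act x vac" using generated by blast
      then have "v = vertex_model (x \<bullet> fock_vac)" by (simp add: vertex_model_act vertex_model_vac)
      then show "v \<in> range vertex_model" by simp
    qed
  qed (use closed in auto)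
  show "inj_on vertex_model UNIV"
  proof (rule inj_onI)
    fix u v assume eq: "vertex_model u = vertex_model v"
    have "vertex_model (u - v) \<oplus>\<^bsub>M\<^esub> vertex_model v = vertex_model v"
      using add[of "u - v" v] eq by simp
    then have "vertex_model (u - v) = \<zero>\<^bsub>M\<^esub>"
      using M.add.l_cancel_one[OF closed[of v] closed[of "u - v"]] M.add.r_cancel_one[OF closed[of v] closed[of "u - v"]]
      by simp
    then have "u - v = 0" by (rule kernel)
    then show "u = v" by simp
  qed
  show "vertex_model 0 = \<zero>\<^bsub>M\<^esub>" by (rule zero)
  fix u v c
  show "vertex_model (u + v) = vertex_model u \<oplus>\<^bsub>M\<^esub> vertex_model v" by (rule add)
  show "vertex_model (c *\<^sub>F u) = c \<odot>\<^bsub>M\<^esub> vertex_model u"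
    unfolding fock_scale_def vertex_model_act by (rule act_const) (rule closed)
qed simp_all

definition fock_vertex :: "fock \<Rightarrow> int \<Rightarrow> fock \<Rightarrow> fock" where
  "fock_vertex u n v = inv_into UNIV vertex_model (Y (vertex_model u) n (vertex_model v))"

lemma vertex_model_closed: "vertex_model v \<in> carrier M"
  by (simp add: vertex_model_def act_closed vac_closed)

lemma vertex_model_fock_vertex: "vertex_model (fock_vertex u n v) = Y (vertex_model u) n (vertex_model v)"
proof -
  have "Y (vertex_model u) n (vertex_model v) \<in> range vertex_model"
    using fock_model.carrier[OF fock_model_vertex] closed[OF vertex_model_closed vertex_model_closed]
    by simp
  then show ?thesis unfolding fock_vertex_def by (rule f_inv_into_f)
qed

lemma vertex_model_inject: "vertex_model u = vertex_model v \<longleftrightarrow> u = v"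
  by (rule inj_eq) (rule fock_model.inj[OF fock_model_vertex])

lemma vertex_operators_model_vertex:
  "vertex_operators_model UNIV vertex_model M UNIV vertex_model M Y fock_vertex"
  by (intro vertex_operators_model.intro fock_model_vertex vertex_operators_model_axioms.intro)
    (simp_all add: vertex_model_fock_vertex)

sublocale FV: fock_vertex_algebra fock_vertex
proof
  interpret VM: vertex_operators_model UNIV vertex_model M UNIV vertex_model M Y fock_vertex
    by (rule vertex_operators_model_vertex)
  show "fock_map fock_vertex"
    by (rule VM.fock_map_of_record[OF vertex_operators_axioms refl refl])
  show "fock_jacobi fock_vertex fock_vertex"
    using jacobi VM.jacobi_identity_iff[OF vertex_operators_model_vertex]
    unfolding fock_jacobi_def by blast
  fix n v
  show "fock_vertex fock_vac n v = (if n = - 1 then v else 0)"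
    unfolding vertex_model_inject[symmetric]
    using vacuum[OF vertex_model_closed, of n v]
    by (simp add: vertex_model_fock_vertex vertex_model_vac VM.V.map_zero)
  show "fock_vertex v (- 1) fock_vac = v"
    unfolding vertex_model_inject[symmetric]
    by (simp add: vertex_model_fock_vertex vertex_model_vac creation vertex_model_closed)
  show "fock_vertex (gen (A (- 1)) \<bullet> fock_vac) n v = gen (A n) \<bullet> v"
    unfolding vertex_model_inject[symmetric]
    by (simp add: vertex_model_fock_vertex vertex_model_vac vertex_model_act gen.simps field_a
        vertex_model_closed)
  show "fock_vertex (gen (As 0) \<bullet> fock_vac) n v = gen (As (n + 1)) \<bullet> v"
    unfolding vertex_model_inject[symmetric]
    by (simp add: vertex_model_fock_vertex vertex_model_vac vertex_model_act gen.simps field_as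
        vertex_model_closed)
qed

text \<open>In the Fock model the required fields are those of \<open>M\<close> with scalars added
  to finitely many modes, because the Whittaker character vanishes outside a finite range.\<close>

theorem natural_weak_module_exists:
  "\<exists>YW. natural_weak_module M act vac Y
    (whittaker_module n lam mu) (whittaker_act n lam mu) YW"
proof -
  let ?s = "whittaker_shift n lam mu" and ?\<psi> = "whittaker_model n lam mu"
    and ?W = "whittaker_module n lam mu"
  have "{k. ?s (A k) \<noteq> 0} \<subseteq> {0..int n}" by auto
  then have fin_a: "finite {k. ?s (A k) \<noteq> 0}" by (rule finite_subset) simp
  have "{k. ?s (As k) \<noteq> 0} \<subseteq> {1..int n}" by auto
  then have fin_as: "finite {k. ?s (As k) \<noteq> 0}" by (rule finite_subset) simp
  obtain Z where Z: "FV.is_module Z"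
    "\<And>k w. Z (gen (A (- 1)) \<bullet> fock_vac) k w = gen (A k) \<bullet> w + ?s (A k) *\<^sub>F w"
    "\<And>k w. Z (gen (As 0) \<bullet> fock_vac) k w = gen (As (k + 1)) \<bullet> w + ?s (As (k + 1)) *\<^sub>F w"
    by (rule FV.shifted_module_exists[where \<alpha> = "\<lambda>k. ?s (A k)" and \<beta> = "\<lambda>k. ?s (As k)", OF fin_a fin_as])
      (rule that, assumption+)
  define YW where "YW u k w = ?\<psi> (Z (inv_into UNIV vertex_model u) k (inv_into UNIV ?\<psi> w))" for u k w
  interpret Wm: fock_model UNIV ?\<psi> ?W by (rule fock_model_whittaker)
  have inj: "inj vertex_model" "inj ?\<psi>"
    using fock_model.inj[OF fock_model_vertex] Wm.inj by auto
  have YW: "YW (vertex_model u) k (?\<psi> w) = ?\<psi> (Z u k w)" for u k w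
    by (simp add: YW_def inv_f_f inj)
  interpret VW: vertex_operators_model UNIV vertex_model M UNIV ?\<psi> ?W YW Z
    by (intro vertex_operators_model.intro fock_model_vertex fock_model_whittaker
        vertex_operators_model_axioms.intro) (simp_all add: YW)
  have shift: "weyl_shift ?s (gen l) \<bullet> w = gen l \<bullet> w + ?s l *\<^sub>F w" for l w
    by (simp add: weyl_shift_gen fock_act_add_left fock_act_const)
  have jacobi_W: "jacobi_identity M Y ?W YW"
    using Z(1) VW.jacobi_identity_iff[OF vertex_operators_model_vertex]
    unfolding FV.is_module_def fock_jacobi_def by blast
  have vops: "vertex_operators M ?W YW"
    using Z(1) by (intro VW.vertex_operators_record) (simp add: FV.is_module_def)
  have "natural_weak_module M act vac Y ?W (whittaker_act n lam mu) YW"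
  proof (intro natural_weak_module.intro weak_module.intro natural_weak_module_axioms.intro
      weak_module_axioms.intro weyl_module_whittaker vertex_algebra_axioms vops jacobi_W)
    fix w k assume "w \<in> carrier ?W"
    then obtain w' where w: "w = ?\<psi> w'" by (auto simp: Wm.carrier)
    show "YW vac k w = (if k = - 1 then w else \<zero>\<^bsub>?W\<^esub>)"
      using YW[of fock_vac k w'] Z(1) unfolding w vertex_model_vac
      by (simp add: FV.is_module_def Wm.map_zero)
    show "YW (act (gen_a (- 1)) vac) k w = whittaker_act n lam mu (gen_a k) w"
      using YW[of "gen (A (- 1)) \<bullet> fock_vac" k w']
        whittaker_model_act[of n lam mu "gen (A k)" w', symmetric]
      unfolding w vertex_model_vac vertex_model_act Z shift by (simp add: gen.simps)
    show "YW (act (gen_as 0) vac) k w = whittaker_act n lam mu (gen_as (k + 1)) w"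
      using YW[of "gen (As 0) \<bullet> fock_vac" k w']
        whittaker_model_act[of n lam mu "gen (As (k + 1))" w', symmetric]
      unfolding w vertex_model_vac vertex_model_act Z shift by (simp add: gen.simps)
  qed
  then show ?thesis by blast
qed

end


section \<open>The rotation of the Fock space\<close>

lemma weyl_rotation_letter:
  "weyl_rotation p (gen l) = weyl_const (letter_weight p l) * gen l"
  by (cases l) (simp_all add: gen.simps weyl_rotation_gen)

lemma weyl_rotation_0: "weyl_rotation p 0 = 0"
  using weyl_rotation_hom(3)[of p 0] by (simp add: weyl_const_0)

lemma weyl_rotation_1: "weyl_rotation p 1 = 1"
  using weyl_rotation_hom(3)[of p 1] by (simp add: weyl_const_1)

lemma weyl_rotation_diff: "weyl_rotation p (x - y) = weyl_rotation p x - weyl_rotation p y"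
  using weyl_rotation_hom(1)[of p "x - y" y] by simp

lemma weyl_rotation_fock_ideal: "x \<in> fock_ideal \<Longrightarrow> weyl_rotation p x \<in> fock_ideal"
  unfolding fock_ideal_def
proof (induction rule: left_ideal.induct)
  case (base x)
  then obtain l where "x = gen l" "gen l \<in> gen ` Collect annihilator" by blast
  then show ?case by (simp add: weyl_rotation_letter left_ideal.lmult left_ideal.base del: imageE)
qed (auto simp: weyl_rotation_0 weyl_rotation_hom intro: left_ideal.intros)

definition rotate :: "nat \<Rightarrow> fock \<Rightarrow> fock" where
  "rotate p v = abs_fock (weyl_rotation p (rep_fock v))"

lemma rotate_abs: "rotate p (abs_fock x) = abs_fock (weyl_rotation p x)"
  unfolding rotate_def abs_fock_eq_iff weyl_rotation_diff[symmetric]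
  by (rule weyl_rotation_fock_ideal) (rule rep_abs_fock)

lemma rotate_act: "rotate p (x \<bullet> v) = weyl_rotation p x \<bullet> rotate p v"
  by (cases v rule: abs_fock_cases) (simp add: act_abs_fock rotate_abs weyl_rotation_hom)

lemma rotate_add: "rotate p (u + v) = rotate p u + rotate p v"
  by (cases u rule: abs_fock_cases; cases v rule: abs_fock_cases)
    (simp add: plus_fock.abs_eq rotate_abs weyl_rotation_hom)

lemma rotate_vac: "rotate p fock_vac = fock_vac"
  by (simp add: fock_vac_def rotate_abs weyl_rotation_1)

lemma rotate_scale: "rotate p (c *\<^sub>F v) = c *\<^sub>F rotate p v"
  by (simp add: fock_scale_def rotate_act weyl_rotation_hom)

lemma rotate_gen: "rotate p (gen l \<bullet> v) = letter_weight p l *\<^sub>F gen l \<bullet> rotate p v"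
  by (simp add: rotate_act weyl_rotation_letter fock_act_mult fock_act_const)

lemma rotate_0: "rotate p 0 = 0"
  using rotate_scale[of p 0 0] by simp

lemma rotate_sum: "rotate p (sum f S) = (\<Sum>x\<in>S. rotate p (f x))"
  by (induction S rule: infinite_finite_induct) (simp_all add: rotate_0 rotate_add)

lemma rotate_diff: "rotate p (u - v) = rotate p u - rotate p v"
  using rotate_add[of p "u - v" v] by simp

text \<open>The primed fields are those of rotated vectors. A common truncation bound turns both
  series into finite sums of the same shape, through which the rotation passes termwise.\<close>

lemma rotate_delta_product:
  assumes "fock_field \<phi>" "fock_field \<psi>" "fock_field \<phi>'" "fock_field \<psi>'"
    and "\<And>n w. rotate p (\<phi> n w) = \<phi>' n (rotate p w)"
    and "\<And>n w. rotate p (\<psi> n w) = \<psi>' n (rotate p w)"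
  shows "rotate p (delta_product \<phi> \<psi> l m n w) = delta_product \<phi>' \<psi>' l m n (rotate p w)"
proof -
  obtain J1 where J1: "\<And>j. J1 \<le> j \<Longrightarrow> \<psi> (n + int j) w = 0"
    using fock_field_truncated[OF assms(2)] by blast
  obtain J2 where J2: "\<And>j. J2 \<le> j \<Longrightarrow> \<psi>' (n + int j) (rotate p w) = 0"
    using fock_field_truncated[OF assms(4)] by blast
  let ?J = "max J1 J2"
  have 1: "delta_product \<phi> \<psi> l m n w = (\<Sum>j<?J. ((-1) ^ j * (of_int l gchoose j)) *\<^sub>F
      \<phi> (m + l - int j) (\<psi> (n + int j) w))"
    unfolding delta_product_def
    by (rule Sum_any_lessThan) (simp add: J1 fock_field_0[OF assms(1)])
  have 2: "delta_product \<phi>' \<psi>' l m n (rotate p w) = (\<Sum>j<?J. ((-1) ^ j * (of_int l gchoose j)) *\<^sub>F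
      \<phi>' (m + l - int j) (\<psi>' (n + int j) (rotate p w)))"
    unfolding delta_product_def
    by (rule Sum_any_lessThan) (simp add: J2 fock_field_0[OF assms(3)])
  show ?thesis unfolding 1 2 by (simp add: rotate_sum rotate_scale assms(5,6))
qed

fun letter_vector :: "letter \<Rightarrow> fock" where
  "letter_vector (A k) = gen (A (- 1)) \<bullet> fock_vac"
| "letter_vector (As k) = gen (As 0) \<bullet> fock_vac"

text \<open>The case \<open>As\<close> is offset by one because mode \<open>n\<close> of the second
  generating vector is \<open>As (n + 1)\<close>.\<close>

fun letter_mode :: "letter \<Rightarrow> int" where
  "letter_mode (A k) = k"
| "letter_mode (As k) = k - 1"

lemma rotate_letter_vector: "rotate p (letter_vector l) = letter_weight p l *\<^sub>F letter_vector l"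
  by (cases l) (simp_all add: rotate_gen rotate_vac)

context fock_vertex_algebra
begin

lemma Y_letter: "Y (letter_vector l) (letter_mode l) w = gen l \<bullet> w"
  by (cases l) (simp_all add: Y_a Y_as)

lemma rotate_Y_letter:
  "rotate p (Y (letter_vector l) n w) = Y (rotate p (letter_vector l)) n (rotate p w)"
  unfolding rotate_letter_vector fock_map_scale[OF Y_map]
  by (cases l) (simp_all add: Y_a Y_as rotate_gen)

lemma iterate_product_0:
  assumes "fock_map Z"
  shows "iterate_product Z f l 0 n w = Z (f l) n w"
  unfolding iterate_product_def
  by (subst Sum_any_lessThan[of 1]) (auto simp: gbinomial_0_left)

text \<open>The vector \<open>gen l \<bullet> u\<close> is h_k u for a generating vector h, so its
  field is built from those of h and u by the Jacobi identity. The rotation is compatible with the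
  first by direct computation and with the second by induction.\<close>

lemma rotate_Y: "rotate p (Y u n v) = Y (rotate p u) n (rotate p v)"
proof (induction u arbitrary: n v rule: fock_induct)
  case (scale_vac c)
  show ?case
    by (simp add: rotate_scale rotate_vac fock_map_scale[OF Y_map] Y_vacuum rotate_0)
next
  case (add u v)
  then show ?case by (simp add: rotate_add fock_map_add[OF Y_map])
next
  case (gen l u)
  let ?h = "letter_vector l" and ?k = "letter_mode l"
  note f = fock_map_field[OF Y_map]
  \<comment> \<open>At m = 0 only the term j = 0 of the iterate survives, which expresses the field
    of a product by the two given fields.\<close>
  have iter: "Y (Y g k x) n w = bracket (Y g) (Y x) k 0 n w" for g k x w
    using Y_jacobi unfolding fock_jacobi_def by (simp add: iterate_product_0[OF Y_map])
  have "rotate p (Y (gen l \<bullet> u) n v) = rotate p (bracket (Y ?h) (Y u) ?k 0 n v)"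
    by (simp flip: iter add: Y_letter)
  also have "\<dots> = bracket (Y (rotate p ?h)) (Y (rotate p u)) ?k 0 n (rotate p v)"
    unfolding bracket_def rotate_diff rotate_scale
    using rotate_delta_product[OF f f f f rotate_Y_letter gen.IH]
      rotate_delta_product[OF f f f f gen.IH rotate_Y_letter] by simp
  also have "\<dots> = Y (Y (rotate p ?h) ?k (rotate p u)) n (rotate p v)"
    by (simp add: iter)
  also have "Y (rotate p ?h) ?k (rotate p u) = rotate p (gen l \<bullet> u)"
    unfolding rotate_Y_letter[symmetric] by (simp add: rotate_letter_vector fock_map_scale[OF Y_map] Y_letter rotate_gen)
  finally show ?case .
qed

section \<open>Submodules for the fixed points of the rotation\<close>

text \<open>A suitable Jacobi identity has u_m v_n w as leading term, an iterate on the right, and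
  otherwise terms in which the mode of v is larger than n. Those are closer to the truncation bound
  of v on \<open>w\<close>, and \<open>d\<close> measures this distance.\<close>

lemma module_associativity:
  assumes "is_module Z"
  shows "Z u m (Z v n w) \<in> fock.span {Z (Y u i v) j w | i j. True}"
proof -
  have Z: "fock_map Z" and jac: "fock_jacobi Y Z" using assms by (auto simp: is_module_def)
  note Zf = fock_map_field[OF Z]
  let ?S = "fock.span {Z (Y u i v) j w | i j. True}"
  obtain k where k: "\<forall>i\<ge>k. Z u i w = 0" using Zf unfolding fock_field_def by blast
  have claim: "\<forall>i\<ge>n + int d. Z v i w = 0 \<Longrightarrow> Z u m (Z v n w) \<in> ?S" for d m n
  proof (induction d arbitrary: m n rule: less_induct)
    case (less d)
    show ?case
    proof (cases d)
      case 0
      then show ?thesis using less.prems fock_field_0[OF Zf] by (simp add: fock.span_zero)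
    next
      case (Suc d')
      let ?c = "\<lambda>j. (-1) ^ j * (of_int (m - k) gchoose j) :: complex"
      \<comment> \<open>With \<open>k\<close> as the mode of u every term contains u_(k+j) w = 0, so
        one half of the bracket disappears. The exponent \<open>m - k\<close> is chosen to give the
        other half the leading term u_m v_n w.\<close>
      have "delta_product (Z v) (Z u) (m - k) n k w = 0"
        unfolding delta_product_def using k by (simp add: fock_field_0[OF Zf])
      then have "delta_product (Z u) (Z v) (m - k) k n w = iterate_product Z (\<lambda>i. Y u i v) (m - k) k n w"
        using jac unfolding fock_jacobi_def bracket_def by (metis diff_zero fock.scale_zero_right)
      moreover have "iterate_product Z (\<lambda>i. Y u i v) (m - k) k n w \<in> ?S"
        unfolding iterate_product_def Sum_any.expand_set
        by (intro fock.span_sum fock.span_scale fock.span_base) blast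
      moreover have "delta_product (Z u) (Z v) (m - k) k n w =
        (\<Sum>j<d. ?c j *\<^sub>F Z u (k + (m - k) - int j) (Z v (n + int j) w))"
        unfolding delta_product_def using less.prems
        by (intro Sum_any_lessThan) (simp add: fock_field_0[OF Zf])
      ultimately have "(\<Sum>j<d. ?c j *\<^sub>F Z u (m - int j) (Z v (n + int j) w)) \<in> ?S" by simp
      then have "Z u m (Z v n w) + (\<Sum>j<d'. ?c (Suc j) *\<^sub>F Z u (m - int (Suc j)) (Z v (n + int (Suc j)) w)) \<in> ?S"
        unfolding Suc sum.lessThan_Suc_shift by simp
      moreover have "(\<Sum>j<d'. ?c (Suc j) *\<^sub>F Z u (m - int (Suc j)) (Z v (n + int (Suc j)) w)) \<in> ?S"
      proof (intro fock.span_sum fock.span_scale)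
        fix j assume "j \<in> {..<d'}"
        then show "Z u (m - int (Suc j)) (Z v (n + int (Suc j)) w) \<in> ?S"
          using less.prems Suc by (intro less.IH[of "d - Suc j"]) auto
      qed
      ultimately show ?thesis using fock.span_diff by fastforce
    qed
  qed
  obtain J where J: "\<And>j. J \<le> j \<Longrightarrow> Z v (n + int j) w = 0" using fock_field_truncated[OF Zf] by blast
  have "Z v i w = 0" if "n + int J \<le> i" for i
    using J[of "nat (i - n)"] that by (simp add: nat_le_iff le_nat_iff)
  then show ?thesis using claim by blast
qed

text \<open>All that single modes of vectors of weight \<kappa> can produce from \<open>w\<close>.
  For weight 1 these are the modes of the orbifold, so a stable subspace containing \<open>w\<close>
  contains this span.\<close>

definition rotation_span :: "nat \<Rightarrow> (fock \<Rightarrow> int \<Rightarrow> fock \<Rightarrow> fock) \<Rightarrow> complex \<Rightarrow> fock \<Rightarrow> fock set" where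
  "rotation_span p Z \<kappa> w = fock.span {Z v n w | v n. rotate p v = \<kappa> *\<^sub>F v}"

text \<open>Associativity rewrites u_m v_n w by vectors (u_i v)_j w, and the weight of u_i v is the
  product of the weights. Products of modes are thereby controlled by their total weight
  alone.\<close>

lemma rotation_span_step:
  assumes "is_module Z" "rotate p u = \<kappa>' *\<^sub>F u" "x \<in> rotation_span p Z \<kappa> w"
  shows "Z u m x \<in> rotation_span p Z (\<kappa>' * \<kappa>) w"
  using assms(3) unfolding rotation_span_def
proof (induction rule: fock.span_induct)
  have Z: "fock_map Z" using assms(1) by (simp add: is_module_def)
  note Zf = fock_map_field[OF Z]
  case base
  show ?case
    using Zf[of u] unfolding fock_field_def
    by (intro fock.subspaceI) (auto simp: fock_field_0[OF Zf] fock.span_zero fock.span_add fock.span_scale)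
next
  case (step x)
  then obtain v n where v: "x = Z v n w" "rotate p v = \<kappa> *\<^sub>F v" by blast
  have "{Z (Y u i v) j w | i j. True} \<subseteq> {Z v n w | v n. rotate p v = (\<kappa>' * \<kappa>) *\<^sub>F v}"
  proof
    fix y assume "y \<in> {Z (Y u i v) j w | i j. True}"
    then obtain i j where y: "y = Z (Y u i v) j w" by blast
    have "rotate p (Y u i v) = (\<kappa>' * \<kappa>) *\<^sub>F Y u i v"
      by (simp add: rotate_Y v(2) assms(2) fock_map_scale[OF Y_map]
          fock_field_scale[OF fock_map_field[OF Y_map]])
    then show "y \<in> {Z v n w | v n. rotate p v = (\<kappa>' * \<kappa>) *\<^sub>F v}" using y by blast
  qed
  then show ?case
    using module_associativity[OF assms(1), of u m v n w] fock.span_mono unfolding v(1) by blast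
qed

end

lemma zeta_power: "p \<ge> 1 \<Longrightarrow> zeta p ^ p = 1"
  by (simp add: zeta_def flip: exp_of_nat_mult)

lemma letter_weight_power: "p \<ge> 1 \<Longrightarrow> letter_weight p l ^ p = 1"
  by (cases l) (simp_all add: zeta_power power_inverse)

text \<open>Only two weights occur, inverse to each other. Opposite weights cancel with
  \<open>q = 1\<close>, equal ones with \<open>q = p - 1\<close>.\<close>

lemma letter_weight_cancel:
  assumes "p \<ge> 1"
  shows "\<exists>q. letter_weight p l * letter_weight p l' ^ q = 1"
proof -
  have "zeta p \<noteq> 0" by (simp add: zeta_def)
  then have "letter_weight p l = letter_weight p l' \<or> letter_weight p l * letter_weight p l' ^ 1 = 1"
    by (cases l; cases l') auto
  moreover have "letter_weight p l' * letter_weight p l' ^ (p - 1) = 1"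
    using letter_weight_power[OF assms, of l'] assms by (simp flip: power_Suc)
  ultimately show ?thesis by metis
qed

text \<open>For \<open>T = D + \<mu>\<close>, the operator \<open>T\<^sup>p - \<mu>\<^sup>p\<close> is a nonzero multiple of \<open>D\<close> modulo higher powers
  of \<open>D\<close>. As \<open>D\<close> is locally nilpotent, a subspace stable under \<open>T\<^sup>p\<close> is therefore stable under \<open>D\<close>.\<close>

locale shifted_annihilator =
  fixes l0 :: letter and \<mu> :: complex
  assumes annihilator: "annihilator l0" and nonzero: "\<mu> \<noteq> 0"
begin

definition D :: "fock \<Rightarrow> fock" where "D v = gen l0 \<bullet> v"

definition T :: "fock \<Rightarrow> fock" where "T v = D v + \<mu> *\<^sub>F v"

text \<open>The space of remainders in expansions in powers of D: membership in
  \<open>tail i v\<close> plays the part of an error term of order D^i.\<close>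

definition tail :: "nat \<Rightarrow> fock \<Rightarrow> fock set" where
  "tail i v = fock.span {(D ^^ j) v | j. i \<le> j}"

lemma D_add: "D (u + v) = D u + D v" and D_scale: "D (c *\<^sub>F v) = c *\<^sub>F D v"
  and D_0: "D 0 = 0"
  by (simp_all add: D_def fock_act_add_right fock_act_scale fock_act_zero_right)

lemma T_add: "T (u + v) = T u + T v" and T_scale: "T (c *\<^sub>F v) = c *\<^sub>F T v"
  by (simp_all add: T_def D_add D_scale fock.scale_right_distrib mult.commute add_ac)

lemma D_power_degree: "fock_degree d v \<Longrightarrow> d < N \<Longrightarrow> (D ^^ N) v = 0"
proof (induction N arbitrary: d v)
  case (Suc N)
  have zero: "(D ^^ N) 0 = 0" for N by (induction N) (simp_all add: D_0)
  show ?case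
  proof (cases d)
    case 0
    then have "D v = 0"
      using fock_degree_annihilate[OF annihilator Suc.prems(1)] by (simp add: D_def)
    then show ?thesis by (simp add: funpow_Suc_right zero del: funpow.simps)
  next
    case (Suc d')
    then have "(D ^^ N) (D v) = 0"
      using fock_degree_annihilate[OF annihilator Suc.prems(1)] Suc.prems(2)
      by (intro Suc.IH[of d']) (simp_all add: D_def)
    then show ?thesis by (simp add: funpow_Suc_right del: funpow.simps)
  qed
qed simp

lemma D_nilpotent: obtains N where "\<And>i. N \<le> i \<Longrightarrow> (D ^^ i) v = 0"
  using fock_degree_exists[of v] D_power_degree by (meson Suc_le_lessD)

lemma tail_base: "i \<le> j \<Longrightarrow> (D ^^ j) v \<in> tail i v"
  unfolding tail_def by (rule fock.span_base) blast

lemma tail_add: "x \<in> tail i v \<Longrightarrow> y \<in> tail i v \<Longrightarrow> x + y \<in> tail i v"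
  and tail_scale: "x \<in> tail i v \<Longrightarrow> c *\<^sub>F x \<in> tail i v"
  and tail_0: "0 \<in> tail i v"
  unfolding tail_def by (simp_all add: fock.span_add fock.span_scale fock.span_zero)

lemma tail_mono: "i \<le> j \<Longrightarrow> tail j v \<subseteq> tail i v"
  unfolding tail_def by (intro fock.span_mono) auto

lemma tail_D: "x \<in> tail i v \<Longrightarrow> D x \<in> tail (Suc i) v"
  unfolding tail_def
proof (induction rule: fock.span_induct)
  case base
  show ?case
    by (intro fock.subspaceI) (auto simp: D_0 D_add D_scale fock.span_zero fock.span_add fock.span_scale)
next
  case (step x)
  then obtain j where "x = (D ^^ j) v" "i \<le> j" by blast
  then have "D x = (D ^^ Suc j) v" "Suc i \<le> Suc j" by simp_all
  then show ?case by (intro fock.span_base) blast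
qed

lemma tail_T: "x \<in> tail i v \<Longrightarrow> T x \<in> tail i v"
  using tail_D[of x i v] tail_mono[of i "Suc i" v] by (auto simp: T_def intro: tail_add tail_scale)

lemma tail_funpow: "tail i ((D ^^ j) v) \<subseteq> tail (i + j) v"
  unfolding tail_def
proof (rule fock.span_mono, rule subsetI)
  fix x assume "x \<in> {(D ^^ k) ((D ^^ j) v) |k. i \<le> k}"
  then obtain k where "x = (D ^^ (k + j)) v" "i + j \<le> k + j" by (auto simp: funpow_add)
  then show "x \<in> {(D ^^ k) v |k. i + j \<le> k}" by blast
qed

text \<open>The binomial expansion of (D + \<mu>)^s, kept to first order in D.\<close>

lemma T_power:
  "\<exists>y\<in>tail 2 v. (T ^^ s) v = \<mu> ^ s *\<^sub>F v + (of_nat s * \<mu> ^ (s - 1)) *\<^sub>F D v + y"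
proof (induction s)
  case 0
  show ?case by (auto intro: tail_0)
next
  case (Suc s)
  then obtain y where y: "y \<in> tail 2 v"
    "(T ^^ s) v = \<mu> ^ s *\<^sub>F v + (of_nat s * \<mu> ^ (s - 1)) *\<^sub>F D v + y" by blast
  have DD: "D (D v) \<in> tail 2 v" using tail_base[of 2 2 v] by (simp add: numeral_2_eq_2)
  define a where "a = of_nat s * \<mu> ^ (s - 1)"
  have "(T ^^ Suc s) v = \<mu> ^ Suc s *\<^sub>F v + (\<mu> ^ s + a * \<mu>) *\<^sub>F D v + (a *\<^sub>F D (D v) + T y)"
    by (simp add: y(2)[folded a_def] T_add T_scale)
      (simp add: T_def fock.scale_right_distrib fock.scale_left_distrib mult.commute add_ac)
  moreover have "\<mu> ^ s + a * \<mu> = of_nat (Suc s) * \<mu> ^ (Suc s - 1)"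
    by (cases s) (simp_all add: a_def distrib_right)
  ultimately have "(T ^^ Suc s) v = \<mu> ^ Suc s *\<^sub>F v + (of_nat (Suc s) * \<mu> ^ (Suc s - 1)) *\<^sub>F D v +
    (a *\<^sub>F D (D v) + T y)"
    by (simp only:)
  then show ?case using y(1) DD by (blast intro: tail_add tail_scale tail_T)
qed

lemma T_power_leading: "\<exists>y\<in>tail 1 v. (T ^^ s) v = \<mu> ^ s *\<^sub>F v + y"
proof -
  obtain y where "y \<in> tail 2 v"
    "(T ^^ s) v = \<mu> ^ s *\<^sub>F v + (of_nat s * \<mu> ^ (s - 1)) *\<^sub>F D v + y"
    using T_power by blast
  moreover have "D v \<in> tail 1 v" using tail_base[of 1 1 v] by simp
  ultimately show ?thesis
    using tail_mono[of 1 2 v] by (auto simp: add.assoc intro!: tail_add tail_scale)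
qed

context
  fixes U :: "fock set" and p :: nat
  assumes U: "fock.subspace U" and p: "p \<ge> 1" and TpU: "\<And>u. u \<in> U \<Longrightarrow> (T ^^ p) u \<in> U"
begin

text \<open>The coefficient of D in T^p, nonzero because \<open>p\<close> is positive and \<mu> is
  not 0.\<close>

private definition c :: complex where "c = of_nat p * \<mu> ^ (p - 1)"

private definition E :: "fock \<Rightarrow> fock" where "E u = (T ^^ p) u - \<mu> ^ p *\<^sub>F u"

private lemma Tp_linear: "(T ^^ q) (u + v) = (T ^^ q) u + (T ^^ q) v" "(T ^^ q) (e *\<^sub>F v) = e *\<^sub>F (T ^^ q) v"
  by (induction q) (simp_all add: T_add T_scale)

private lemma E_linear: "E (u + v) = E u + E v" "E (e *\<^sub>F v) = e *\<^sub>F E v"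
  by (simp_all add: E_def Tp_linear fock.scale_right_distrib fock.scale_right_diff_distrib mult.commute)

private lemma E_expand: "\<exists>y\<in>tail 2 v. E v = c *\<^sub>F D v + y"
  using T_power[of v p] by (auto simp: E_def c_def add.assoc)

private lemma tail_E: "x \<in> tail i v \<Longrightarrow> E x \<in> tail (Suc i) v"
  unfolding tail_def
proof (induction rule: fock.span_induct)
  case base
  have "E 0 = 0" using E_linear(2)[of 0 0] by simp
  then show ?case
    by (intro fock.subspaceI) (auto simp: E_linear fock.span_zero fock.span_add fock.span_scale)
next
  case (step x)
  then obtain j where j: "x = (D ^^ j) v" "i \<le> j" by blast
  obtain y where y: "y \<in> tail 2 x" "E x = c *\<^sub>F D x + y" using E_expand by blast
  have "y \<in> tail (Suc i) v"
    using y(1) tail_funpow[of 2 j v] tail_mono[of "Suc i" "2 + j" v] j by auto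
  moreover have "D x \<in> tail (Suc i) v" using j tail_base[of "Suc i" "Suc j" v] by simp
  ultimately have "E x \<in> tail (Suc i) v" unfolding y(2) by (intro tail_add tail_scale)
  then show ?case by (simp add: tail_def)
qed

text \<open>Since E is cD plus terms of higher order, its powers isolate the powers of D one by one,
  up to an error of the next order.\<close>

private lemma E_power: "\<exists>y\<in>tail (Suc i) v. (E ^^ i) v = c ^ i *\<^sub>F (D ^^ i) v + y"
proof (induction i)
  case 0
  show ?case by (auto intro: tail_0)
next
  case (Suc i)
  then obtain y where y: "y \<in> tail (Suc i) v" "(E ^^ i) v = c ^ i *\<^sub>F (D ^^ i) v + y" by blast
  obtain z where z: "z \<in> tail 2 ((D ^^ i) v)" "E ((D ^^ i) v) = c *\<^sub>F D ((D ^^ i) v) + z"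
    using E_expand by blast
  have "z \<in> tail (Suc (Suc i)) v" using z(1) tail_funpow[of 2 i v] by auto
  then have "c ^ i *\<^sub>F z + E y \<in> tail (Suc (Suc i)) v"
    using tail_E[OF y(1)] by (intro tail_add tail_scale)
  moreover have "(E ^^ Suc i) v = c ^ Suc i *\<^sub>F (D ^^ Suc i) v + (c ^ i *\<^sub>F z + E y)"
    by (simp add: y(2) E_linear z(2) fock.scale_right_distrib mult.commute add_ac)
  ultimately show ?case by blast
qed

text \<open>Downward induction on \<open>i\<close>, starting where D^i u = 0. The error term of E^i
  u involves only higher powers of D, already in \<open>U\<close>; as E preserves \<open>U\<close>,
  subtracting and dividing by c^i leaves D^i u.\<close>

lemma D_power_mem:
  assumes "u \<in> U" shows "(D ^^ i) u \<in> U"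
proof -
  obtain N where N: "\<And>i. N \<le> i \<Longrightarrow> (D ^^ i) u = 0" using D_nilpotent by blast
  have EU: "(E ^^ i) u \<in> U" for i
    by (induction i) (auto simp: assms E_def intro: fock.subspace_diff[OF U] fock.subspace_scale[OF U] TpU)
  have c: "c \<noteq> 0" using p nonzero by (simp add: c_def)
  have "N \<le> i + m \<Longrightarrow> (D ^^ i) u \<in> U" for m i
  proof (induction m arbitrary: i)
    case 0
    then show ?case using N by (simp add: fock.subspace_0[OF U])
  next
    case (Suc m)
    have "tail (Suc i) u \<subseteq> U"
      unfolding tail_def
      by (rule fock.span_minimal[OF _ U]) (use Suc in \<open>auto simp del: funpow.simps\<close>)
    then obtain y where "y \<in> U" "(E ^^ i) u = c ^ i *\<^sub>F (D ^^ i) u + y" using E_power by blast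
    then have "c ^ i *\<^sub>F (D ^^ i) u \<in> U" using fock.subspace_diff[OF U EU[of i]] by fastforce
    then have "(1 / c ^ i) *\<^sub>F c ^ i *\<^sub>F (D ^^ i) u \<in> U" by (rule fock.subspace_scale[OF U])
    then show ?case using c by simp
  qed
  from this[of i N] show ?thesis by simp
qed

text \<open>\<open>T\<close> is invertible on \<open>U\<close>, so \<open>F = (F T\<^sup>q) T\<^bsup>-q\<^esup>\<close>; the inverse is avoided by a downward induction
  on the powers of \<open>D\<close>.\<close>

lemma operator_mem:
  assumes F: "\<And>u v. F (u + v) = F u + F v" "\<And>e v. F (e *\<^sub>F v) = e *\<^sub>F F v"
    and FT: "\<And>u. u \<in> U \<Longrightarrow> F ((T ^^ q) u) \<in> U" and u: "u \<in> U"
  shows "F u \<in> U"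
proof -
  obtain N where N: "\<And>i. N \<le> i \<Longrightarrow> (D ^^ i) u = 0" using D_nilpotent by blast
  have F0: "F 0 = 0" using F(2)[of 0 0] by simp
  have "N \<le> i + m \<Longrightarrow> F ((D ^^ i) u) \<in> U" for m i
  proof (induction m arbitrary: i)
    case 0
    then show ?case using N by (simp add: F0 fock.subspace_0[OF U])
  next
    case (Suc m)
    have "tail (Suc i) u \<subseteq> {x. F x \<in> U}"
      unfolding tail_def
    proof (rule fock.span_minimal)
      show "fock.subspace {x. F x \<in> U}"
        by (rule fock.subspaceI) (auto simp: F F0 fock.subspace_0[OF U]
          intro: fock.subspace_add[OF U] fock.subspace_scale[OF U])
    qed (use Suc in \<open>auto simp del: funpow.simps\<close>)
    then have tail: "F x \<in> U" if "x \<in> tail (Suc i) u" for x using that by blast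
    obtain y where y: "y \<in> tail 1 ((D ^^ i) u)" "(T ^^ q) ((D ^^ i) u) = \<mu> ^ q *\<^sub>F (D ^^ i) u + y"
      using T_power_leading by blast
    have "F y \<in> U" using y(1) tail_funpow[of 1 i u] tail by auto
    moreover have "\<mu> ^ q *\<^sub>F F ((D ^^ i) u) + F y \<in> U"
      using FT[OF D_power_mem[OF u, of i]] unfolding y(2) by (simp add: F)
    ultimately have "\<mu> ^ q *\<^sub>F F ((D ^^ i) u) \<in> U" using fock.subspace_diff[OF U] by fastforce
    then have "(1 / \<mu> ^ q) *\<^sub>F \<mu> ^ q *\<^sub>F F ((D ^^ i) u) \<in> U" by (rule fock.subspace_scale[OF U])
    then show ?case using nonzero by simp
  qed
  from this[of 0 N] show ?thesis by simp
qed

end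

end

section \<open>From stability under the fixed points to stability under the Weyl algebra\<close>

lemma gen_stable_subspace:
  assumes U: "fock.subspace U" and gen: "\<And>l u. u \<in> U \<Longrightarrow> gen l \<bullet> u \<in> U"
  shows "U = {0} \<or> U = UNIV"
proof (cases "U = {0}")
  case False
  then obtain u where u: "u \<in> U" "u \<noteq> 0" using fock.subspace_0[OF U] by blast
  have act: "x \<bullet> u \<in> U" if "u \<in> U" for x u
    by (induction x rule: weyl_induct)
      (auto simp: fock_act_const fock_act_add_left fock_act_mult that gen
        intro: fock.subspace_scale[OF U] fock.subspace_add[OF U])
  obtain x where "x \<bullet> u = fock_vac" using fock_reaches_vac[OF u(2)] by blast
  then have "fock_vac \<in> U" using act[OF u(1)] by metis
  then have "v \<in> U" for v by (cases v rule: fock_cases) (auto intro: act)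
  then show ?thesis by auto
qed simp

context fock_vertex_algebra
begin

theorem rotation_fixed_irreducible:
  assumes Z: "is_module Z"
    and Zl: "\<And>l w. Z (letter_vector l) (letter_mode l) w = gen l \<bullet> w + s l *\<^sub>F w"
    and p: "p \<ge> 1" and l0: "annihilator l0" "s l0 \<noteq> 0"
    and U: "fock.subspace U"
    and stable: "\<And>v n u. rotate p v = v \<Longrightarrow> u \<in> U \<Longrightarrow> Z v n u \<in> U"
  shows "U = {0} \<or> U = UNIV"
proof -
  interpret shifted_annihilator l0 "s l0" by unfold_locales (fact l0)+
  define TT where "TT l w = Z (letter_vector l) (letter_mode l) w" for l w
  have T: "T w = TT l0 w" for w by (simp add: T_def D_def TT_def Zl)
  have step: "TT l x \<in> rotation_span p Z (letter_weight p l * \<kappa>) w"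
    if "x \<in> rotation_span p Z \<kappa> w" for l x \<kappa> w
    unfolding TT_def by (rule rotation_span_step[OF Z rotate_letter_vector that])
  \<comment> \<open>The vacuum is fixed by the rotation, and its mode -1 is the identity.\<close>
  have start: "w \<in> rotation_span p Z 1 w" for w
  proof -
    have "w = Z fock_vac (- 1) w" using Z by (simp add: is_module_def)
    then show ?thesis unfolding rotation_span_def
      by (intro fock.span_base) (metis (mono_tags, lifting) fock.scale_one mem_Collect_eq rotate_vac)
  qed
  have powers: "(T ^^ q) w \<in> rotation_span p Z (letter_weight p l0 ^ q) w" for q w
    by (induction q) (auto simp: start T intro: step)
  have span_U: "rotation_span p Z 1 u \<subseteq> U" if "u \<in> U" for u
    unfolding rotation_span_def
    by (rule fock.span_minimal[OF _ U]) (auto intro: stable that)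
  have TpU: "(T ^^ p) u \<in> U" if "u \<in> U" for u
    using powers[of p u] span_U[OF that] by (auto simp: letter_weight_power[OF p])
  have "gen l \<bullet> u \<in> U" if u: "u \<in> U" for l u
  proof -
    obtain q where q: "letter_weight p l * letter_weight p l0 ^ q = 1"
      using letter_weight_cancel[OF p] by blast
    have "TT l u \<in> U"
    proof (rule operator_mem[OF U p TpU _ _ _ u, where q = q])
      have "fock_field (Z (letter_vector l))"
        using Z fock_map_field by (auto simp: is_module_def)
      then show "TT l (x + y) = TT l x + TT l y" "TT l (e *\<^sub>F x) = e *\<^sub>F TT l x" for x y e
        by (simp_all add: TT_def fock_field_def)
      show "TT l ((T ^^ q) x) \<in> U" if "x \<in> U" for x
        using step[OF powers[of q x], of l] span_U[OF that] by (auto simp: q)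
    qed
    then have "TT l u - s l *\<^sub>F u \<in> U"
      using u by (intro fock.subspace_diff[OF U] fock.subspace_scale[OF U])
    then show ?thesis by (simp add: TT_def Zl)
  qed
  with U show ?thesis by (rule gen_stable_subspace)
qed

end


section \<open>Orbifolds\<close>

context weyl_vertex_algebra
begin

lemma vertex_model_act_vac: "act x vac = vertex_model (x \<bullet> fock_vac)"
  by (simp add: vertex_model_act vertex_model_vac)

text \<open>Uniqueness for the definite description: in the faithful model the vector determines
  \<open>y \<bullet> fock_vac\<close>, and the rotation depends on that vector alone.\<close>

lemma orbifold_automorphism_model:
  "orbifold_automorphism p act vac (vertex_model v) = vertex_model (rotate p v)"
proof -
  obtain x where x: "v = x \<bullet> fock_vac" by (rule fock_cases)
  show ?thesis
    unfolding orbifold_automorphism_def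
  proof (rule the_equality)
    show "\<exists>x. vertex_model v = act x vac \<and> vertex_model (rotate p v) = act (weyl_rotation p x) vac"
      by (intro exI[of _ x]) (simp add: x vertex_model_act_vac rotate_act rotate_vac)
  next
    fix u assume "\<exists>x. vertex_model v = act x vac \<and> u = act (weyl_rotation p x) vac"
    then obtain y where "v = y \<bullet> fock_vac" "u = vertex_model (weyl_rotation p y \<bullet> fock_vac)"
      by (auto simp: vertex_model_act_vac vertex_model_inject)
    then show "u = vertex_model (rotate p v)" by (simp add: rotate_act rotate_vac)
  qed
qed

lemma fock_model_orbifold: "fock_model {v. rotate p v = v} vertex_model (orbifold p M act vac)"
proof -
  interpret V: fock_model UNIV vertex_model M by (rule fock_model_vertex)
  show ?thesis
  proof
    show "carrier (orbifold p M act vac) = vertex_model ` {v. rotate p v = v}"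
      by (auto simp: orbifold_def V.carrier orbifold_automorphism_model vertex_model_inject)
    show "inj_on vertex_model {v. rotate p v = v}"
      using V.inj by (rule inj_on_subset) simp
  qed (simp_all add: rotate_0 rotate_add rotate_scale orbifold_def V.map_zero V.map_add V.map_scale)
qed

lemma orbifold_model_vertex:
  "vertex_operators_model {v. rotate p v = v} vertex_model (orbifold p M act vac)
    {v. rotate p v = v} vertex_model (orbifold p M act vac) Y fock_vertex"
  by (intro vertex_operators_model.intro fock_model_orbifold vertex_operators_model_axioms.intro)
    (simp_all add: vertex_model_fock_vertex FV.rotate_Y)

lemma vertex_algebra_orbifold: "vertex_algebra (orbifold p M act vac) vac Y"
proof -
  let ?O = "orbifold p M act vac"
  interpret O: vertex_operators_model "{v. rotate p v = v}" vertex_model ?O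
    "{v. rotate p v = v}" vertex_model ?O Y fock_vertex
    by (rule orbifold_model_vertex)
  have carrier: "v \<in> carrier M" if "v \<in> carrier ?O" for v
    using that by (simp add: orbifold_def)
  have zero: "\<zero>\<^bsub>?O\<^esub> = \<zero>\<^bsub>M\<^esub>" by (simp add: orbifold_def)
  show ?thesis
  proof (intro vertex_algebra.intro vertex_algebra_axioms.intro)
    show "vertex_operators ?O ?O Y" by (rule O.vertex_operators_record[OF FV.Y_map])
    have "vertex_model fock_vac \<in> carrier ?O" by (simp add: O.V.carrier rotate_vac)
    then show "vac \<in> carrier ?O" by (simp add: vertex_model_vac)
    show "jacobi_identity ?O Y ?O Y"
      using FV.Y_jacobi unfolding O.jacobi_identity_iff[OF orbifold_model_vertex] fock_jacobi_def
      by blast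
  qed (simp_all add: carrier zero vacuum creation creation_regular)
qed

theorem orbifold_irreducible:
  assumes W: "natural_weak_module M act vac Y
      (whittaker_module n lam mu) (whittaker_act n lam mu) YW"
    and p: "p \<ge> 1"
    and character: "(\<exists>k. k \<le> n \<and> lam k \<noteq> 0) \<or> (\<exists>k. 1 \<le> k \<and> k \<le> n \<and> mu k \<noteq> 0)"
  shows "irreducible_weak_module (orbifold p M act vac) vac Y (whittaker_module n lam mu) YW"
proof -
  let ?s = "whittaker_shift n lam mu" and ?\<psi> = "whittaker_model n lam mu"
    and ?W = "whittaker_module n lam mu" and ?O = "orbifold p M act vac"
    and ?F = "{v. rotate p v = v}"
  have weak: "weak_module M vac Y ?W YW" using W by (simp add: natural_weak_module_def)
  then have vops: "vertex_operators M ?W YW" by (simp add: weak_module_def)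
  interpret Wm: fock_model UNIV ?\<psi> ?W by (rule fock_model_whittaker)
  have inj: "?\<psi> u = ?\<psi> v \<longleftrightarrow> u = v" for u v by (rule inj_eq[OF Wm.inj])
  have closed: "?\<psi> w \<in> carrier ?W" for w by (simp add: Wm.carrier)
  \<comment> \<open>The given structure is arbitrary. It is pulled back to the Fock space, where its
    values on the two generating vectors are then identified.\<close>
  define Z where "Z u k w = inv_into UNIV ?\<psi> (YW (vertex_model u) k (?\<psi> w))" for u k w
  have \<psi>Z: "?\<psi> (Z u k w) = YW (vertex_model u) k (?\<psi> w)" for u k w
    using vertex_operators.closed[OF vops vertex_model_closed closed]
    unfolding Z_def Wm.carrier by (rule f_inv_into_f)
  interpret VW: vertex_operators_model UNIV vertex_model M UNIV ?\<psi> ?W YW Z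
    by (intro vertex_operators_model.intro fock_model_vertex fock_model_whittaker
        vertex_operators_model_axioms.intro) (simp_all add: \<psi>Z)
  have map: "fock_map Z" by (rule VW.fock_map_of_record[OF vops refl refl])
  have Z: "FV.is_module Z"
    unfolding FV.is_module_def
  proof (intro conjI allI map)
    fix k w
    show "Z fock_vac k w = (if k = - 1 then w else 0)"
      using weak_module.module_vacuum[OF weak closed[of w], of k]
      by (simp add: \<psi>Z vertex_model_vac Wm.map_zero flip: inj)
    show "fock_jacobi fock_vertex Z"
      using weak_module.module_jacobi[OF weak]
      unfolding VW.jacobi_identity_iff[OF vertex_operators_model_vertex] fock_jacobi_def by blast
  qed
  have shift: "weyl_shift ?s (gen l) \<bullet> w = gen l \<bullet> w + ?s l *\<^sub>F w" for l w
    by (simp add: weyl_shift_gen fock_act_add_left fock_act_const)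
  have Zl: "Z (letter_vector l) (letter_mode l) w = gen l \<bullet> w + ?s l *\<^sub>F w" for l w
  proof -
    have "YW (vertex_model (letter_vector l)) (letter_mode l) (?\<psi> w) =
      whittaker_act n lam mu (gen l) (?\<psi> w)"
    proof (cases l)
      case (A k)
      then show ?thesis
        using natural_weak_module.module_field_a[OF W closed[of w], of k]
        by (simp add: vertex_model_act vertex_model_vac gen.simps)
    next
      case (As k)
      then show ?thesis
        using natural_weak_module.module_field_as[OF W closed[of w], of "k - 1"]
        by (simp add: vertex_model_act vertex_model_vac gen.simps)
    qed
    also have "\<dots> = ?\<psi> (gen l \<bullet> w + ?s l *\<^sub>F w)"
      by (simp only: shift flip: whittaker_model_act)
    finally show ?thesis by (simp add: \<psi>Z flip: inj)
  qed
  have "\<exists>l. annihilator l \<and> ?s l \<noteq> 0"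
    using character
  proof (elim disjE exE conjE)
    fix k assume "k \<le> n" "lam k \<noteq> 0"
    then show ?thesis by (intro exI[of _ "A (int k)"]) simp
  next
    fix k assume "1 \<le> k" "k \<le> n" "mu k \<noteq> 0"
    then show ?thesis by (intro exI[of _ "As (int k)"]) simp
  qed
  then obtain l0 where l0: "annihilator l0" "?s l0 \<noteq> 0" by blast
  \<comment> \<open>The same pulled-back operators, now with the acting vectors restricted to the
    fixed space.\<close>
  interpret OW: vertex_operators_model ?F vertex_model ?O UNIV ?\<psi> ?W YW Z
    by (intro vertex_operators_model.intro fock_model_orbifold fock_model_whittaker
        vertex_operators_model_axioms.intro) (simp_all add: \<psi>Z)
  have weak_O: "weak_module ?O vac Y ?W YW"
  proof (intro weak_module.intro weak_module_axioms.intro vertex_algebra_orbifold)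
    show "vertex_operators ?O ?W YW" by (rule OW.vertex_operators_record[OF map])
    show "jacobi_identity ?O Y ?W YW"
      using Z unfolding OW.jacobi_identity_iff[OF orbifold_model_vertex] FV.is_module_def fock_jacobi_def
      by blast
  qed (rule weak_module.module_vacuum[OF weak])
  show ?thesis
  proof (intro irreducible_weak_module.intro irreducible_weak_module_axioms.intro weak_O)
    have "fock_vac \<noteq> 0"
      using vac_nonzero VW.V.map_zero by (metis vertex_model_vac)
    then have "?\<psi> fock_vac \<noteq> \<zero>\<^bsub>?W\<^esub>" by (simp add: Wm.map_eq_zero)
    then show "carrier ?W \<noteq> {\<zero>\<^bsub>?W\<^esub>}" using closed[of fock_vac] by blast
  next
    fix U assume U: "submodule U complex_field ?W"
      and stable: "\<And>v k u. v \<in> carrier ?O \<Longrightarrow> u \<in> U \<Longrightarrow> YW v k u \<in> U"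
    note sub = Module.module.submoduleE[OF Wm.module_W U]
    have U_zero: "\<zero>\<^bsub>?W\<^esub> \<in> U"
    proof -
      obtain u where u: "u \<in> U" using sub(2) by blast
      then obtain w where w: "u = ?\<psi> w" using sub(1) by (auto simp: Wm.carrier)
      have "?\<psi> (0 *\<^sub>F w) \<in> U" unfolding Wm.map_scale[OF UNIV_I] using sub(4)[of 0 u] u w by simp
      then show ?thesis by (simp add: Wm.map_zero)
    qed
    have image: "U = ?\<psi> ` (?\<psi> -` U)" using sub(1) by (auto simp: Wm.carrier)
    have "?\<psi> -` U = {0} \<or> ?\<psi> -` U = UNIV"
    proof (rule FV.rotation_fixed_irreducible[OF Z Zl p l0])
      show "fock.subspace (?\<psi> -` U)"
        by (rule fock.subspaceI) (simp_all add: Wm.map_zero Wm.map_add Wm.map_scale U_zero sub(4,5))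
      show "Z v k u \<in> ?\<psi> -` U" if "rotate p v = v" "u \<in> ?\<psi> -` U" for v k u
        using that stable[of "vertex_model v" "?\<psi> u" k] by (simp add: \<psi>Z OW.V.carrier)
    qed
    then show "U = {\<zero>\<^bsub>?W\<^esub>} \<or> U = carrier ?W"
      using image Wm.map_zero Wm.carrier by (metis image_empty image_insert)
  qed
qed

end

text \<open>Existence keeps the universal statement from being vacuous. Irreducibility is proved for
  every structure extending the two generating fields, so it does not depend on the one constructed
  by twisting.\<close>

theorem theorem3:
  fixes M :: "(complex, 'm) module" and act :: "weyl \<Rightarrow> 'm \<Rightarrow> 'm"
    and vac :: 'm and Y :: "'m \<Rightarrow> int \<Rightarrow> 'm \<Rightarrow> 'm"
    and n p :: nat and lam mu :: "nat \<Rightarrow> complex"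
  assumes "weyl_vertex_algebra M act vac Y"
    and "n \<ge> 1"
    and "(\<exists>k. k \<le> n \<and> lam k \<noteq> 0) \<or> (\<exists>k. 1 \<le> k \<and> k \<le> n \<and> mu k \<noteq> 0)"
    and "p \<ge> 1"
  shows "(\<exists>YW. natural_weak_module M act vac Y
            (whittaker_module n lam mu) (whittaker_act n lam mu) YW) \<and>
    (\<forall>YW. natural_weak_module M act vac Y
            (whittaker_module n lam mu) (whittaker_act n lam mu) YW \<longrightarrow>
          irreducible_weak_module (orbifold p M act vac) vac Y (whittaker_module n lam mu) YW)"
proof -
  interpret weyl_vertex_algebra M act vac Y by (rule assms(1))
  show ?thesis
    using natural_weak_module_exists orbifold_irreducible[OF _ assms(4,3)] by blast
qed

end
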